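(* Let $k$ be an algebraically closed field, $G$ a finite group with $\mathrm{char}(k)\nmid |G|$, $X$ an integral scheme over $k$ with rational function field $K$ and generic point $\epsilon$, and let $\mathcal{E}$ be a torsion-free coherent $\mathcal{O}_X[G]$-module. Let $V_0,\dots,V_r$ be the irreducible representations of $G$ over $k$ (up to isomorphism) and let $e_0,\dots,e_r\in k[G]$ be the corresponding central idempotents. If $\mathcal{E}_\epsilon\simeq (V_0^{n_0}\oplus\cdots\oplus V_r^{n_r})\otimes_k K$ as a representation of $G$ over $K$, then the natural decomposition $\mathcal{E}=e_0\mathcal{E}\oplus\cdots\oplus e_r\mathcal{E}$ satisfies, for each $i$: (i) $\mathrm{rank}(e_i\mathcal{E})=n_i\cdot\dim(V_i)$; (ii) the natural inclusion $e_i\mathcal{E}\hookrightarrow\mathcal{E}$ induces an isomorphism of representations of $G$ over $K$ from $(e_i\mathcal{E})_\epsilon$ onto $V_i^{n_i}\otimes_k K$.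
   Context: An $\mathcal{O}_X[G]$-module is an $\mathcal{O}_X$-module $\mathcal{E}$ together with a $k$-algebra homomorphism $\rho:k[G]\to \mathrm{End}(\mathcal{E})$ (equivalently, an $\mathcal{O}_X$-linear action of $G$ on $\mathcal{E}$). It is called coherent or torsion-free if it is so as an $\mathcal{O}_X$-module. The idempotents satisfy $e_ie_j=\delta_{ij}e_i$, $e_0+\cdots+e_r=1$, and for every finitely generated $k[G]$-module $M$, $e_iM$ is the $V_i$-isotypical component of $M$ (isomorphic to a power of $V_i$). $e_i\mathcal{E}$ denotes the image of $\rho(e_i)$. The rank of a coherent sheaf on $X$ is the dimension over $K$ of its stalk at $\epsilon$. *)

theory Defs
  imports
    "HOL-Algebra.Algebra"
    "HOL-Analysis.Abstract_Topology"
    "Jordan_Normal_Form.Missing_VectorSpace"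
begin

hide_const (open) Multiset.mult

section \<open>Sheaves of sets and stalks\<close>

text \<open>A presheaf of sets on a topology \<open>T\<close> is a family \<open>F\<close> of sets together with restriction maps
  \<open>r U V\<close> from \<open>F U\<close> to \<open>F V\<close>; only the values on open \<open>V \<subseteq> U\<close> matter.\<close>

definition presheaf :: "'x topology \<Rightarrow> ('x set \<Rightarrow> 's set) \<Rightarrow> ('x set \<Rightarrow> 'x set \<Rightarrow> 's \<Rightarrow> 's) \<Rightarrow> bool" where
  "presheaf T F r \<longleftrightarrow>
     (\<forall>U V. openin T U \<and> openin T V \<and> V \<subseteq> U \<longrightarrow> r U V \<in> F U \<rightarrow> F V) \<and>
     (\<forall>U. openin T U \<longrightarrow> (\<forall>s\<in>F U. r U U s = s)) \<and>
     (\<forall>U V W. openin T U \<and> openin T V \<and> openin T W \<and> W \<subseteq> V \<and> V \<subseteq> U \<longrightarrow>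
        (\<forall>s\<in>F U. r V W (r U V s) = r U W s))"

text \<open>Families to be glued are indexed by the members of the cover. This is no restriction: two
  compatible sections over the same open set coincide. The empty cover forces \<open>F {}\<close> to be a
  singleton.\<close>

definition sheaf :: "'x topology \<Rightarrow> ('x set \<Rightarrow> 's set) \<Rightarrow> ('x set \<Rightarrow> 'x set \<Rightarrow> 's \<Rightarrow> 's) \<Rightarrow> bool" where
  "sheaf T F r \<longleftrightarrow> presheaf T F r \<and>
     (\<forall>\<U>. (\<forall>U\<in>\<U>. openin T U) \<longrightarrow>
        (\<forall>s\<in>F (\<Union>\<U>). \<forall>t\<in>F (\<Union>\<U>). (\<forall>U\<in>\<U>. r (\<Union>\<U>) U s = r (\<Union>\<U>) U t) \<longrightarrow> s = t) \<and>
        (\<forall>f. (\<forall>U\<in>\<U>. f U \<in> F U) \<and>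
             (\<forall>U\<in>\<U>. \<forall>V\<in>\<U>. r U (U \<inter> V) (f U) = r V (U \<inter> V) (f V)) \<longrightarrow>
             (\<exists>s\<in>F (\<Union>\<U>). \<forall>U\<in>\<U>. r (\<Union>\<U>) U s = f U)))"

text \<open>Germs at \<open>x\<close> are equivalence classes of pairs \<open>(U, s)\<close>.\<close>

definition germ ::
  "'x topology \<Rightarrow> ('x set \<Rightarrow> 's set) \<Rightarrow> ('x set \<Rightarrow> 'x set \<Rightarrow> 's \<Rightarrow> 's) \<Rightarrow> 'x \<Rightarrow> 'x set \<Rightarrow> 's \<Rightarrow> ('x set \<times> 's) set"
where
  "germ T F r x U s =
     {(V, t). openin T V \<and> x \<in> V \<and> t \<in> F V \<and>
              (\<exists>W. openin T W \<and> x \<in> W \<and> W \<subseteq> U \<inter> V \<and> r U W s = r V W t)}"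

definition germs ::
  "'x topology \<Rightarrow> ('x set \<Rightarrow> 's set) \<Rightarrow> ('x set \<Rightarrow> 'x set \<Rightarrow> 's \<Rightarrow> 's) \<Rightarrow> 'x \<Rightarrow> ('x set \<times> 's) set set"
where
  "germs T F r x = {germ T F r x U s | U s. openin T U \<and> x \<in> U \<and> s \<in> F U}"


section \<open>Locally ringed spaces\<close>

record ('x, 'a) ringed_space_data =
  pts :: "'x topology"
  Osec :: "'x set \<Rightarrow> 'a ring"
  Ores :: "'x set \<Rightarrow> 'x set \<Rightarrow> 'a \<Rightarrow> 'a"

locale ringed_space =
  fixes S :: "('x, 'a) ringed_space_data"
  assumes sections_cring: "openin (pts S) U \<Longrightarrow> cring (Osec S U)"
    and restriction_hom:
      "\<lbrakk>openin (pts S) U; openin (pts S) V; V \<subseteq> U\<rbrakk> \<Longrightarrow> Ores S U V \<in> ring_hom (Osec S U) (Osec S V)"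
    and structure_sheaf: "sheaf (pts S) (\<lambda>U. carrier (Osec S U)) (Ores S)"

abbreviation Ogerm :: "('x, 'a) ringed_space_data \<Rightarrow> 'x \<Rightarrow> 'x set \<Rightarrow> 'a \<Rightarrow> ('x set \<times> 'a) set" where
  "Ogerm S \<equiv> germ (pts S) (\<lambda>U. carrier (Osec S U)) (Ores S)"

text \<open>The ring operations are defined on representatives; as usual for quotients, the union over all
  representatives is a union of copies of a single class.\<close>

definition stalk_ring :: "('x, 'a) ringed_space_data \<Rightarrow> 'x \<Rightarrow> ('x set \<times> 'a) set ring" where
  "stalk_ring S x = \<lparr>
     carrier = germs (pts S) (\<lambda>U. carrier (Osec S U)) (Ores S) x,
     mult = (\<lambda>A B. \<Union>(U, s)\<in>A. \<Union>(V, t)\<in>B.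
       Ogerm S x (U \<inter> V) (Ores S U (U \<inter> V) s \<otimes>\<^bsub>Osec S (U \<inter> V)\<^esub> Ores S V (U \<inter> V) t)),
     one = Ogerm S x (topspace (pts S)) \<one>\<^bsub>Osec S (topspace (pts S))\<^esub>,
     ring.zero = Ogerm S x (topspace (pts S)) \<zero>\<^bsub>Osec S (topspace (pts S))\<^esub>,
     ring.add = (\<lambda>A B. \<Union>(U, s)\<in>A. \<Union>(V, t)\<in>B.
       Ogerm S x (U \<inter> V) (Ores S U (U \<inter> V) s \<oplus>\<^bsub>Osec S (U \<inter> V)\<^esub> Ores S V (U \<inter> V) t))\<rparr>"

definition local_ring :: "('a, 'm) ring_scheme \<Rightarrow> bool" where
  "local_ring R \<longleftrightarrow> cring R \<and> (\<exists>!m. maximalideal m R)"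

definition locally_ringed_space :: "('x, 'a) ringed_space_data \<Rightarrow> bool" where
  "locally_ringed_space S \<longleftrightarrow>
     ringed_space S \<and> (\<forall>x\<in>topspace (pts S). local_ring (stalk_ring S x))"

definition open_subspace :: "('x, 'a) ringed_space_data \<Rightarrow> 'x set \<Rightarrow> ('x, 'a) ringed_space_data" where
  "open_subspace S U = S\<lparr>pts := subtopology (pts S) U\<rparr>"

definition preim :: "('x, 'a) ringed_space_data \<Rightarrow> ('x \<Rightarrow> 'y) \<Rightarrow> 'y set \<Rightarrow> 'x set" where
  "preim S f V = {x \<in> topspace (pts S). f x \<in> V}"

text \<open>A morphism \<open>S \<rightarrow> Y\<close> is a continuous map \<open>f\<close> with ring homomorphisms
  \<open>\<phi> V\<close> from \<open>O\<^sub>Y(V)\<close> to \<open>O\<^sub>S(f\<^sup>-\<^sup>1 V)\<close>, inducing local homomorphisms on stalks.\<close>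

definition stalk_pullback ::
  "('x, 'a) ringed_space_data \<Rightarrow> ('x \<Rightarrow> 'y) \<Rightarrow> ('y set \<Rightarrow> 'b \<Rightarrow> 'a) \<Rightarrow> 'x \<Rightarrow> ('y set \<times> 'b) set \<Rightarrow> ('x set \<times> 'a) set"
where
  "stalk_pullback S f \<phi> x A = (\<Union>(V, t)\<in>A. Ogerm S x (preim S f V) (\<phi> V t))"

definition lrs_morphism ::
  "('x, 'a) ringed_space_data \<Rightarrow> ('y, 'b) ringed_space_data \<Rightarrow> ('x \<Rightarrow> 'y) \<Rightarrow> ('y set \<Rightarrow> 'b \<Rightarrow> 'a) \<Rightarrow> bool"
where
  "lrs_morphism S Y f \<phi> \<longleftrightarrow>
     continuous_map (pts S) (pts Y) f \<and>
     (\<forall>V. openin (pts Y) V \<longrightarrow> \<phi> V \<in> ring_hom (Osec Y V) (Osec S (preim S f V))) \<and>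
     (\<forall>V W. openin (pts Y) V \<and> openin (pts Y) W \<and> W \<subseteq> V \<longrightarrow>
        (\<forall>t\<in>carrier (Osec Y V). \<phi> W (Ores Y V W t) = Ores S (preim S f V) (preim S f W) (\<phi> V t))) \<and>
     (\<forall>x\<in>topspace (pts S). \<forall>A\<in>carrier (stalk_ring Y (f x)).
        stalk_pullback S f \<phi> x A \<in> Units (stalk_ring S x) \<longrightarrow> A \<in> Units (stalk_ring Y (f x)))"

definition lrs_isomorphism ::
  "('x, 'a) ringed_space_data \<Rightarrow> ('y, 'b) ringed_space_data \<Rightarrow> ('x \<Rightarrow> 'y) \<Rightarrow> ('y set \<Rightarrow> 'b \<Rightarrow> 'a) \<Rightarrow> bool"
where
  "lrs_isomorphism S Y f \<phi> \<longleftrightarrow>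
     lrs_morphism S Y f \<phi> \<and> homeomorphic_map (pts S) (pts Y) f \<and>
     (\<forall>V. openin (pts Y) V \<longrightarrow>
        bij_betw (\<phi> V) (carrier (Osec Y V)) (carrier (Osec S (preim S f V))))"


section \<open>Schemes\<close>

definition frac :: "('a, 'm) ring_scheme \<Rightarrow> 'a set \<Rightarrow> 'a \<Rightarrow> 'a \<Rightarrow> ('a \<times> 'a) set" where
  "frac A S a s =
     {(b, t). b \<in> carrier A \<and> t \<in> S \<and> (\<exists>h\<in>S. h \<otimes>\<^bsub>A\<^esub> (a \<otimes>\<^bsub>A\<^esub> t) = h \<otimes>\<^bsub>A\<^esub> (b \<otimes>\<^bsub>A\<^esub> s))}"

definition localization :: "('a, 'm) ring_scheme \<Rightarrow> 'a set \<Rightarrow> ('a \<times> 'a) set ring" where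
  "localization A S = \<lparr>
     carrier = {frac A S a s | a s. a \<in> carrier A \<and> s \<in> S},
     mult = (\<lambda>x y. \<Union>(a, s)\<in>x. \<Union>(b, t)\<in>y. frac A S (a \<otimes>\<^bsub>A\<^esub> b) (s \<otimes>\<^bsub>A\<^esub> t)),
     one = frac A S \<one>\<^bsub>A\<^esub> \<one>\<^bsub>A\<^esub>,
     ring.zero = frac A S \<zero>\<^bsub>A\<^esub> \<one>\<^bsub>A\<^esub>,
     ring.add = (\<lambda>x y. \<Union>(a, s)\<in>x. \<Union>(b, t)\<in>y.
       frac A S ((a \<otimes>\<^bsub>A\<^esub> t) \<oplus>\<^bsub>A\<^esub> (b \<otimes>\<^bsub>A\<^esub> s)) (s \<otimes>\<^bsub>A\<^esub> t))\<rparr>"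

definition zariski_open :: "('a, 'm) ring_scheme \<Rightarrow> 'a set set \<Rightarrow> bool" where
  "zariski_open A U \<longleftrightarrow> (\<exists>I\<subseteq>carrier A. U = {P. primeideal P A \<and> \<not> I \<subseteq> P})"

definition zariski :: "('a, 'm) ring_scheme \<Rightarrow> 'a set topology" where
  "zariski A = topology (zariski_open A)"

lemma istopology_zariski_open: "istopology (zariski_open A)"
  unfolding istopology_def
proof (intro conjI allI impI)
  fix U V assume "zariski_open A U" "zariski_open A V"
  then obtain I J where I: "I \<subseteq> carrier A" "U = {P. primeideal P A \<and> \<not> I \<subseteq> P}"
    and J: "J \<subseteq> carrier A" "V = {P. primeideal P A \<and> \<not> J \<subseteq> P}"
    unfolding zariski_open_def by auto
  define L where "L = {c \<in> carrier A. \<exists>a\<in>I. \<exists>b\<in>J. c = a \<otimes>\<^bsub>A\<^esub> b}"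
  have "(\<not> L \<subseteq> P) \<longleftrightarrow> (\<not> I \<subseteq> P) \<and> (\<not> J \<subseteq> P)" if "primeideal P A" for P
  proof -
    interpret primeideal P A by (fact that)
    show ?thesis
    proof
      assume "\<not> L \<subseteq> P"
      then obtain a b where "a \<in> I" "b \<in> J" "a \<otimes>\<^bsub>A\<^esub> b \<notin> P"
        unfolding L_def by auto
      moreover have "a \<in> carrier A" "b \<in> carrier A"
        using I(1) J(1) \<open>a \<in> I\<close> \<open>b \<in> J\<close> by auto
      ultimately have "a \<notin> P" "b \<notin> P"
        using I_l_closed I_r_closed by metis+
      then show "(\<not> I \<subseteq> P) \<and> (\<not> J \<subseteq> P)"
        using \<open>a \<in> I\<close> \<open>b \<in> J\<close> by auto
    next
      assume "(\<not> I \<subseteq> P) \<and> (\<not> J \<subseteq> P)"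
      then obtain a b where ab: "a \<in> I" "a \<notin> P" "b \<in> J" "b \<notin> P"
        by auto
      then have car: "a \<in> carrier A" "b \<in> carrier A"
        using I(1) J(1) by auto
      then have "a \<otimes>\<^bsub>A\<^esub> b \<notin> P"
        using I_prime ab by metis
      moreover have "a \<otimes>\<^bsub>A\<^esub> b \<in> L"
        unfolding L_def using ab car by auto
      ultimately show "\<not> L \<subseteq> P"
        by auto
    qed
  qed
  then have "U \<inter> V = {P. primeideal P A \<and> \<not> L \<subseteq> P}"
    unfolding I(2) J(2) by auto
  moreover have "L \<subseteq> carrier A"
    unfolding L_def by auto
  ultimately show "zariski_open A (U \<inter> V)"
    unfolding zariski_open_def by auto
next
  fix \<K> assume "\<forall>K\<in>\<K>. zariski_open A K"
  then have "\<forall>K\<in>\<K>. \<exists>I. I \<subseteq> carrier A \<and> K = {P. primeideal P A \<and> \<not> I \<subseteq> P}"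
    unfolding zariski_open_def by auto
  then obtain I where I: "\<forall>K\<in>\<K>. I K \<subseteq> carrier A \<and> K = {P. primeideal P A \<and> \<not> I K \<subseteq> P}"
    unfolding bchoice_iff by (elim exE)
  have "P \<in> K \<longleftrightarrow> primeideal P A \<and> \<not> I K \<subseteq> P" if "K \<in> \<K>" for P K
    using bspec[OF I that] by (metis (mono_tags, lifting) mem_Collect_eq)
  then have "\<Union>\<K> = {P. primeideal P A \<and> \<not> \<Union>(I ` \<K>) \<subseteq> P}"
    by (simp add: set_eq_iff UN_subset_iff Bex_def)
  moreover have "\<Union>(I ` \<K>) \<subseteq> carrier A"
    using I by (simp add: UN_subset_iff)
  ultimately show "zariski_open A (\<Union>\<K>)"
    unfolding zariski_open_def by (intro exI[of _ "\<Union>(I ` \<K>)"]) simp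
qed

lemma openin_zariski: "openin (zariski A) = zariski_open A"
  unfolding zariski_def by (rule topology_inverse') (rule istopology_zariski_open)

definition spec_sections :: "('a, 'm) ring_scheme \<Rightarrow> 'a set set \<Rightarrow> ('a set \<Rightarrow> ('a \<times> 'a) set) set" where
  "spec_sections A U =
     {s \<in> \<Pi>\<^sub>E P\<in>U. carrier (localization A (carrier A - P)).
        \<forall>P\<in>U. \<exists>V a f. openin (zariski A) V \<and> P \<in> V \<and> V \<subseteq> U \<and> a \<in> carrier A \<and> f \<in> carrier A \<and>
          (\<forall>Q\<in>V. f \<notin> Q \<and> s Q = frac A (carrier A - Q) a f)}"

definition Spec :: "('a, 'm) ring_scheme \<Rightarrow> ('a set, 'a set \<Rightarrow> ('a \<times> 'a) set) ringed_space_data" where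
  "Spec A = \<lparr>
     pts = zariski A,
     Osec = (\<lambda>U. \<lparr>
       carrier = spec_sections A U,
       mult = (\<lambda>s t. \<lambda>P\<in>U. s P \<otimes>\<^bsub>localization A (carrier A - P)\<^esub> t P),
       one = (\<lambda>P\<in>U. \<one>\<^bsub>localization A (carrier A - P)\<^esub>),
       ring.zero = (\<lambda>P\<in>U. \<zero>\<^bsub>localization A (carrier A - P)\<^esub>),
       ring.add = (\<lambda>s t. \<lambda>P\<in>U. s P \<oplus>\<^bsub>localization A (carrier A - P)\<^esub> t P)\<rparr>),
     Ores = (\<lambda>U V s. restrict s V)\<rparr>"

text \<open>The rings of the affine charts are taken over the type of the sections of \<open>S\<close>. This is no
  restriction: if \<open>U\<close> is isomorphic to the spectrum of some ring, then also to that of the ring of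
  sections over \<open>U\<close>.\<close>

definition scheme :: "('x, 'a) ringed_space_data \<Rightarrow> bool" where
  "scheme S \<longleftrightarrow> locally_ringed_space S \<and>
     (\<forall>x\<in>topspace (pts S). \<exists>U (A :: 'a ring) f \<phi>.
        openin (pts S) U \<and> x \<in> U \<and> cring A \<and> lrs_isomorphism (open_subspace S U) (Spec A) f \<phi>)"

definition integral_scheme :: "('x, 'a) ringed_space_data \<Rightarrow> bool" where
  "integral_scheme S \<longleftrightarrow> scheme S \<and> topspace (pts S) \<noteq> {} \<and>
     (\<forall>U. openin (pts S) U \<and> U \<noteq> {} \<longrightarrow> domain (Osec S U))"

definition generic_point :: "('x, 'a) ringed_space_data \<Rightarrow> 'x \<Rightarrow> bool" where
  "generic_point S \<epsilon> \<longleftrightarrow> \<epsilon> \<in> topspace (pts S) \<and> pts S closure_of {\<epsilon>} = topspace (pts S)"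

abbreviation function_field :: "('x, 'a) ringed_space_data \<Rightarrow> 'x \<Rightarrow> ('x set \<times> 'a) set ring" where
  "function_field S \<epsilon> \<equiv> stalk_ring S \<epsilon>"

text \<open>A scheme over \<open>k\<close> is a scheme \<open>S\<close> with a morphism \<open>(\<pi>, \<phi>)\<close> to \<open>Spec k\<close>. It makes all rings of
  sections and all stalks into \<open>k\<close>-algebras.\<close>

definition scheme_over ::
  "('k, 'm) ring_scheme \<Rightarrow> ('x, 'a) ringed_space_data \<Rightarrow> ('x \<Rightarrow> 'k set) \<Rightarrow>
   ('k set set \<Rightarrow> ('k set \<Rightarrow> ('k \<times> 'k) set) \<Rightarrow> 'a) \<Rightarrow> bool"
where
  "scheme_over k S \<pi> \<phi> \<longleftrightarrow> scheme S \<and> lrs_morphism S (Spec k) \<pi> \<phi>"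

definition scalar_section ::
  "('k, 'm) ring_scheme \<Rightarrow> ('x, 'a) ringed_space_data \<Rightarrow> ('x \<Rightarrow> 'k set) \<Rightarrow>
   ('k set set \<Rightarrow> ('k set \<Rightarrow> ('k \<times> 'k) set) \<Rightarrow> 'a) \<Rightarrow> 'x set \<Rightarrow> 'k \<Rightarrow> 'a"
where
  "scalar_section k S \<pi> \<phi> U c =
     (let Sp = topspace (zariski k)
      in Ores S (preim S \<pi> Sp) U (\<phi> Sp (\<lambda>P\<in>Sp. frac k (carrier k - P) c \<one>\<^bsub>k\<^esub>)))"

definition scalar_germ ::
  "('k, 'm) ring_scheme \<Rightarrow> ('x, 'a) ringed_space_data \<Rightarrow> ('x \<Rightarrow> 'k set) \<Rightarrow>
   ('k set set \<Rightarrow> ('k set \<Rightarrow> ('k \<times> 'k) set) \<Rightarrow> 'a) \<Rightarrow> 'x \<Rightarrow> 'k \<Rightarrow> ('x set \<times> 'a) set"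
where
  "scalar_germ k S \<pi> \<phi> x c =
     Ogerm S x (topspace (pts S)) (scalar_section k S \<pi> \<phi> (topspace (pts S)) c)"


section \<open>Sheaves of modules\<close>

record ('x, 'a, 'e) module_sheaf_data =
  Msec :: "'x set \<Rightarrow> ('a, 'e) module"
  Mres :: "'x set \<Rightarrow> 'x set \<Rightarrow> 'e \<Rightarrow> 'e"

locale O_module =
  fixes S :: "('x, 'a) ringed_space_data" and E :: "('x, 'a, 'e) module_sheaf_data"
  assumes sections_module: "openin (pts S) U \<Longrightarrow> module (Osec S U) (Msec E U)"
    and restriction_add:
      "\<lbrakk>openin (pts S) U; openin (pts S) V; V \<subseteq> U; s \<in> carrier (Msec E U); t \<in> carrier (Msec E U)\<rbrakk>
       \<Longrightarrow> Mres E U V (s \<oplus>\<^bsub>Msec E U\<^esub> t) = Mres E U V s \<oplus>\<^bsub>Msec E V\<^esub> Mres E U V t"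
    and restriction_smult:
      "\<lbrakk>openin (pts S) U; openin (pts S) V; V \<subseteq> U; a \<in> carrier (Osec S U); s \<in> carrier (Msec E U)\<rbrakk>
       \<Longrightarrow> Mres E U V (a \<odot>\<^bsub>Msec E U\<^esub> s) = Ores S U V a \<odot>\<^bsub>Msec E V\<^esub> Mres E U V s"
    and module_sheaf: "sheaf (pts S) (\<lambda>U. carrier (Msec E U)) (Mres E)"

abbreviation Mgerm ::
  "('x, 'a) ringed_space_data \<Rightarrow> ('x, 'a, 'e) module_sheaf_data \<Rightarrow> 'x \<Rightarrow> 'x set \<Rightarrow> 'e \<Rightarrow> ('x set \<times> 'e) set"
where
  "Mgerm S E \<equiv> germ (pts S) (\<lambda>U. carrier (Msec E U)) (Mres E)"

text \<open>Module records extend ring records; their multiplicative components are junk.\<close>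

definition stalk_module ::
  "('x, 'a) ringed_space_data \<Rightarrow> ('x, 'a, 'e) module_sheaf_data \<Rightarrow> 'x \<Rightarrow>
   (('x set \<times> 'a) set, ('x set \<times> 'e) set) module"
where
  "stalk_module S E x = \<lparr>
     carrier = germs (pts S) (\<lambda>U. carrier (Msec E U)) (Mres E) x,
     mult = undefined,
     one = undefined,
     ring.zero = Mgerm S E x (topspace (pts S)) \<zero>\<^bsub>Msec E (topspace (pts S))\<^esub>,
     ring.add = (\<lambda>A B. \<Union>(U, s)\<in>A. \<Union>(V, t)\<in>B.
       Mgerm S E x (U \<inter> V) (Mres E U (U \<inter> V) s \<oplus>\<^bsub>Msec E (U \<inter> V)\<^esub> Mres E V (U \<inter> V) t)),
     smult = (\<lambda>A B. \<Union>(U, a)\<in>A. \<Union>(V, t)\<in>B.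
       Mgerm S E x (U \<inter> V) (Ores S U (U \<inter> V) a \<odot>\<^bsub>Msec E (U \<inter> V)\<^esub> Mres E V (U \<inter> V) t))\<rparr>"

definition stalk_map ::
  "('x, 'a) ringed_space_data \<Rightarrow> ('x, 'a, 'f) module_sheaf_data \<Rightarrow> ('x set \<Rightarrow> 'e \<Rightarrow> 'f) \<Rightarrow> 'x \<Rightarrow>
   ('x set \<times> 'e) set \<Rightarrow> ('x set \<times> 'f) set"
where
  "stalk_map S F \<psi> x A = (\<Union>(U, s)\<in>A. Mgerm S F x U (\<psi> U s))"

definition torsion_free :: "('x, 'a) ringed_space_data \<Rightarrow> ('x, 'a, 'e) module_sheaf_data \<Rightarrow> bool" where
  "torsion_free S E \<longleftrightarrow>
     (\<forall>x\<in>topspace (pts S). \<forall>a\<in>carrier (stalk_ring S x). \<forall>m\<in>carrier (stalk_module S E x).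
        a \<odot>\<^bsub>stalk_module S E x\<^esub> m = \<zero>\<^bsub>stalk_module S E x\<^esub> \<longrightarrow>
        a = \<zero>\<^bsub>stalk_ring S x\<^esub> \<or> m = \<zero>\<^bsub>stalk_module S E x\<^esub>)"

text \<open>Locally there are finitely many sections defining a surjection of sheaves from a finite free
  module.\<close>

definition finite_type :: "('x, 'a) ringed_space_data \<Rightarrow> ('x, 'a, 'e) module_sheaf_data \<Rightarrow> bool" where
  "finite_type S E \<longleftrightarrow>
     (\<forall>x\<in>topspace (pts S). \<exists>U (n :: nat) s.
        openin (pts S) U \<and> x \<in> U \<and> (\<forall>i<n. s i \<in> carrier (Msec E U)) \<and>
        (\<forall>V t y. openin (pts S) V \<and> V \<subseteq> U \<and> t \<in> carrier (Msec E V) \<and> y \<in> V \<longrightarrow>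
           (\<exists>W a. openin (pts S) W \<and> y \<in> W \<and> W \<subseteq> V \<and> (\<forall>i<n. a i \<in> carrier (Osec S W)) \<and>
              Mres E V W t = (\<Oplus>\<^bsub>Msec E W\<^esub> i\<in>{..<n}. a i \<odot>\<^bsub>Msec E W\<^esub> Mres E U W (s i)))))"

text \<open>The kernel of the map from the free module of rank \<open>n\<close> on \<open>U\<close> given by sections
  \<open>s 0, \<dots>, s (n - 1)\<close> over \<open>U\<close>; a sheaf of modules on the open subspace \<open>U\<close>.\<close>

definition relation_sheaf ::
  "('x, 'a) ringed_space_data \<Rightarrow> ('x, 'a, 'e) module_sheaf_data \<Rightarrow> 'x set \<Rightarrow> nat \<Rightarrow> (nat \<Rightarrow> 'e) \<Rightarrow>
   ('x, 'a, nat \<Rightarrow> 'a) module_sheaf_data"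
where
  "relation_sheaf S E U n s = \<lparr>
     Msec = (\<lambda>V. \<lparr>
       carrier = {a \<in> {..<n} \<rightarrow>\<^sub>E carrier (Osec S V).
         (\<Oplus>\<^bsub>Msec E V\<^esub> i\<in>{..<n}. a i \<odot>\<^bsub>Msec E V\<^esub> Mres E U V (s i)) = \<zero>\<^bsub>Msec E V\<^esub>},
       mult = undefined,
       one = undefined,
       ring.zero = (\<lambda>i\<in>{..<n}. \<zero>\<^bsub>Osec S V\<^esub>),
       ring.add = (\<lambda>a b. \<lambda>i\<in>{..<n}. a i \<oplus>\<^bsub>Osec S V\<^esub> b i),
       smult = (\<lambda>c a. \<lambda>i\<in>{..<n}. c \<otimes>\<^bsub>Osec S V\<^esub> a i)\<rparr>),
     Mres = (\<lambda>V W a. \<lambda>i\<in>{..<n}. Ores S V W (a i))\<rparr>"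

text \<open>Coherence in the sense valid on arbitrary ringed spaces; on locally Noetherian schemes it agrees
  with being locally associated with a finitely generated module.\<close>

definition coherent :: "('x, 'a) ringed_space_data \<Rightarrow> ('x, 'a, 'e) module_sheaf_data \<Rightarrow> bool" where
  "coherent S E \<longleftrightarrow> O_module S E \<and> finite_type S E \<and>
     (\<forall>U n s. openin (pts S) U \<and> (\<forall>i<n. s i \<in> carrier (Msec E U)) \<longrightarrow>
        finite_type (open_subspace S U) (relation_sheaf S E U n s))"

text \<open>For an integral scheme with generic point \<open>\<epsilon>\<close>.\<close>

definition sheaf_rank ::
  "('x, 'a) ringed_space_data \<Rightarrow> 'x \<Rightarrow> ('x, 'a, 'e) module_sheaf_data \<Rightarrow> nat" where
  "sheaf_rank S \<epsilon> E = vectorspace.dim (function_field S \<epsilon>) (stalk_module S E \<epsilon>)"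

text \<open>Endomorphisms are families of maps on sections, normalised to be \<open>undefined\<close> outside of their
  domain so that equality of endomorphisms is equality in the logic.\<close>

definition sheaf_End ::
  "('x, 'a) ringed_space_data \<Rightarrow> ('x, 'a, 'e) module_sheaf_data \<Rightarrow> ('x set \<Rightarrow> 'e \<Rightarrow> 'e) ring"
where
  "sheaf_End S E = \<lparr>
     carrier = {\<psi> \<in> extensional {U. openin (pts S) U}.
       (\<forall>U. openin (pts S) U \<longrightarrow>
          \<psi> U \<in> extensional (carrier (Msec E U)) \<inter> module_hom (Osec S U) (Msec E U) (Msec E U)) \<and>
       (\<forall>U V. openin (pts S) U \<and> openin (pts S) V \<and> V \<subseteq> U \<longrightarrow>
          (\<forall>s\<in>carrier (Msec E U). Mres E U V (\<psi> U s) = \<psi> V (Mres E U V s)))},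
     mult = (\<lambda>\<psi> \<chi>. \<lambda>U\<in>{U. openin (pts S) U}. \<lambda>s\<in>carrier (Msec E U). \<psi> U (\<chi> U s)),
     one = (\<lambda>U\<in>{U. openin (pts S) U}. \<lambda>s\<in>carrier (Msec E U). s),
     ring.zero = (\<lambda>U\<in>{U. openin (pts S) U}. \<lambda>s\<in>carrier (Msec E U). \<zero>\<^bsub>Msec E U\<^esub>),
     ring.add = (\<lambda>\<psi> \<chi>. \<lambda>U\<in>{U. openin (pts S) U}. \<lambda>s\<in>carrier (Msec E U). \<psi> U s \<oplus>\<^bsub>Msec E U\<^esub> \<chi> U s)\<rparr>"

text \<open>The image in the category of sheaves: sections that are locally in the image.\<close>

definition image_sheaf ::
  "('x, 'a) ringed_space_data \<Rightarrow> ('x, 'a, 'e) module_sheaf_data \<Rightarrow> ('x set \<Rightarrow> 'e \<Rightarrow> 'e) \<Rightarrow>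
   ('x, 'a, 'e) module_sheaf_data"
where
  "image_sheaf S E \<psi> = E\<lparr>Msec := \<lambda>U. (Msec E U)\<lparr>carrier :=
     {s \<in> carrier (Msec E U). \<forall>x\<in>U. \<exists>V t. openin (pts S) V \<and> x \<in> V \<and> V \<subseteq> U \<and>
        t \<in> carrier (Msec E V) \<and> Mres E U V s = \<psi> V t}\<rparr>\<rparr>"

text \<open>Finite direct sums of sheaves are formed section by section.\<close>

definition internal_direct_sum ::
  "('x, 'a) ringed_space_data \<Rightarrow> ('x, 'a, 'e) module_sheaf_data \<Rightarrow> nat \<Rightarrow>
   (nat \<Rightarrow> ('x, 'a, 'e) module_sheaf_data) \<Rightarrow> bool"
where
  "internal_direct_sum S E r F \<longleftrightarrow>
     (\<forall>U. openin (pts S) U \<longrightarrow>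
        (\<forall>i\<le>r. LinearCombinations.submodule (Osec S U) (carrier (Msec (F i) U)) (Msec E U)) \<and>
        (\<forall>s\<in>carrier (Msec E U). \<exists>!t. t \<in> (\<Pi>\<^sub>E i\<in>{..r}. carrier (Msec (F i) U)) \<and>
           s = (\<Oplus>\<^bsub>Msec E U\<^esub> i\<in>{..r}. t i)))"


section \<open>The group algebra and representations\<close>

definition ring_char :: "('a, 'm) ring_scheme \<Rightarrow> nat" where
  "ring_char R = Gcd {n. [n] \<cdot>\<^bsub>R\<^esub> \<one>\<^bsub>R\<^esub> = \<zero>\<^bsub>R\<^esub>}"

definition group_algebra :: "('k, 'm) ring_scheme \<Rightarrow> ('g, 'n) monoid_scheme \<Rightarrow> ('g \<Rightarrow> 'k) ring" where
  "group_algebra k G = \<lparr>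
     carrier = carrier G \<rightarrow>\<^sub>E carrier k,
     mult = (\<lambda>a b. \<lambda>g\<in>carrier G. \<Oplus>\<^bsub>k\<^esub> h\<in>carrier G. a h \<otimes>\<^bsub>k\<^esub> b (inv\<^bsub>G\<^esub> h \<otimes>\<^bsub>G\<^esub> g)),
     one = (\<lambda>g\<in>carrier G. if g = \<one>\<^bsub>G\<^esub> then \<one>\<^bsub>k\<^esub> else \<zero>\<^bsub>k\<^esub>),
     ring.zero = (\<lambda>g\<in>carrier G. \<zero>\<^bsub>k\<^esub>),
     ring.add = (\<lambda>a b. \<lambda>g\<in>carrier G. a g \<oplus>\<^bsub>k\<^esub> b g)\<rparr>"

definition group_elt :: "('k, 'm) ring_scheme \<Rightarrow> ('g, 'n) monoid_scheme \<Rightarrow> 'g \<Rightarrow> 'g \<Rightarrow> 'k" where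
  "group_elt k G g = (\<lambda>h\<in>carrier G. if h = g then \<one>\<^bsub>k\<^esub> else \<zero>\<^bsub>k\<^esub>)"

text \<open>The last assumption makes the ring homomorphism \<open>\<rho>\<close> one of \<open>k\<close>-algebras.\<close>

locale OG_module = O_module S E
  for k :: "('k, 'm) ring_scheme" and G :: "('g, 'n) monoid_scheme"
    and S :: "('x, 'a) ringed_space_data" and \<pi> \<phi>
    and E :: "('x, 'a, 'e) module_sheaf_data" and \<rho> :: "('g \<Rightarrow> 'k) \<Rightarrow> 'x set \<Rightarrow> 'e \<Rightarrow> 'e" +
  assumes action_hom: "\<rho> \<in> ring_hom (group_algebra k G) (sheaf_End S E)"
    and action_scalar:
      "\<lbrakk>c \<in> carrier k; a \<in> carrier (group_algebra k G); openin (pts S) U; s \<in> carrier (Msec E U)\<rbrakk>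
       \<Longrightarrow> \<rho> (\<lambda>g\<in>carrier G. c \<otimes>\<^bsub>k\<^esub> a g) U s = scalar_section k S \<pi> \<phi> U c \<odot>\<^bsub>Msec E U\<^esub> \<rho> a U s"

definition restrict_action ::
  "('x, 'a) ringed_space_data \<Rightarrow> ('x, 'a, 'e) module_sheaf_data \<Rightarrow>
   ('c \<Rightarrow> 'x set \<Rightarrow> 'e \<Rightarrow> 'e) \<Rightarrow> 'c \<Rightarrow> 'x set \<Rightarrow> 'e \<Rightarrow> 'e"
where
  "restrict_action S F \<rho> a = (\<lambda>U\<in>{U. openin (pts S) U}. \<lambda>s\<in>carrier (Msec F U). \<rho> a U s)"

definition stalk_action ::
  "('k, 'm) ring_scheme \<Rightarrow> ('g, 'n) monoid_scheme \<Rightarrow> ('x, 'a) ringed_space_data \<Rightarrow>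
   ('x, 'a, 'e) module_sheaf_data \<Rightarrow> (('g \<Rightarrow> 'k) \<Rightarrow> 'x set \<Rightarrow> 'e \<Rightarrow> 'e) \<Rightarrow> 'x \<Rightarrow>
   'g \<Rightarrow> ('x set \<times> 'e) set \<Rightarrow> ('x set \<times> 'e) set"
where
  "stalk_action k G S E \<rho> x g = stalk_map S E (\<rho> (group_elt k G g)) x"

locale representation = module R M
  for G :: "('g, 'n) monoid_scheme" and R :: "('k, 'm) ring_scheme"
    and M :: "('k, 'v, 'l) module_scheme" and \<sigma> :: "'g \<Rightarrow> 'v \<Rightarrow> 'v" +
  assumes group_G: "group G"
    and linear: "g \<in> carrier G \<Longrightarrow> \<sigma> g \<in> module_hom R M M"
    and act_mult: "\<lbrakk>g \<in> carrier G; h \<in> carrier G; v \<in> carrier M\<rbrakk> \<Longrightarrow> \<sigma> (g \<otimes>\<^bsub>G\<^esub> h) v = \<sigma> g (\<sigma> h v)"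
    and act_one: "v \<in> carrier M \<Longrightarrow> \<sigma> \<one>\<^bsub>G\<^esub> v = v"

definition subrepresentation ::
  "('g, 'n) monoid_scheme \<Rightarrow> ('k, 'm) ring_scheme \<Rightarrow> ('k, 'v, 'l) module_scheme \<Rightarrow>
   ('g \<Rightarrow> 'v \<Rightarrow> 'v) \<Rightarrow> 'v set \<Rightarrow> bool"
where
  "subrepresentation G R M \<sigma> N \<longleftrightarrow>
     LinearCombinations.submodule R N M \<and> (\<forall>g\<in>carrier G. \<sigma> g ` N \<subseteq> N)"

definition rep_iso ::
  "('g, 'n) monoid_scheme \<Rightarrow> ('k, 'm) ring_scheme \<Rightarrow> ('k, 'v, 'l) module_scheme \<Rightarrow> ('g \<Rightarrow> 'v \<Rightarrow> 'v) \<Rightarrow>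
   ('k, 'w, 'o) module_scheme \<Rightarrow> ('g \<Rightarrow> 'w \<Rightarrow> 'w) \<Rightarrow> ('v \<Rightarrow> 'w) \<Rightarrow> bool"
where
  "rep_iso G R M \<sigma> N \<tau> f \<longleftrightarrow>
     f \<in> module_hom R M N \<and> bij_betw f (carrier M) (carrier N) \<and>
     (\<forall>g\<in>carrier G. \<forall>v\<in>carrier M. f (\<sigma> g v) = \<tau> g (f v))"

definition irreducible_rep ::
  "('g, 'n) monoid_scheme \<Rightarrow> ('k, 'm) ring_scheme \<Rightarrow> ('k, 'v, 'l) module_scheme \<Rightarrow>
   ('g \<Rightarrow> 'v \<Rightarrow> 'v) \<Rightarrow> bool"
where
  "irreducible_rep G R M \<sigma> \<longleftrightarrow>
     representation G R M \<sigma> \<and> carrier M \<noteq> {\<zero>\<^bsub>M\<^esub>} \<and>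
     (\<forall>N. subrepresentation G R M \<sigma> N \<longrightarrow> N = {\<zero>\<^bsub>M\<^esub>} \<or> N = carrier M)"

text \<open>\<open>V 0, \<dots>, V r\<close> represent each isomorphism class of irreducible representations exactly once.
  In the exhaustiveness clause, representations have their carrier in the type \<open>nat \<Rightarrow> 'k\<close>. As \<open>G\<close> is
  finite, irreducible representations are finite-dimensional, so each of them is isomorphic to one of
  this form. The same remark applies to finitely generated modules below.\<close>

definition irreducible_reps ::
  "('g, 'n) monoid_scheme \<Rightarrow> ('k, 'm) ring_scheme \<Rightarrow> nat \<Rightarrow> (nat \<Rightarrow> ('k, 'v) module) \<Rightarrow>
   (nat \<Rightarrow> 'g \<Rightarrow> 'v \<Rightarrow> 'v) \<Rightarrow> bool"
where
  "irreducible_reps G k r V \<sigma> \<longleftrightarrow>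
     (\<forall>i\<le>r. irreducible_rep G k (V i) (\<sigma> i)) \<and>
     (\<forall>i\<le>r. \<forall>j\<le>r. (\<exists>f. rep_iso G k (V i) (\<sigma> i) (V j) (\<sigma> j) f) \<longrightarrow> i = j) \<and>
     (\<forall>(M :: ('k, nat \<Rightarrow> 'k) module) \<tau>. irreducible_rep G k M \<tau> \<longrightarrow>
        (\<exists>i\<le>r. \<exists>f. rep_iso G k (V i) (\<sigma> i) M \<tau> f))"

text \<open>A \<open>k[G]\<close>-module is given by a representation; the element \<open>a\<close> acts by \<open>\<Sum>\<^sub>g a(g) g\<close>.\<close>

definition algebra_action ::
  "('g, 'n) monoid_scheme \<Rightarrow> ('k, 'v, 'l) module_scheme \<Rightarrow> ('g \<Rightarrow> 'v \<Rightarrow> 'v) \<Rightarrow> ('g \<Rightarrow> 'k) \<Rightarrow> 'v \<Rightarrow> 'v"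
where
  "algebra_action G M \<tau> a v = (\<Oplus>\<^bsub>M\<^esub> g\<in>carrier G. a g \<odot>\<^bsub>M\<^esub> \<tau> g v)"

definition fin_gen_rep ::
  "('g, 'n) monoid_scheme \<Rightarrow> ('k, 'm) ring_scheme \<Rightarrow> ('k, 'v, 'l) module_scheme \<Rightarrow>
   ('g \<Rightarrow> 'v \<Rightarrow> 'v) \<Rightarrow> bool"
where
  "fin_gen_rep G k M \<tau> \<longleftrightarrow> representation G k M \<tau> \<and>
     (\<exists>S. finite S \<and> S \<subseteq> carrier M \<and>
        (\<forall>N. subrepresentation G k M \<tau> N \<and> S \<subseteq> N \<longrightarrow> N = carrier M))"

text \<open>The sum of all subrepresentations isomorphic to \<open>V\<close>.\<close>

definition isotypical_component ::
  "('g, 'n) monoid_scheme \<Rightarrow> ('k, 'm) ring_scheme \<Rightarrow> ('k, 'v, 'l) module_scheme \<Rightarrow>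
   ('g \<Rightarrow> 'v \<Rightarrow> 'v) \<Rightarrow> ('k, 'w, 'o) module_scheme \<Rightarrow> ('g \<Rightarrow> 'w \<Rightarrow> 'w) \<Rightarrow> 'w set"
where
  "isotypical_component G k V \<sigma> M \<tau> =
     \<Inter>{N. subrepresentation G k M \<tau> N \<and>
        (\<forall>L f. subrepresentation G k M \<tau> L \<and> rep_iso G k V \<sigma> (M\<lparr>carrier := L\<rparr>) \<tau> f \<longrightarrow> L \<subseteq> N)}"

text \<open>The last clause determines \<open>e i\<close>: it is the component of the unit in the \<open>V i\<close>-isotypical part of
  the regular representation.\<close>

definition central_idempotents ::
  "('g, 'n) monoid_scheme \<Rightarrow> ('k, 'm) ring_scheme \<Rightarrow> nat \<Rightarrow> (nat \<Rightarrow> ('k, 'v) module) \<Rightarrow>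
   (nat \<Rightarrow> 'g \<Rightarrow> 'v \<Rightarrow> 'v) \<Rightarrow> (nat \<Rightarrow> 'g \<Rightarrow> 'k) \<Rightarrow> bool"
where
  "central_idempotents G k r V \<sigma> e \<longleftrightarrow>
     (\<forall>i\<le>r. e i \<in> carrier (group_algebra k G) \<and>
        (\<forall>a\<in>carrier (group_algebra k G). e i \<otimes>\<^bsub>group_algebra k G\<^esub> a = a \<otimes>\<^bsub>group_algebra k G\<^esub> e i)) \<and>
     (\<forall>i\<le>r. \<forall>j\<le>r. e i \<otimes>\<^bsub>group_algebra k G\<^esub> e j =
        (if i = j then e i else \<zero>\<^bsub>group_algebra k G\<^esub>)) \<and>
     (\<Oplus>\<^bsub>group_algebra k G\<^esub> i\<in>{..r}. e i) = \<one>\<^bsub>group_algebra k G\<^esub> \<and>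
     (\<forall>i\<le>r. \<forall>(M :: ('k, nat \<Rightarrow> 'k) module) \<tau>. fin_gen_rep G k M \<tau> \<longrightarrow>
        algebra_action G M \<tau> (e i) ` carrier M = isotypical_component G k (V i) (\<sigma> i) M \<tau>)"

definition sum_module :: "nat set \<Rightarrow> (nat \<Rightarrow> ('k, 'v) module) \<Rightarrow> ('k, nat \<Rightarrow> 'v) module" where
  "sum_module I M = \<lparr>
     carrier = (\<Pi>\<^sub>E i\<in>I. carrier (M i)),
     mult = undefined,
     one = undefined,
     ring.zero = (\<lambda>i\<in>I. \<zero>\<^bsub>M i\<^esub>),
     ring.add = (\<lambda>v w. \<lambda>i\<in>I. v i \<oplus>\<^bsub>M i\<^esub> w i),
     smult = (\<lambda>c v. \<lambda>i\<in>I. c \<odot>\<^bsub>M i\<^esub> v i)\<rparr>"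

definition sum_action :: "nat set \<Rightarrow> (nat \<Rightarrow> 'g \<Rightarrow> 'v \<Rightarrow> 'v) \<Rightarrow> 'g \<Rightarrow> (nat \<Rightarrow> 'v) \<Rightarrow> nat \<Rightarrow> 'v" where
  "sum_action I \<sigma> g v = (\<lambda>i\<in>I. \<sigma> i g (v i))"

definition sum_incl :: "nat set \<Rightarrow> (nat \<Rightarrow> ('k, 'v) module) \<Rightarrow> nat \<Rightarrow> 'v \<Rightarrow> nat \<Rightarrow> 'v" where
  "sum_incl I M i v = (\<lambda>j\<in>I. if j = i then v else \<zero>\<^bsub>M j\<^esub>)"

abbreviation power_module :: "('k, 'v) module \<Rightarrow> nat \<Rightarrow> ('k, nat \<Rightarrow> 'v) module" where
  "power_module M n \<equiv> sum_module {..<n} (\<lambda>_. M)"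

abbreviation power_action :: "nat \<Rightarrow> ('g \<Rightarrow> 'v \<Rightarrow> 'v) \<Rightarrow> 'g \<Rightarrow> (nat \<Rightarrow> 'v) \<Rightarrow> nat \<Rightarrow> 'v" where
  "power_action n \<sigma> \<equiv> sum_action {..<n} (\<lambda>_. \<sigma>)"


section \<open>Tensor products and extension of scalars\<close>

definition free_module :: "('k, 'm) ring_scheme \<Rightarrow> 'b set \<Rightarrow> ('k, 'b \<Rightarrow> 'k) module" where
  "free_module R B = \<lparr>
     carrier = {x \<in> B \<rightarrow>\<^sub>E carrier R. finite {b \<in> B. x b \<noteq> \<zero>\<^bsub>R\<^esub>}},
     mult = undefined,
     one = undefined,
     ring.zero = (\<lambda>b\<in>B. \<zero>\<^bsub>R\<^esub>),
     ring.add = (\<lambda>x y. \<lambda>b\<in>B. x b \<oplus>\<^bsub>R\<^esub> y b),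
     smult = (\<lambda>c x. \<lambda>b\<in>B. c \<otimes>\<^bsub>R\<^esub> x b)\<rparr>"

definition free_basis :: "('k, 'm) ring_scheme \<Rightarrow> 'b set \<Rightarrow> 'b \<Rightarrow> 'b \<Rightarrow> 'k" where
  "free_basis R B b = (\<lambda>c\<in>B. if c = b then \<one>\<^bsub>R\<^esub> else \<zero>\<^bsub>R\<^esub>)"

definition free_map :: "('k, 'm) ring_scheme \<Rightarrow> 'b set \<Rightarrow> 'c set \<Rightarrow> ('b \<Rightarrow> 'c) \<Rightarrow> ('b \<Rightarrow> 'k) \<Rightarrow> 'c \<Rightarrow> 'k" where
  "free_map R B C f x = (\<lambda>c\<in>C. \<Oplus>\<^bsub>R\<^esub> b\<in>{b \<in> B. x b \<noteq> \<zero>\<^bsub>R\<^esub> \<and> f b = c}. x b)"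

definition quotient_module ::
  "('k, 'v, 'l) module_scheme \<Rightarrow> 'v set \<Rightarrow> ('k, 'v set) module" where
  "quotient_module M N = \<lparr>
     carrier = a_rcosets\<^bsub>M\<^esub> N,
     mult = undefined,
     one = undefined,
     ring.zero = N,
     ring.add = (\<lambda>A B. A <+>\<^bsub>M\<^esub> B),
     smult = (\<lambda>c A. \<Union>v\<in>A. N +>\<^bsub>M\<^esub> (c \<odot>\<^bsub>M\<^esub> v))\<rparr>"

definition tensor_free ::
  "('k, 'm) ring_scheme \<Rightarrow> ('k, 'v, 'l) module_scheme \<Rightarrow> ('k, 'w, 'o) module_scheme \<Rightarrow>
   ('k, 'v \<times> 'w \<Rightarrow> 'k) module"
where
  "tensor_free R M N = free_module R (carrier M \<times> carrier N)"

definition bilinear_relations ::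
  "('k, 'm) ring_scheme \<Rightarrow> ('k, 'v, 'l) module_scheme \<Rightarrow> ('k, 'w, 'o) module_scheme \<Rightarrow>
   ('v \<times> 'w \<Rightarrow> 'k) set"
where
  "bilinear_relations R M N =
     (let F = tensor_free R M N;
          b = (\<lambda>v w. free_basis R (carrier M \<times> carrier N) (v, w))
      in {b (v \<oplus>\<^bsub>M\<^esub> v') w \<ominus>\<^bsub>F\<^esub> (b v w \<oplus>\<^bsub>F\<^esub> b v' w) | v v' w.
            v \<in> carrier M \<and> v' \<in> carrier M \<and> w \<in> carrier N} \<union>
         {b v (w \<oplus>\<^bsub>N\<^esub> w') \<ominus>\<^bsub>F\<^esub> (b v w \<oplus>\<^bsub>F\<^esub> b v w') | v w w'.
            v \<in> carrier M \<and> w \<in> carrier N \<and> w' \<in> carrier N} \<union>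
         {b (c \<odot>\<^bsub>M\<^esub> v) w \<ominus>\<^bsub>F\<^esub> (c \<odot>\<^bsub>F\<^esub> b v w) | c v w.
            c \<in> carrier R \<and> v \<in> carrier M \<and> w \<in> carrier N} \<union>
         {b v (c \<odot>\<^bsub>N\<^esub> w) \<ominus>\<^bsub>F\<^esub> (c \<odot>\<^bsub>F\<^esub> b v w) | c v w.
            c \<in> carrier R \<and> v \<in> carrier M \<and> w \<in> carrier N})"

definition tensor_kernel ::
  "('k, 'm) ring_scheme \<Rightarrow> ('k, 'v, 'l) module_scheme \<Rightarrow> ('k, 'w, 'o) module_scheme \<Rightarrow>
   ('v \<times> 'w \<Rightarrow> 'k) set"
where
  "tensor_kernel R M N =
     \<Inter>{L. LinearCombinations.submodule R L (tensor_free R M N) \<and> bilinear_relations R M N \<subseteq> L}"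

definition tensor_product ::
  "('k, 'm) ring_scheme \<Rightarrow> ('k, 'v, 'l) module_scheme \<Rightarrow> ('k, 'w, 'o) module_scheme \<Rightarrow>
   ('k, ('v \<times> 'w \<Rightarrow> 'k) set) module"
where
  "tensor_product R M N = quotient_module (tensor_free R M N) (tensor_kernel R M N)"

text \<open>The map \<open>f \<otimes> g\<close>.\<close>

definition tensor_map ::
  "('k, 'm) ring_scheme \<Rightarrow> ('k, 'v, 'l) module_scheme \<Rightarrow> ('k, 'w, 'o) module_scheme \<Rightarrow>
   ('k, 'v2, 'l2) module_scheme \<Rightarrow> ('k, 'w2, 'o2) module_scheme \<Rightarrow> ('v \<Rightarrow> 'v2) \<Rightarrow> ('w \<Rightarrow> 'w2) \<Rightarrow>
   ('v \<times> 'w \<Rightarrow> 'k) set \<Rightarrow> ('v2 \<times> 'w2 \<Rightarrow> 'k) set"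
where
  "tensor_map R M N M' N' f g A =
     (\<Union>x\<in>A. tensor_kernel R M' N' +>\<^bsub>tensor_free R M' N'\<^esub>
        free_map R (carrier M \<times> carrier N) (carrier M' \<times> carrier N') (map_prod f g) x)"

text \<open>A ring \<open>K\<close> as a module along \<open>\<iota> : k \<rightarrow> K\<close>.\<close>

definition algebra_module :: "('k \<Rightarrow> 'c) \<Rightarrow> ('c, 'm) ring_scheme \<Rightarrow> ('k, 'c) module" where
  "algebra_module \<iota> K = \<lparr>
     carrier = carrier K, mult = mult K, one = one K, ring.zero = ring.zero K, ring.add = ring.add K,
     smult = (\<lambda>c a. \<iota> c \<otimes>\<^bsub>K\<^esub> a)\<rparr>"

text \<open>The \<open>K\<close>-module \<open>V \<otimes>\<^sub>k K\<close>, where \<open>K\<close> acts on the second factor, and the map \<open>f \<otimes> id\<close>.\<close>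

definition scalar_extension ::
  "('k, 'm) ring_scheme \<Rightarrow> ('c, 'n) ring_scheme \<Rightarrow> ('k \<Rightarrow> 'c) \<Rightarrow> ('k, 'v, 'l) module_scheme \<Rightarrow>
   ('c, ('v \<times> 'c \<Rightarrow> 'k) set) module"
where
  "scalar_extension k K \<iota> V =
     (let N = algebra_module \<iota> K; T = tensor_product k V N
      in \<lparr>carrier = carrier T, mult = undefined, one = undefined, ring.zero = ring.zero T, ring.add = ring.add T,
          smult = (\<lambda>b. tensor_map k V N V N (\<lambda>v. v) (\<lambda>a. b \<otimes>\<^bsub>K\<^esub> a))\<rparr>)"

definition scalar_extension_map ::
  "('k, 'm) ring_scheme \<Rightarrow> ('c, 'n) ring_scheme \<Rightarrow> ('k \<Rightarrow> 'c) \<Rightarrow> ('k, 'v, 'l) module_scheme \<Rightarrow>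
   ('k, 'w, 'o) module_scheme \<Rightarrow> ('v \<Rightarrow> 'w) \<Rightarrow> ('v \<times> 'c \<Rightarrow> 'k) set \<Rightarrow> ('w \<times> 'c \<Rightarrow> 'k) set"
where
  "scalar_extension_map k K \<iota> V W f =
     tensor_map k V (algebra_module \<iota> K) W (algebra_module \<iota> K) f (\<lambda>a. a)"

abbreviation scalar_extension_action ::
  "('k, 'm) ring_scheme \<Rightarrow> ('c, 'n) ring_scheme \<Rightarrow> ('k \<Rightarrow> 'c) \<Rightarrow> ('k, 'v, 'l) module_scheme \<Rightarrow>
   ('g \<Rightarrow> 'v \<Rightarrow> 'v) \<Rightarrow> 'g \<Rightarrow> ('v \<times> 'c \<Rightarrow> 'k) set \<Rightarrow> ('v \<times> 'c \<Rightarrow> 'k) set"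
where
  "scalar_extension_action k K \<iota> V \<sigma> g \<equiv> scalar_extension_map k K \<iota> V V (\<sigma> g)"

end

theory Submission
  imports Defs
begin

text \<open>As \<open>e i\<close> is idempotent, the sections of \<open>e i E\<close> are the fixed points of \<open>e i\<close>, so \<open>E\<close> is their
  direct sum and the stalk of \<open>e i E\<close> is the fixed space of \<open>e i\<close> on the stalk of \<open>E\<close>. Under the given
  isomorphism \<open>e i\<close> acts on \<open>(\<Oplus>\<^sub>j V j\<^bsup>n j\<^esup>) \<otimes> K\<close> as the extension of its action on the direct sum,
  which is the projection onto the \<open>i\<close>-th summand. The rank is read off a basis of \<open>V i\<^bsup>n i\<^esup>\<close>, which
  stays a basis over \<open>K\<close> after extension of scalars; \<open>K\<close> is a field because an element of the generic
  prime of an affine chart lies in every prime and hence is nilpotent.\<close>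

section \<open>Modules\<close>

text \<open>The isomorphism \<open>\<Phi>\<close> is only known to commute with the elements of
  \<open>G\<close>, whereas \<open>e i\<close> acts on the stalk through the sheaf endomorphism
  \<open>\<rho> (e i)\<close>. The bridge is \<open>algebra_action\<close>: on the stalk,
  \<open>\<rho> (e i)\<close> is the combination of the group elements with coefficients
  \<open>\<iota> (e i g)\<close>, and every linear equivariant map respects such a combination. On
  the other side the coefficients cross the tensor sign, which leaves the action of
  \<open>e i\<close> on the direct sum over \<open>k\<close>. The inclusion of a summand stays
  injective over \<open>K\<close> because the projection splits it, so functoriality of
  \<open>ext_map\<close> is enough. For the rank, a basis is carried together with its coordinate
  functions: both extend to \<open>K\<close>, and the extended functions prove independence there.
  Each \<open>V i\<close> has finite dimension because \<open>G\<close> is finite: the span of an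
  orbit is stable. Germs, fractions and cosets are classes on which operations are given by unions
  over representatives, so constructions on them first need independence of the
  representative.\<close>

lemma module_homI:
  assumes "\<And>v. v \<in> carrier M \<Longrightarrow> f v \<in> carrier N"
    and "\<And>v w. v \<in> carrier M \<Longrightarrow> w \<in> carrier M \<Longrightarrow> f (v \<oplus>\<^bsub>M\<^esub> w) = f v \<oplus>\<^bsub>N\<^esub> f w"
    and "\<And>c v. c \<in> carrier R \<Longrightarrow> v \<in> carrier M \<Longrightarrow> f (c \<odot>\<^bsub>M\<^esub> v) = c \<odot>\<^bsub>N\<^esub> f v"
  shows "f \<in> module_hom R M N"
  using assms unfolding module_hom_def by auto

lemma module_homD:
  assumes "f \<in> module_hom R M N"
  shows "v \<in> carrier M \<Longrightarrow> f v \<in> carrier N"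
    and "v \<in> carrier M \<Longrightarrow> w \<in> carrier M \<Longrightarrow> f (v \<oplus>\<^bsub>M\<^esub> w) = f v \<oplus>\<^bsub>N\<^esub> f w"
    and "c \<in> carrier R \<Longrightarrow> v \<in> carrier M \<Longrightarrow> f (c \<odot>\<^bsub>M\<^esub> v) = c \<odot>\<^bsub>N\<^esub> f v"
  using assms unfolding module_hom_def by auto

lemma module_hom_zero:
  assumes "module R M" "module R N" "f \<in> module_hom R M N"
  shows "f \<zero>\<^bsub>M\<^esub> = \<zero>\<^bsub>N\<^esub>"
  using mod_hom.f0_is_0[of R M N f] assms by (simp add: mod_hom_def mod_hom_axioms_def)

text \<open>Holds for every index set: over an infinite one \<open>finsum\<close> is zero on both
  sides.\<close>

lemma module_hom_finsum:
  assumes "module R M" "module R N" "f \<in> module_hom R M N" "g \<in> A \<rightarrow> carrier M"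
  shows "f (\<Oplus>\<^bsub>M\<^esub>a\<in>A. g a) = (\<Oplus>\<^bsub>N\<^esub>a\<in>A. f (g a))"
proof -
  interpret M: module R M by fact
  interpret N: module R N by fact
  show ?thesis using assms(4)
  proof (induct A rule: infinite_finite_induct)
    case (insert a A)
    then have "g a \<in> carrier M" "g \<in> A \<rightarrow> carrier M" by auto
    moreover have "(\<lambda>a. f (g a)) \<in> A \<rightarrow> carrier N" "f (g a) \<in> carrier N"
      using calculation module_homD(1)[OF assms(3)] by auto
    ultimately show ?case
      using insert by (simp add: M.finsum_insert N.finsum_insert module_homD(2)[OF assms(3)] M.finsum_closed)
  qed (simp_all add: module_hom_zero[OF assms(1-3)])
qed

lemma module_hom_comp:
  assumes "f \<in> module_hom R M N" "g \<in> module_hom R N P"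
  shows "(\<lambda>x. g (f x)) \<in> module_hom R M P"
  by (rule module_homI) (simp_all add: module_homD[OF assms(1)] module_homD[OF assms(2)])

lemma module_hom_ident: "(\<lambda>x. x) \<in> module_hom R M M"
  unfolding module_hom_def by auto

lemma (in module) finsum_product_closed:
  "\<lbrakk>\<And>i. i \<in> A \<Longrightarrow> f i \<in> carrier R; \<And>i. i \<in> A \<Longrightarrow> g i \<in> carrier M\<rbrakk> \<Longrightarrow> (\<Oplus>\<^bsub>M\<^esub>i\<in>A. f i \<odot>\<^bsub>M\<^esub> g i) \<in> carrier M"
  by (auto intro!: finsum_closed)

lemma (in abelian_monoid) finsum_swap:
  assumes "finite A" "finite B" "\<And>a b. a \<in> A \<Longrightarrow> b \<in> B \<Longrightarrow> f a b \<in> carrier G"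
  shows "(\<Oplus>a\<in>A. \<Oplus>b\<in>B. f a b) = (\<Oplus>b\<in>B. \<Oplus>a\<in>A. f a b)"
  using assms(1,3)
proof (induct A)
  case empty
  then show ?case by (simp add: finsum_zero)
next
  case (insert a A)
  have "(\<Oplus>a\<in>insert a A. \<Oplus>b\<in>B. f a b) = (\<Oplus>b\<in>B. f a b) \<oplus> (\<Oplus>a\<in>A. \<Oplus>b\<in>B. f a b)"
    using insert by (intro finsum_insert) (auto intro!: finsum_closed)
  also have "\<dots> = (\<Oplus>b\<in>B. f a b) \<oplus> (\<Oplus>b\<in>B. \<Oplus>a\<in>A. f a b)"
    using insert by simp
  also have "\<dots> = (\<Oplus>b\<in>B. f a b \<oplus> (\<Oplus>a\<in>A. f a b))"
    using insert by (intro finsum_addf[symmetric]) (auto intro!: finsum_closed)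
  also have "\<dots> = (\<Oplus>b\<in>B. \<Oplus>a\<in>insert a A. f a b)"
    using insert by (intro finsum_cong') (auto intro!: finsum_closed)
  finally show ?case .
qed

lemma (in abelian_monoid) finsum_mono_neutral:
  assumes "finite S" "A \<subseteq> S" "\<And>x. x \<in> A \<Longrightarrow> f x \<in> carrier G" "\<And>x. x \<in> S - A \<Longrightarrow> f x = \<zero>"
  shows "(\<Oplus>x\<in>S. f x) = (\<Oplus>x\<in>A. f x)"
proof -
  have "(\<Oplus>x\<in>S. f x) = (\<Oplus>x\<in>S. if x \<in> A then f x else \<zero>)"
    using assms by (intro finsum_cong') auto
  also have "\<dots> = (\<Oplus>x\<in>A. f x)"
    using assms add.extend_prod[of S A f] by auto
  finally show ?thesis .
qed

section \<open>Free modules\<close>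

lemma free_module_simps [simp]:
  "\<zero>\<^bsub>free_module R B\<^esub> = (\<lambda>b\<in>B. \<zero>\<^bsub>R\<^esub>)"
  "x \<oplus>\<^bsub>free_module R B\<^esub> y = (\<lambda>b\<in>B. x b \<oplus>\<^bsub>R\<^esub> y b)"
  "c \<odot>\<^bsub>free_module R B\<^esub> x = (\<lambda>b\<in>B. c \<otimes>\<^bsub>R\<^esub> x b)"
  by (simp_all add: free_module_def)

lemma free_module_carrier:
  "x \<in> carrier (free_module R B) \<longleftrightarrow> x \<in> B \<rightarrow>\<^sub>E carrier R \<and> finite {b \<in> B. x b \<noteq> \<zero>\<^bsub>R\<^esub>}"
  by (simp add: free_module_def)

lemma free_module_apply: "x \<in> carrier (free_module R B) \<Longrightarrow> b \<in> B \<Longrightarrow> x b \<in> carrier R"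
  by (auto simp: free_module_carrier)

lemma free_module_is_module:
  fixes R (structure)
  assumes "cring R"
  shows "module R (free_module R B)"
proof -
  interpret cring R by fact
  show ?thesis
  proof (rule module_criteria)
    show "\<zero>\<^bsub>free_module R B\<^esub> \<in> carrier (free_module R B)"
      by (auto simp: free_module_carrier cong: conj_cong)
  next
    show "\<forall>v w. v \<in> carrier (free_module R B) \<and> w \<in> carrier (free_module R B) \<longrightarrow>
      v \<oplus>\<^bsub>free_module R B\<^esub> w \<in> carrier (free_module R B)"
    proof (intro allI impI)
      fix v w assume vw: "v \<in> carrier (free_module R B) \<and> w \<in> carrier (free_module R B)"
      have "finite {b \<in> B. v b \<oplus> w b \<noteq> \<zero>}"
        by (rule finite_subset[of _ "{b \<in> B. v b \<noteq> \<zero>} \<union> {b \<in> B. w b \<noteq> \<zero>}"])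
          (use vw in \<open>auto simp: free_module_carrier\<close>)
      then show "v \<oplus>\<^bsub>free_module R B\<^esub> w \<in> carrier (free_module R B)"
        using vw by (auto simp: free_module_carrier cong: conj_cong)
    qed
  next
    show "\<forall>v\<in>carrier (free_module R B). \<exists>neg_v\<in>carrier (free_module R B).
       v \<oplus>\<^bsub>free_module R B\<^esub> neg_v = \<zero>\<^bsub>free_module R B\<^esub>"
    proof
      fix v assume v: "v \<in> carrier (free_module R B)"
      have "finite {b \<in> B. \<ominus> v b \<noteq> \<zero>}"
        by (rule finite_subset[of _ "{b \<in> B. v b \<noteq> \<zero>}"])
          (use v in \<open>auto simp: free_module_carrier\<close>)
      then have "(\<lambda>b\<in>B. \<ominus> v b) \<in> carrier (free_module R B)"
        using v by (auto simp: free_module_carrier cong: conj_cong)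
      moreover have "v \<oplus>\<^bsub>free_module R B\<^esub> (\<lambda>b\<in>B. \<ominus> v b) = \<zero>\<^bsub>free_module R B\<^esub>"
        using v by (auto simp: free_module_apply r_neg intro!: restrict_ext)
      ultimately show "\<exists>neg_v\<in>carrier (free_module R B). v \<oplus>\<^bsub>free_module R B\<^esub> neg_v = \<zero>\<^bsub>free_module R B\<^esub>"
        by blast
    qed
  next
    show "\<forall>c v. c \<in> carrier R \<and> v \<in> carrier (free_module R B) \<longrightarrow>
      c \<odot>\<^bsub>free_module R B\<^esub> v \<in> carrier (free_module R B)"
    proof (intro allI impI)
      fix c v assume vw: "c \<in> carrier R \<and> v \<in> carrier (free_module R B)"
      have "finite {b \<in> B. c \<otimes> v b \<noteq> \<zero>}"
        by (rule finite_subset[of _ "{b \<in> B. v b \<noteq> \<zero>}"])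
          (use vw in \<open>auto simp: free_module_carrier\<close>)
      then show "c \<odot>\<^bsub>free_module R B\<^esub> v \<in> carrier (free_module R B)"
        using vw by (auto simp: free_module_carrier cong: conj_cong)
    qed
  next
    show "\<forall>v\<in>carrier (free_module R B). v \<oplus>\<^bsub>free_module R B\<^esub> \<zero>\<^bsub>free_module R B\<^esub> = v"
      by (auto simp: free_module_carrier PiE_def extensional_def Pi_def fun_eq_iff)
    show "\<forall>v\<in>carrier (free_module R B). \<one> \<odot>\<^bsub>free_module R B\<^esub> v = v"
      by (auto simp: free_module_carrier PiE_def extensional_def Pi_def fun_eq_iff)
  qed (auto simp: free_module_apply assms a_ac m_assoc l_distr r_distr intro!: restrict_ext)
qed

lemma free_basis_closed:
  fixes R (structure)
  assumes "cring R" "b \<in> B"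
  shows "free_basis R B b \<in> carrier (free_module R B)"
proof -
  interpret cring R by fact
  have "finite {c \<in> B. free_basis R B b c \<noteq> \<zero>}"
    by (rule finite_subset[of _ "{b}"]) (auto simp: free_basis_def split: if_splits)
  then show ?thesis
    by (auto simp: free_module_carrier free_basis_def)
qed

lemma free_module_ext:
  assumes "x \<in> carrier (free_module R B)" "y \<in> carrier (free_module R B)" "\<And>b. b \<in> B \<Longrightarrow> x b = y b"
  shows "x = y"
  using assms by (auto simp: free_module_carrier intro: PiE_ext)

text \<open>Elements have finite support. Splitting off the coordinate at one \<open>b\<close>
  leaves an element of strictly smaller support, so the induction is on the support.\<close>

lemma free_module_induct [consumes 2, case_names zero basis add]:
  fixes R (structure)
  assumes R: "cring R" and x: "x \<in> carrier (free_module R B)"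
    and zero: "P \<zero>\<^bsub>free_module R B\<^esub>"
    and basis: "\<And>c b. c \<in> carrier R \<Longrightarrow> b \<in> B \<Longrightarrow> P (c \<odot>\<^bsub>free_module R B\<^esub> free_basis R B b)"
    and add: "\<And>x y. x \<in> carrier (free_module R B) \<Longrightarrow> y \<in> carrier (free_module R B) \<Longrightarrow> P x \<Longrightarrow> P y
       \<Longrightarrow> P (x \<oplus>\<^bsub>free_module R B\<^esub> y)"
  shows "P x"
proof -
  interpret cring R by fact
  interpret F: module R "free_module R B" by (rule free_module_is_module[OF R])
  have "finite {b \<in> B. x b \<noteq> \<zero>}" using x by (simp add: free_module_carrier)
  then show ?thesis using x
  proof (induct "{b \<in> B. x b \<noteq> \<zero>}" arbitrary: x rule: finite_psubset_induct)
    case psubset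
    show ?case
    proof (cases "{b \<in> B. x b \<noteq> \<zero>} = {}")
      case True
      then have "x = \<zero>\<^bsub>free_module R B\<^esub>"
        using psubset by (intro free_module_ext[OF _ F.zero_closed]) auto
      then show ?thesis using assms(3) by (simp only:)
    next
      case False
      then obtain b where b: "b \<in> B" "x b \<noteq> \<zero>" by auto
      define y where "y = (\<lambda>c\<in>B. if c = b then \<zero> else x c)"
      have "finite {c \<in> B. y c \<noteq> \<zero>}"
        by (rule finite_subset[OF _ psubset(1)]) (auto simp: y_def)
      then have y: "y \<in> carrier (free_module R B)"
        using psubset by (auto simp: y_def free_module_carrier)
      have "{c \<in> B. y c \<noteq> \<zero>} \<subset> {c \<in> B. x c \<noteq> \<zero>}"
        using b by (auto simp: y_def split: if_splits)
      then have "P y" using psubset y by blast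
      have xb: "x b \<in> carrier R" using b psubset by (auto simp: free_module_apply)
      have z: "x b \<odot>\<^bsub>free_module R B\<^esub> free_basis R B b \<in> carrier (free_module R B)"
        using free_basis_closed[OF R b(1)] xb by (rule F.smult_closed[rotated])
      have "x = x b \<odot>\<^bsub>free_module R B\<^esub> free_basis R B b \<oplus>\<^bsub>free_module R B\<^esub> y"
        using psubset(3) xb F.add.m_closed[OF z y]
        by (intro free_module_ext) (auto simp: y_def free_basis_def free_module_apply)
      then show ?thesis using add[OF z y basis[OF xb b(1)] \<open>P y\<close>] by metis
    qed
  qed
qed

text \<open>The linear extension of \<open>f\<close> from the basis \<open>B\<close>. The sum runs
  over the support of \<open>x\<close> only, which keeps it finite when \<open>B\<close> is
  infinite.\<close>

definition free_lift :: "('k, 'm) ring_scheme \<Rightarrow> 'b set \<Rightarrow> ('k, 'v, 'l) module_scheme \<Rightarrow> ('b \<Rightarrow> 'v) \<Rightarrow> ('b \<Rightarrow> 'k) \<Rightarrow> 'v"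
  where "free_lift R B N f x = (\<Oplus>\<^bsub>N\<^esub>b\<in>{b \<in> B. x b \<noteq> \<zero>\<^bsub>R\<^esub>}. x b \<odot>\<^bsub>N\<^esub> f b)"

text \<open>The supports of \<open>x\<close>, \<open>y\<close> and their sum differ, so additivity
  has to be checked over one finite set that contains them all; the added terms vanish.\<close>

lemma free_lift_superset:
  assumes "module R N" "x \<in> carrier (free_module R B)" "f \<in> B \<rightarrow> carrier N"
    and "finite S" "S \<subseteq> B" "{b \<in> B. x b \<noteq> \<zero>\<^bsub>R\<^esub>} \<subseteq> S"
  shows "free_lift R B N f x = (\<Oplus>\<^bsub>N\<^esub>b\<in>S. x b \<odot>\<^bsub>N\<^esub> f b)"
proof -
  interpret module R N by fact
  show ?thesis unfolding free_lift_def
    by (rule M.finsum_mono_neutral[symmetric]) (use assms in \<open>auto simp: free_module_apply Pi_def\<close>)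
qed

lemma free_lift_hom:
  assumes "module R N" "f \<in> B \<rightarrow> carrier N"
  shows "free_lift R B N f \<in> module_hom R (free_module R B) N"
proof -
  interpret module R N by fact
  interpret F: module R "free_module R B" by (rule free_module_is_module) (rule R.is_cring)
  show ?thesis
  proof (rule module_homI)
    fix x assume "x \<in> carrier (free_module R B)"
    then show "free_lift R B N f x \<in> carrier N"
      unfolding free_lift_def using assms(2) by (intro finsum_product_closed) (auto simp: free_module_apply)
  next
    fix x y assume xy: "x \<in> carrier (free_module R B)" "y \<in> carrier (free_module R B)"
    let ?S = "{b \<in> B. x b \<noteq> \<zero>\<^bsub>R\<^esub>} \<union> {b \<in> B. y b \<noteq> \<zero>\<^bsub>R\<^esub>}"
    have S: "finite ?S" using xy by (simp add: free_module_carrier)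
    have "free_lift R B N f (x \<oplus>\<^bsub>free_module R B\<^esub> y) = (\<Oplus>\<^bsub>N\<^esub>b\<in>?S. (x \<oplus>\<^bsub>free_module R B\<^esub> y) b \<odot>\<^bsub>N\<^esub> f b)"
      by (intro free_lift_superset assms F.add.m_closed xy S) auto
    also have "\<dots> = (\<Oplus>\<^bsub>N\<^esub>b\<in>?S. x b \<odot>\<^bsub>N\<^esub> f b \<oplus>\<^bsub>N\<^esub> y b \<odot>\<^bsub>N\<^esub> f b)"
      using xy assms(2) by (intro finsum_cong') (auto simp: free_module_apply smult_l_distr Pi_def)
    also have "\<dots> = (\<Oplus>\<^bsub>N\<^esub>b\<in>?S. x b \<odot>\<^bsub>N\<^esub> f b) \<oplus>\<^bsub>N\<^esub> (\<Oplus>\<^bsub>N\<^esub>b\<in>?S. y b \<odot>\<^bsub>N\<^esub> f b)"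
      using xy assms(2) by (intro finsum_addf) (auto simp: free_module_apply Pi_def)
    also have "\<dots> = free_lift R B N f x \<oplus>\<^bsub>N\<^esub> free_lift R B N f y"
      using free_lift_superset[OF assms(1) xy(1) assms(2) S] free_lift_superset[OF assms(1) xy(2) assms(2) S] by auto
    finally show "free_lift R B N f (x \<oplus>\<^bsub>free_module R B\<^esub> y) = free_lift R B N f x \<oplus>\<^bsub>N\<^esub> free_lift R B N f y" .
  next
    fix c x assume cx: "c \<in> carrier R" "x \<in> carrier (free_module R B)"
    let ?S = "{b \<in> B. x b \<noteq> \<zero>\<^bsub>R\<^esub>}"
    have S: "finite ?S" using cx by (simp add: free_module_carrier)
    have "free_lift R B N f (c \<odot>\<^bsub>free_module R B\<^esub> x) = (\<Oplus>\<^bsub>N\<^esub>b\<in>?S. (c \<odot>\<^bsub>free_module R B\<^esub> x) b \<odot>\<^bsub>N\<^esub> f b)"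
      by (intro free_lift_superset assms F.smult_closed cx S) (use cx in auto)
    also have "\<dots> = (\<Oplus>\<^bsub>N\<^esub>b\<in>?S. c \<odot>\<^bsub>N\<^esub> (x b \<odot>\<^bsub>N\<^esub> f b))"
      using cx assms(2) by (intro finsum_cong') (auto simp: free_module_apply smult_assoc1 Pi_def)
    also have "\<dots> = c \<odot>\<^bsub>N\<^esub> (\<Oplus>\<^bsub>N\<^esub>b\<in>?S. x b \<odot>\<^bsub>N\<^esub> f b)"
      using cx assms(2) by (intro finsum_smult[symmetric]) (auto simp: free_module_apply Pi_def)
    finally show "free_lift R B N f (c \<odot>\<^bsub>free_module R B\<^esub> x) = c \<odot>\<^bsub>N\<^esub> free_lift R B N f x"
      by (simp add: free_lift_def)
  qed
qed

lemma free_lift_basis: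
  assumes "module R N" "f \<in> B \<rightarrow> carrier N" "b \<in> B"
  shows "free_lift R B N f (free_basis R B b) = f b"
proof -
  interpret module R N by fact
  have "f b \<in> carrier N" using assms by auto
  have "free_lift R B N f (free_basis R B b) = (\<Oplus>\<^bsub>N\<^esub>c\<in>{b}. free_basis R B b c \<odot>\<^bsub>N\<^esub> f c)"
    using assms by (intro free_lift_superset free_basis_closed R.is_cring)
      (auto simp: free_basis_def split: if_splits)
  then show ?thesis using assms \<open>f b \<in> carrier N\<close> by (simp add: free_basis_def)
qed

lemma free_module_finsum_apply:
  assumes "cring R" "b \<in> B" "g \<in> I \<rightarrow> carrier (free_module R B)"
  shows "(\<Oplus>\<^bsub>free_module R B\<^esub>i\<in>I. g i) b = (\<Oplus>\<^bsub>R\<^esub>i\<in>I. g i b)"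
proof -
  interpret cring R by fact
  interpret F: module R "free_module R B" by (rule free_module_is_module[OF assms(1)])
  show ?thesis using assms(3)
  proof (induct I rule: infinite_finite_induct)
    case (insert i I)
    then have g: "g i \<in> carrier (free_module R B)" "g \<in> I \<rightarrow> carrier (free_module R B)" by auto
    then have "(\<lambda>i. g i b) \<in> I \<rightarrow> carrier R" "g i b \<in> carrier R"
      using assms(2) by (auto simp: free_module_apply Pi_def)
    then show ?case using insert g assms(2) by (simp add: F.finsum_insert finsum_insert)
  qed (use assms(2) in simp_all)
qed

text \<open>\<open>free_map\<close> is given by sums over the fibres of \<open>f\<close>.
  Recognising it as the linear extension of the induced map of bases yields its linearity and its
  values on the basis. The comparison is made coordinate by coordinate.\<close>

lemma free_map_eq_lift:
  fixes R (structure)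
  assumes R: "cring R" and f: "f \<in> B \<rightarrow> C" and x: "x \<in> carrier (free_module R B)"
  shows "free_map R B C f x = free_lift R B (free_module R C) (\<lambda>b. free_basis R C (f b)) x"
proof -
  interpret cring R by fact
  interpret F: module R "free_module R C" by (rule free_module_is_module[OF R])
  have fb: "(\<lambda>b. free_basis R C (f b)) \<in> B \<rightarrow> carrier (free_module R C)"
    using f by (auto intro!: free_basis_closed[OF R])
  have lift: "free_lift R B (free_module R C) (\<lambda>b. free_basis R C (f b)) x \<in> carrier (free_module R C)"
    using module_homD(1)[OF free_lift_hom[OF F.module_axioms fb] x] .
  let ?S = "{b \<in> B. x b \<noteq> \<zero>}"
  have S: "finite ?S" using x by (simp add: free_module_carrier)
  have "free_map R B C f x c = free_lift R B (free_module R C) (\<lambda>b. free_basis R C (f b)) x c" if c: "c \<in> C" for c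
  proof -
    have g: "(\<lambda>b. x b \<odot>\<^bsub>free_module R C\<^esub> free_basis R C (f b)) \<in> ?S \<rightarrow> carrier (free_module R C)"
      using fb x by (auto simp: Pi_def free_module_apply simp del: free_module_simps intro!: F.smult_closed)
    have "free_lift R B (free_module R C) (\<lambda>b. free_basis R C (f b)) x c =
        (\<Oplus>b\<in>?S. (x b \<odot>\<^bsub>free_module R C\<^esub> free_basis R C (f b)) c)"
      unfolding free_lift_def by (rule free_module_finsum_apply[OF R c g])
    also have "\<dots> = (\<Oplus>b\<in>?S. if f b = c then x b else \<zero>)"
      using x c by (intro finsum_cong') (auto simp: free_basis_def free_module_apply)
    also have "\<dots> = (\<Oplus>b\<in>{b \<in> B. x b \<noteq> \<zero> \<and> f b = c}. if f b = c then x b else \<zero>)"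
      using x S by (intro finsum_mono_neutral) (auto simp: free_module_apply)
    also have "\<dots> = (\<Oplus>b\<in>{b \<in> B. x b \<noteq> \<zero> \<and> f b = c}. x b)"
      using x by (intro finsum_cong') (auto simp: free_module_apply)
    finally show ?thesis using c by (simp add: free_map_def)
  qed
  moreover have "free_map R B C f x \<in> extensional C" by (simp add: free_map_def)
  ultimately show ?thesis
    using lift by (intro extensionalityI[of _ C]) (auto simp: free_module_carrier PiE_def)
qed

lemma free_map_hom:
  assumes R: "cring R" and f: "f \<in> B \<rightarrow> C"
  shows "free_map R B C f \<in> module_hom R (free_module R B) (free_module R C)"
proof -
  interpret F: module R "free_module R B" by (rule free_module_is_module[OF R])
  interpret F': module R "free_module R C" by (rule free_module_is_module[OF R])
  have fb: "(\<lambda>b. free_basis R C (f b)) \<in> B \<rightarrow> carrier (free_module R C)"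
    using f by (auto intro!: free_basis_closed[OF R])
  note h = free_lift_hom[OF F'.module_axioms fb]
  show ?thesis
    by (rule module_homI)
      (simp_all add: free_map_eq_lift[OF R f] module_homD[OF h] F.add.m_closed F.smult_closed
        del: free_module_simps)
qed

lemma free_map_basis:
  assumes R: "cring R" and f: "f \<in> B \<rightarrow> C" and b: "b \<in> B"
  shows "free_map R B C f (free_basis R B b) = free_basis R C (f b)"
  using assms free_lift_basis[OF free_module_is_module[OF R], of "\<lambda>b. free_basis R C (f b)" B C b]
    free_basis_closed[OF R, of _ C]
  by (simp add: free_map_eq_lift[OF R f] free_basis_closed[OF R] Pi_def)

section \<open>Quotients and tensor products\<close>

lemma quotient_module_simps [simp]:
  "carrier (quotient_module M N) = a_rcosets\<^bsub>M\<^esub> N"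
  "\<zero>\<^bsub>quotient_module M N\<^esub> = N"
  "A \<oplus>\<^bsub>quotient_module M N\<^esub> B = A <+>\<^bsub>M\<^esub> B"
  by (simp_all add: quotient_module_def)

locale quotient = module R M for R and M (structure) +
  fixes N
  assumes sub: "submodule R N M"
begin

text \<open>A \<open>submodule\<close> is only asked to contain zero and to be closed under addition
  and scaling; a negative is a multiple by minus one.\<close>

lemma neg_closed: "x \<in> N \<Longrightarrow> \<ominus> x \<in> N"
  using smult_minus_1[of x] submodule.smult_closed[OF sub, of "\<ominus>\<^bsub>R\<^esub> \<one>\<^bsub>R\<^esub>" x] submodule.subset[OF sub]
  by auto

sublocale abelian_subgroup N M
proof (rule abelian_subgroupI3)
  show "additive_subgroup N M"
    by unfold_locales
      (use sub neg_closed in \<open>auto simp: submodule_def a_inv_def[symmetric]\<close>)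
  show "abelian_group M" by (rule M.abelian_group_axioms)
qed

lemma coset_closed: "x \<in> carrier M \<Longrightarrow> N +> x \<in> a_rcosets N"
  by (auto simp: A_RCOSETS_def' )

lemma coset_cases:
  assumes "A \<in> a_rcosets N"
  obtains x where "x \<in> carrier M" "A = N +> x"
  using assms by (auto simp: A_RCOSETS_def')

lemma coset_memD:
  assumes "x \<in> carrier M" "y \<in> N +> x"
  shows "y \<in> carrier M" "N +> y = N +> x"
proof -
  show y: "y \<in> carrier M" using a_elemrcos_carrier assms .
  show "N +> y = N +> x"
    using M.a_repr_independence[OF assms(2,1) a_subgroup] by simp
qed

lemma coset_eq_iff:
  assumes "x \<in> carrier M" "y \<in> carrier M"
  shows "N +> x = N +> y \<longleftrightarrow> x \<ominus> y \<in> N"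
  using a_rcos_module_imp[of y x] a_rcos_module_rev[of y x] a_rcos_self[of x] coset_memD[of y x] assms
  by (auto simp: M.minus_eq)

lemma smult_diff: "c \<in> carrier R \<Longrightarrow> x \<in> carrier M \<Longrightarrow> y \<in> carrier M \<Longrightarrow>
    c \<odot> (x \<ominus> y) = c \<odot> x \<ominus> c \<odot> y"
  by (simp add: M.minus_eq smult_r_distr smult_r_minus)

text \<open>Scalar multiplication on the quotient and \<open>tensor_map\<close> are unions over all
  elements of a coset. Such a union collapses to the value at any one representative as soon as the
  value depends on the coset alone.\<close>

lemma UN_coset:
  assumes "x \<in> carrier M" "\<And>y. y \<in> carrier M \<Longrightarrow> N +> y = N +> x \<Longrightarrow> f y = f x"
  shows "(\<Union>y\<in>N +> x. f y) = f x"
proof -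
  have "f y = f x" if "y \<in> N +> x" for y
    using assms coset_memD[OF assms(1) that] by blast
  then show ?thesis using a_rcos_self[OF assms(1)] by blast
qed

lemma smult_coset:
  assumes "c \<in> carrier R" "x \<in> carrier M"
  shows "c \<odot>\<^bsub>quotient_module M N\<^esub> (N +> x) = N +> (c \<odot> x)"
proof -
  have "(\<Union>y\<in>N +> x. N +> (c \<odot> y)) = N +> (c \<odot> x)"
    by (rule UN_coset)
      (use assms sub in \<open>auto simp: coset_eq_iff smult_diff[symmetric] submodule.smult_closed\<close>)
  then show ?thesis by (simp add: quotient_module_def)
qed

lemma coset_zero: "N +> \<zero> = N"
  using a_rcos_const by simp

lemma quotient_is_module: "module R (quotient_module M N)"
proof (rule module_criteria)
  show "\<forall>v\<in>carrier (quotient_module M N). \<exists>neg_v\<in>carrier (quotient_module M N).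
      v \<oplus>\<^bsub>quotient_module M N\<^esub> neg_v = \<zero>\<^bsub>quotient_module M N\<^esub>"
  proof
    fix v assume "v \<in> carrier (quotient_module M N)"
    then obtain x where x: "x \<in> carrier M" "v = N +> x" using coset_cases by auto
    then have "N +> \<ominus> x \<in> carrier (quotient_module M N)" "v \<oplus>\<^bsub>quotient_module M N\<^esub> (N +> \<ominus> x) = \<zero>\<^bsub>quotient_module M N\<^esub>"
      by (auto simp: coset_closed a_rcos_sum M.r_neg coset_zero)
    then show "\<exists>neg_v\<in>carrier (quotient_module M N). v \<oplus>\<^bsub>quotient_module M N\<^esub> neg_v = \<zero>\<^bsub>quotient_module M N\<^esub>"
      by blast
  qed
  show "\<forall>v\<in>carrier (quotient_module M N). v \<oplus>\<^bsub>quotient_module M N\<^esub> \<zero>\<^bsub>quotient_module M N\<^esub> = v"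
  proof
    fix v assume "v \<in> carrier (quotient_module M N)"
    then obtain x where x: "x \<in> carrier M" "v = N +> x" using coset_cases by auto
    then have "v <+> (N +> \<zero>) = N +> x" by (subst x(2), subst a_rcos_sum) auto
    then show "v \<oplus>\<^bsub>quotient_module M N\<^esub> \<zero>\<^bsub>quotient_module M N\<^esub> = v" using x by (simp add: coset_zero)
  qed
  show "\<zero>\<^bsub>quotient_module M N\<^esub> \<in> carrier (quotient_module M N)"
    using coset_closed[of \<zero>] by (simp add: coset_zero)
qed (auto elim!: coset_cases simp: coset_closed a_rcos_sum smult_coset M.a_ac smult_assoc1 smult_l_distr smult_r_distr
      intro: R.is_cring)

end

lemma submodule_Inter:
  assumes "\<And>L. L \<in> \<L> \<Longrightarrow> submodule R L M" "\<L> \<noteq> {}"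
  shows "submodule R (\<Inter>\<L>) M"
proof -
  obtain L0 where "L0 \<in> \<L>" using assms(2) by blast
  then interpret L0: submodule R L0 M using assms(1) by simp
  show ?thesis
  proof (rule submodule.intro)
    show "\<Inter>\<L> \<subseteq> carrier M" using L0.subset \<open>L0 \<in> \<L>\<close> by blast
  qed (use assms(1) L0.module in \<open>auto simp: submodule_def\<close>)
qed

text \<open>Lets a property of generators pass to everything they generate: the elements that
  \<open>f\<close> sends into \<open>L\<close> form a submodule, which contains the generated one
  once it contains the generators.\<close>

lemma submodule_vimage:
  assumes "module R M" "module R M'" "f \<in> module_hom R M M'" "submodule R L M'"
  shows "submodule R {x \<in> carrier M. f x \<in> L} M"
proof -
  interpret M: module R M by fact
  interpret L: submodule R L M' by fact
  show ?thesis
    by (rule submodule.intro)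
      (use assms(1) module_homD[OF assms(3)] module_hom_zero[OF assms(1-3)] in auto)
qed

lemma submodule_carrier: "module R M \<Longrightarrow> submodule R (carrier M) M"
proof -
  assume "module R M"
  then interpret module R M .
  show ?thesis by (rule submodule.intro) (auto intro: module_axioms)
qed

lemma submodule_zero: "module R M \<Longrightarrow> submodule R {\<zero>\<^bsub>M\<^esub>} M"
proof -
  assume "module R M"
  then interpret module R M .
  show ?thesis by (rule submodule.intro) (auto intro: module_axioms)
qed

section \<open>Tensor products\<close>

definition pure_tensor ::
  "('k, 'm) ring_scheme \<Rightarrow> ('k, 'v, 'l) module_scheme \<Rightarrow> ('k, 'w, 'o) module_scheme \<Rightarrow> 'v \<Rightarrow> 'w \<Rightarrow>
   ('v \<times> 'w \<Rightarrow> 'k) set"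
where
  "pure_tensor R M N v w = tensor_kernel R M N +>\<^bsub>tensor_free R M N\<^esub> free_basis R (carrier M \<times> carrier N) (v, w)"

locale tensor = M: module R M + N: module R N for R and M and N
begin

abbreviation "F \<equiv> tensor_free R M N"
abbreviation "b v w \<equiv> free_basis R (carrier M \<times> carrier N) (v, w)"

sublocale F: module R F
  unfolding tensor_free_def by (rule free_module_is_module) (rule M.R.is_cring)

lemma b_closed [simp]: "v \<in> carrier M \<Longrightarrow> w \<in> carrier N \<Longrightarrow> b v w \<in> carrier F"
  unfolding tensor_free_def by (rule free_basis_closed) (auto intro: M.R.is_cring)

lemma relations_intros:
  "\<lbrakk>v \<in> carrier M; v' \<in> carrier M; w \<in> carrier N\<rbrakk> \<Longrightarrow>
     b (v \<oplus>\<^bsub>M\<^esub> v') w \<ominus>\<^bsub>F\<^esub> (b v w \<oplus>\<^bsub>F\<^esub> b v' w) \<in> bilinear_relations R M N"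
  "\<lbrakk>v \<in> carrier M; w \<in> carrier N; w' \<in> carrier N\<rbrakk> \<Longrightarrow>
     b v (w \<oplus>\<^bsub>N\<^esub> w') \<ominus>\<^bsub>F\<^esub> (b v w \<oplus>\<^bsub>F\<^esub> b v w') \<in> bilinear_relations R M N"
  "\<lbrakk>c \<in> carrier R; v \<in> carrier M; w \<in> carrier N\<rbrakk> \<Longrightarrow>
     b (c \<odot>\<^bsub>M\<^esub> v) w \<ominus>\<^bsub>F\<^esub> (c \<odot>\<^bsub>F\<^esub> b v w) \<in> bilinear_relations R M N"
  "\<lbrakk>c \<in> carrier R; v \<in> carrier M; w \<in> carrier N\<rbrakk> \<Longrightarrow>
     b v (c \<odot>\<^bsub>N\<^esub> w) \<ominus>\<^bsub>F\<^esub> (c \<odot>\<^bsub>F\<^esub> b v w) \<in> bilinear_relations R M N"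
  unfolding bilinear_relations_def Let_def by blast+

lemma relation_cases [consumes 1, case_names add_left add_right smult_left smult_right]:
  assumes "x \<in> bilinear_relations R M N"
  obtains v v' w where "x = b (v \<oplus>\<^bsub>M\<^esub> v') w \<ominus>\<^bsub>F\<^esub> (b v w \<oplus>\<^bsub>F\<^esub> b v' w)"
      "v \<in> carrier M" "v' \<in> carrier M" "w \<in> carrier N"
    | v w w' where "x = b v (w \<oplus>\<^bsub>N\<^esub> w') \<ominus>\<^bsub>F\<^esub> (b v w \<oplus>\<^bsub>F\<^esub> b v w')"
      "v \<in> carrier M" "w \<in> carrier N" "w' \<in> carrier N"
    | c v w where "x = b (c \<odot>\<^bsub>M\<^esub> v) w \<ominus>\<^bsub>F\<^esub> (c \<odot>\<^bsub>F\<^esub> b v w)"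
      "c \<in> carrier R" "v \<in> carrier M" "w \<in> carrier N"
    | c v w where "x = b v (c \<odot>\<^bsub>N\<^esub> w) \<ominus>\<^bsub>F\<^esub> (c \<odot>\<^bsub>F\<^esub> b v w)"
      "c \<in> carrier R" "v \<in> carrier M" "w \<in> carrier N"
  using assms unfolding bilinear_relations_def Let_def by blast

lemma relations_closed: "bilinear_relations R M N \<subseteq> carrier F"
  unfolding bilinear_relations_def Let_def by auto

lemma kernel_submodule: "submodule R (tensor_kernel R M N) F"
  unfolding tensor_kernel_def
  using submodule_carrier[OF F.module_axioms] relations_closed by (intro submodule_Inter) auto

sublocale quotient R F "tensor_kernel R M N"
  by (intro quotient.intro quotient_axioms.intro F.module_axioms kernel_submodule)

lemma relations_kernel: "bilinear_relations R M N \<subseteq> tensor_kernel R M N"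
  unfolding tensor_kernel_def by auto

text \<open>The preimage of \<open>L\<close> under \<open>f\<close> is one of the submodules
  intersected in \<open>tensor_kernel\<close>, so it contains the intersection.\<close>

lemma kernel_least:
  assumes "module R P" "f \<in> module_hom R F P" "submodule R L P"
    "\<And>x. x \<in> bilinear_relations R M N \<Longrightarrow> f x \<in> L" and "x \<in> tensor_kernel R M N"
  shows "f x \<in> L"
  using submodule_vimage[OF F.module_axioms assms(1-3)] assms(4,5) relations_closed
  unfolding tensor_kernel_def by auto

abbreviation "T \<equiv> tensor_product R M N"
abbreviation "ten \<equiv> pure_tensor R M N"

sublocale T: module R T
  unfolding tensor_product_def by (rule quotient_is_module)

lemma T_eq: "T = quotient_module F (tensor_kernel R M N)"
  by (simp add: tensor_product_def)

lemma ten_closed [simp]: "v \<in> carrier M \<Longrightarrow> w \<in> carrier N \<Longrightarrow> ten v w \<in> carrier T"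
  using coset_closed by (simp add: pure_tensor_def T_eq)

lemma rel_eq:
  assumes "x \<ominus>\<^bsub>F\<^esub> y \<in> bilinear_relations R M N" "x \<in> carrier F" "y \<in> carrier F"
  shows "tensor_kernel R M N +>\<^bsub>F\<^esub> x = tensor_kernel R M N +>\<^bsub>F\<^esub> y"
  using assms coset_eq_iff relations_kernel by blast

lemma ten_add_left:
  assumes "v \<in> carrier M" "v' \<in> carrier M" "w \<in> carrier N"
  shows "ten (v \<oplus>\<^bsub>M\<^esub> v') w = ten v w \<oplus>\<^bsub>T\<^esub> ten v' w"
proof -
  have "tensor_kernel R M N +>\<^bsub>F\<^esub> b (v \<oplus>\<^bsub>M\<^esub> v') w = tensor_kernel R M N +>\<^bsub>F\<^esub> (b v w \<oplus>\<^bsub>F\<^esub> b v' w)"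
    by (rule rel_eq[OF relations_intros(1)]) (use assms in auto)
  then show ?thesis using assms by (simp add: pure_tensor_def T_eq a_rcos_sum)
qed

lemma ten_add_right:
  assumes "v \<in> carrier M" "w \<in> carrier N" "w' \<in> carrier N"
  shows "ten v (w \<oplus>\<^bsub>N\<^esub> w') = ten v w \<oplus>\<^bsub>T\<^esub> ten v w'"
proof -
  have "tensor_kernel R M N +>\<^bsub>F\<^esub> b v (w \<oplus>\<^bsub>N\<^esub> w') = tensor_kernel R M N +>\<^bsub>F\<^esub> (b v w \<oplus>\<^bsub>F\<^esub> b v w')"
    by (rule rel_eq[OF relations_intros(2)]) (use assms in auto)
  then show ?thesis using assms by (simp add: pure_tensor_def T_eq a_rcos_sum)
qed

lemma ten_smult_left:
  assumes "c \<in> carrier R" "v \<in> carrier M" "w \<in> carrier N"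
  shows "ten (c \<odot>\<^bsub>M\<^esub> v) w = c \<odot>\<^bsub>T\<^esub> ten v w"
proof -
  have "tensor_kernel R M N +>\<^bsub>F\<^esub> b (c \<odot>\<^bsub>M\<^esub> v) w = tensor_kernel R M N +>\<^bsub>F\<^esub> (c \<odot>\<^bsub>F\<^esub> b v w)"
    by (rule rel_eq[OF relations_intros(3)]) (use assms in auto)
  then show ?thesis using assms by (simp add: pure_tensor_def T_eq smult_coset)
qed

lemma ten_smult_right:
  assumes "c \<in> carrier R" "v \<in> carrier M" "w \<in> carrier N"
  shows "ten v (c \<odot>\<^bsub>N\<^esub> w) = c \<odot>\<^bsub>T\<^esub> ten v w"
proof -
  have "tensor_kernel R M N +>\<^bsub>F\<^esub> b v (c \<odot>\<^bsub>N\<^esub> w) = tensor_kernel R M N +>\<^bsub>F\<^esub> (c \<odot>\<^bsub>F\<^esub> b v w)"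
    by (rule rel_eq[OF relations_intros(4)]) (use assms in auto)
  then show ?thesis using assms by (simp add: pure_tensor_def T_eq smult_coset)
qed

text \<open>No case for scalars is needed: a multiple of a pure tensor is again pure, because the
  scalar can be absorbed into the first factor.\<close>

lemma tensor_induct [consumes 1, case_names zero pure add]:
  assumes "A \<in> carrier T"
    and "P \<zero>\<^bsub>T\<^esub>" "\<And>v w. v \<in> carrier M \<Longrightarrow> w \<in> carrier N \<Longrightarrow> P (ten v w)"
    and "\<And>A B. A \<in> carrier T \<Longrightarrow> B \<in> carrier T \<Longrightarrow> P A \<Longrightarrow> P B \<Longrightarrow> P (A \<oplus>\<^bsub>T\<^esub> B)"
  shows "P A"
proof -
  obtain x where x: "x \<in> carrier F" "A = tensor_kernel R M N +>\<^bsub>F\<^esub> x"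
    using assms(1) coset_cases by (auto simp: T_eq)
  have "P (tensor_kernel R M N +>\<^bsub>F\<^esub> x)"
    using M.R.is_cring x(1)[unfolded tensor_free_def]
  proof (induct rule: free_module_induct)
    case zero
    then show ?case using assms(2) coset_zero by (simp add: T_eq tensor_free_def[symmetric] del: free_module_simps)
  next
    case (basis c p)
    then obtain v w where p: "p = (v, w)" "v \<in> carrier M" "w \<in> carrier N" by auto
    have "P (c \<odot>\<^bsub>T\<^esub> ten v w)" using assms(3)[of "c \<odot>\<^bsub>M\<^esub> v" w] basis p by (simp add: ten_smult_left)
    then show ?case using basis p
      by (simp add: tensor_free_def[symmetric] pure_tensor_def T_eq smult_coset del: free_module_simps)
  next
    case (add x y)
    note add = add[unfolded tensor_free_def[symmetric]]
    have "P ((tensor_kernel R M N +>\<^bsub>F\<^esub> x) \<oplus>\<^bsub>T\<^esub> (tensor_kernel R M N +>\<^bsub>F\<^esub> y))"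
      using add coset_closed by (intro assms(4)) (auto simp: T_eq)
    then show ?case unfolding tensor_free_def[symmetric] using add by (simp add: T_eq a_rcos_sum)
  qed
  then show ?thesis using x by simp
qed

lemma hom_eqI:
  assumes "module R P" "f \<in> module_hom R T P" "g \<in> module_hom R T P" "A \<in> carrier T"
    and "\<And>v w. v \<in> carrier M \<Longrightarrow> w \<in> carrier N \<Longrightarrow> f (ten v w) = g (ten v w)"
  shows "f A = g A"
  using assms(4)
  by (induct rule: tensor_induct)
    (simp_all add: module_hom_zero[OF T.module_axioms assms(1)] assms(2,3,5)
      module_homD[OF assms(2)] module_homD[OF assms(3)])

text \<open>The universal property. The linear extension of \<open>f\<close> to the free module
  kills each of the four kinds of relations because \<open>f\<close> is bilinear. Hence it kills the
  submodule they generate and is constant on cosets.\<close>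

lemma lift:
  assumes P: "module R P" and cl: "\<And>v w. v \<in> carrier M \<Longrightarrow> w \<in> carrier N \<Longrightarrow> f v w \<in> carrier P"
    and "\<And>v v' w. v \<in> carrier M \<Longrightarrow> v' \<in> carrier M \<Longrightarrow> w \<in> carrier N \<Longrightarrow> f (v \<oplus>\<^bsub>M\<^esub> v') w = f v w \<oplus>\<^bsub>P\<^esub> f v' w"
    and "\<And>v w w'. v \<in> carrier M \<Longrightarrow> w \<in> carrier N \<Longrightarrow> w' \<in> carrier N \<Longrightarrow> f v (w \<oplus>\<^bsub>N\<^esub> w') = f v w \<oplus>\<^bsub>P\<^esub> f v w'"
    and "\<And>c v w. c \<in> carrier R \<Longrightarrow> v \<in> carrier M \<Longrightarrow> w \<in> carrier N \<Longrightarrow> f (c \<odot>\<^bsub>M\<^esub> v) w = c \<odot>\<^bsub>P\<^esub> f v w"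
    and "\<And>c v w. c \<in> carrier R \<Longrightarrow> v \<in> carrier M \<Longrightarrow> w \<in> carrier N \<Longrightarrow> f v (c \<odot>\<^bsub>N\<^esub> w) = c \<odot>\<^bsub>P\<^esub> f v w"
  obtains h where "h \<in> module_hom R T P" "\<And>v w. v \<in> carrier M \<Longrightarrow> w \<in> carrier N \<Longrightarrow> h (ten v w) = f v w"
proof -
  interpret P: module R P by fact
  define h where "h = free_lift R (carrier M \<times> carrier N) P (\<lambda>(v, w). f v w)"
  have fP: "(\<lambda>(v, w). f v w) \<in> carrier M \<times> carrier N \<rightarrow> carrier P" using cl by auto
  have h: "h \<in> module_hom R F P"
    unfolding h_def tensor_free_def by (rule free_lift_hom[OF P fP])
  interpret h: mod_hom R F P h by unfold_locales (rule h)
  have hb: "h (b v w) = f v w" if "v \<in> carrier M" "w \<in> carrier N" for v w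
    unfolding h_def using free_lift_basis[OF P fP, of "(v, w)"] that by simp
  have diff: "h (x \<ominus>\<^bsub>F\<^esub> y) \<in> {\<zero>\<^bsub>P\<^esub>}" if "x \<in> carrier F" "y \<in> carrier F" "h x = h y" for x y
    using that by simp
  have "h x \<in> {\<zero>\<^bsub>P\<^esub>}" if "x \<in> bilinear_relations R M N" for x
    using that by (cases rule: relation_cases) (use assms in \<open>auto simp: hb intro!: diff[simplified]\<close>)
  then have ker: "h x = \<zero>\<^bsub>P\<^esub>" if "x \<in> tensor_kernel R M N" for x
    using kernel_least[OF P h submodule_zero[OF P]] that by blast
  have eq: "h y = h x"
    if "y \<in> carrier F \<and> tensor_kernel R M N +>\<^bsub>F\<^esub> x = tensor_kernel R M N +>\<^bsub>F\<^esub> y" "x \<in> carrier F" for x y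
  proof -
    have "x \<ominus>\<^bsub>F\<^esub> y \<in> tensor_kernel R M N" using coset_eq_iff[of x y] that by simp
    from ker[OF this] have "h x \<ominus>\<^bsub>P\<^esub> h y = \<zero>\<^bsub>P\<^esub>" using that h.f_minus[of x y] by simp
    then show ?thesis using that P.M.minus_other_side[of "h x" "h y"] by (simp del: P.M.minus_other_side)
  qed
  \<comment> \<open>The value on a coset is read off a chosen representative, and \<open>eq\<close>
    makes the choice irrelevant. The first premise of \<open>eq\<close> is a conjunction so that
    \<open>someI\<close> can supply it.\<close>
  define H where "H A = h (SOME x. x \<in> carrier F \<and> A = tensor_kernel R M N +>\<^bsub>F\<^esub> x)" for A
  have H: "H (tensor_kernel R M N +>\<^bsub>F\<^esub> x) = h x" if x: "x \<in> carrier F" for x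
    unfolding H_def by (rule eq[OF someI[of _ x]]) (use x in simp_all)
  have "H \<in> module_hom R T P"
    by (rule module_homI) (auto simp: T_eq H a_rcos_sum smult_coset elim!: coset_cases)
  moreover have "H (ten v w) = f v w" if "v \<in> carrier M" "w \<in> carrier N" for v w
    using that by (simp add: pure_tensor_def H hb)
  ultimately show ?thesis using that by blast
qed

end

text \<open>The map of free modules induced by \<open>map_prod f g\<close> sends each bilinear
  relation to a relation of the same kind, hence kernel into kernel. So the union over a coset that
  defines \<open>tensor_map\<close> is a single coset.\<close>

lemma tensor_map:
  assumes "tensor R M N" "tensor R M' N'" and f: "f \<in> module_hom R M M'" and g: "g \<in> module_hom R N N'"
  shows "tensor_map R M N M' N' f g \<in> module_hom R (tensor_product R M N) (tensor_product R M' N')"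
    and "\<lbrakk>v \<in> carrier M; w \<in> carrier N\<rbrakk> \<Longrightarrow>
      tensor_map R M N M' N' f g (pure_tensor R M N v w) = pure_tensor R M' N' (f v) (g w)"
proof -
  interpret t: tensor R M N by fact
  interpret t': tensor R M' N' by fact
  define h where "h = free_map R (carrier M \<times> carrier N) (carrier M' \<times> carrier N') (map_prod f g)"
  have mp: "map_prod f g \<in> carrier M \<times> carrier N \<rightarrow> carrier M' \<times> carrier N'"
    using module_homD[OF f] module_homD[OF g] by auto
  have h: "h \<in> module_hom R t.F t'.F"
    using free_map_hom[OF t.M.R.is_cring mp] by (simp only: h_def tensor_free_def)
  interpret h: mod_hom R t.F t'.F h
    by (intro mod_hom.intro mod_hom_axioms.intro t.F.module_axioms t'.F.module_axioms h)
  have hb: "h (t.b v w) = t'.b (f v) (g w)" if "v \<in> carrier M" "w \<in> carrier N" for v w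
    using free_map_basis[OF t.M.R.is_cring mp, of "(v, w)"] that by (simp add: h_def)
  have rel: "h x \<in> bilinear_relations R M' N'" if "x \<in> bilinear_relations R M N" for x
    using that
  proof (cases rule: t.relation_cases)
    case (add_left v v' w)
    then have "h x = t'.b (f v \<oplus>\<^bsub>M'\<^esub> f v') (g w) \<ominus>\<^bsub>t'.F\<^esub> (t'.b (f v) (g w) \<oplus>\<^bsub>t'.F\<^esub> t'.b (f v') (g w))"
      by (simp add: hb module_homD[OF f] module_homD[OF g] del: t'.F.minus_other_side)
    moreover have "\<dots> \<in> bilinear_relations R M' N'"
      using add_left(2-) by (intro t'.relations_intros(1) module_homD(1)[OF f] module_homD(1)[OF g])
    ultimately show ?thesis by (simp only:)
  next
    case (add_right v w w')
    then have "h x = t'.b (f v) (g w \<oplus>\<^bsub>N'\<^esub> g w') \<ominus>\<^bsub>t'.F\<^esub> (t'.b (f v) (g w) \<oplus>\<^bsub>t'.F\<^esub> t'.b (f v) (g w'))"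
      by (simp add: hb module_homD[OF f] module_homD[OF g] del: t'.F.minus_other_side)
    moreover have "\<dots> \<in> bilinear_relations R M' N'"
      using add_right(2-) by (intro t'.relations_intros(2) module_homD(1)[OF f] module_homD(1)[OF g])
    ultimately show ?thesis by (simp only:)
  next
    case (smult_left c v w)
    then have "h x = t'.b (c \<odot>\<^bsub>M'\<^esub> f v) (g w) \<ominus>\<^bsub>t'.F\<^esub> (c \<odot>\<^bsub>t'.F\<^esub> t'.b (f v) (g w))"
      by (simp add: hb module_homD[OF f] module_homD[OF g] del: t'.F.minus_other_side)
    moreover have "\<dots> \<in> bilinear_relations R M' N'"
      using smult_left(2-) by (intro t'.relations_intros(3) module_homD(1)[OF f] module_homD(1)[OF g])
    ultimately show ?thesis by (simp only:)
  next
    case (smult_right c v w)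
    then have "h x = t'.b (f v) (c \<odot>\<^bsub>N'\<^esub> g w) \<ominus>\<^bsub>t'.F\<^esub> (c \<odot>\<^bsub>t'.F\<^esub> t'.b (f v) (g w))"
      by (simp add: hb module_homD[OF f] module_homD[OF g] del: t'.F.minus_other_side)
    moreover have "\<dots> \<in> bilinear_relations R M' N'"
      using smult_right(2-) by (intro t'.relations_intros(4) module_homD(1)[OF f] module_homD(1)[OF g])
    ultimately show ?thesis by (simp only:)
  qed
  have ker: "h x \<in> tensor_kernel R M' N'" if "x \<in> tensor_kernel R M N" for x
    using t.kernel_least[OF t'.F.module_axioms h t'.kernel_submodule _ that] rel t'.relations_kernel by blast
  have map: "tensor_map R M N M' N' f g (tensor_kernel R M N +>\<^bsub>t.F\<^esub> x) = tensor_kernel R M' N' +>\<^bsub>t'.F\<^esub> h x"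
    if "x \<in> carrier t.F" for x
    unfolding tensor_map_def h_def[symmetric]
    by (rule t.UN_coset) (use that in \<open>auto simp: t.coset_eq_iff t'.coset_eq_iff simp flip: h.f_minus intro: ker\<close>)
  show "tensor_map R M N M' N' f g \<in> module_hom R t.T t'.T"
    by (rule module_homI)
      (auto simp: t.T_eq t'.T_eq map t.a_rcos_sum t'.a_rcos_sum t.smult_coset t'.smult_coset t'.coset_closed elim!: t.coset_cases)
  show "tensor_map R M N M' N' f g (t.ten v w) = t'.ten (f v) (g w)" if "v \<in> carrier M" "w \<in> carrier N"
    using that by (simp add: pure_tensor_def map hb)
qed

section \<open>Stalks\<close>

lemma presheafD:
  assumes "presheaf T F r" "openin T U" "openin T V" "V \<subseteq> U" "s \<in> F U"
  shows "r U V s \<in> F V"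
    and "r U U s = s"
    and "openin T W \<Longrightarrow> W \<subseteq> V \<Longrightarrow> r V W (r U V s) = r U W s"
proof -
  note P = assms(1)[unfolded presheaf_def]
  have U: "openin T U \<and> openin T V \<and> V \<subseteq> U" using assms by simp
  show "r U V s \<in> F V"
    using P[THEN conjunct1, rule_format, OF U] assms(5) by (rule funcset_mem)
  show "r U U s = s"
    using P[THEN conjunct2, THEN conjunct1, rule_format, OF assms(2,5)] .
  show "r V W (r U V s) = r U W s" if "openin T W" "W \<subseteq> V"
    by (rule P[THEN conjunct2, THEN conjunct2, rule_format]) (use U that assms(5) in auto)
qed

text \<open>A germ is the class of all pairs that agree with it near \<open>x\<close>. Agreement is
  transitive on the intersection of two neighbourhoods, which gives one inclusion of classes; the
  other one follows by symmetry.\<close>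

lemma germ_eqI:
  assumes P: "presheaf T F r"
    and U: "openin T U" "s \<in> F U" and V: "openin T V" "t \<in> F V"
    and W: "openin T W" "x \<in> W" "W \<subseteq> U \<inter> V" and eq: "r U W s = r V W t"
  shows "germ T F r x U s = germ T F r x V t"
proof -
  have *: "germ T F r x U s \<subseteq> germ T F r x V t"
    if "openin T U" "s \<in> F U" "openin T V" "t \<in> F V" "openin T W" "x \<in> W" "W \<subseteq> U \<inter> V" "r U W s = r V W t"
    for U V W s t
  proof
    fix p assume "p \<in> germ T F r x U s"
    then obtain U' s' W' where p: "p = (U', s')" "openin T U'" "x \<in> U'" "s' \<in> F U'"
      "openin T W'" "x \<in> W'" "W' \<subseteq> U \<inter> U'" "r U W' s = r U' W' s'"
      unfolding germ_def by auto
    have o: "openin T (W \<inter> W')" using p that by auto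
    have "r V (W \<inter> W') t = r W (W \<inter> W') (r V W t)"
      using presheafD(3)[OF P that(3,5) _ that(4) o] that by auto
    also have "\<dots> = r U (W \<inter> W') s"
      using presheafD(3)[OF P that(1,5) _ that(2) o] that by auto
    also have "\<dots> = r W' (W \<inter> W') (r U W' s)"
      using presheafD(3)[OF P that(1) p(5) _ that(2) o] p by auto
    also have "\<dots> = r U' (W \<inter> W') s'"
      using presheafD(3)[OF P p(2) p(5) _ p(4) o] p by auto
    finally show "p \<in> germ T F r x V t"
      unfolding germ_def using p that o by blast
  qed
  show ?thesis
    using *[OF U V W eq] *[OF V U W(1,2) _ eq[symmetric]] W(3) by auto
qed

lemma germ_self: "openin T U \<Longrightarrow> x \<in> U \<Longrightarrow> s \<in> F U \<Longrightarrow> (U, s) \<in> germ T F r x U s"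
  unfolding germ_def by auto

lemma germ_memD:
  assumes "(V, t) \<in> germ T F r x U s"
  obtains W where "openin T V" "x \<in> V" "t \<in> F V" "openin T W" "x \<in> W" "W \<subseteq> U" "W \<subseteq> V" "r U W s = r V W t"
  using assms unfolding germ_def by auto

text \<open>The converse of \<open>germ_eqI\<close>: a class contains its own
  representative.\<close>

lemma germ_eqD:
  assumes "germ T F r x U s = germ T F r x V t" "openin T V" "x \<in> V" "t \<in> F V"
  obtains W where "openin T W" "x \<in> W" "W \<subseteq> U" "W \<subseteq> V" "r U W s = r V W t"
proof -
  have "(V, t) \<in> germ T F r x U s" using assms germ_self[of T V x t F r] by simp
  then show ?thesis using that by (elim germ_memD) blast
qed

lemma germ_res:
  assumes "presheaf T F r" "openin T U" "s \<in> F U" "openin T W" "x \<in> W" "W \<subseteq> U"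
  shows "germ T F r x W (r U W s) = germ T F r x U s"
  using assms presheafD[OF assms(1,2,4,6,3)] presheafD(2)[OF assms(1,4,4) _ presheafD(1)[OF assms(1,2,4,6,3)]]
  by (intro germ_eqI[of T F r W "r U W s" U s W x]) auto

lemma germ_in_germs: "openin T U \<Longrightarrow> x \<in> U \<Longrightarrow> s \<in> F U \<Longrightarrow> germ T F r x U s \<in> germs T F r x"
  unfolding germs_def by auto

lemma germsE:
  assumes "A \<in> germs T F r x"
  obtains U s where "openin T U" "x \<in> U" "s \<in> F U" "A = germ T F r x U s"
  using assms unfolding germs_def by auto

text \<open>With representatives over one open set, an identity between germs reduces to an identity
  between sections. Two presheaves are allowed, so that a germ of a function and a germ of a module
  section can be treated together.\<close>

lemma germs_common2:
  assumes P: "presheaf T F r" "presheaf T F' r'" and A: "A \<in> germs T F r x" and B: "B \<in> germs T F' r' x"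
  obtains U s t where "openin T U" "x \<in> U" "s \<in> F U" "t \<in> F' U"
    "A = germ T F r x U s" "B = germ T F' r' x U t"
proof -
  obtain U s where U: "openin T U" "x \<in> U" "s \<in> F U" "A = germ T F r x U s" by (rule germsE[OF A])
  obtain V t where V: "openin T V" "x \<in> V" "t \<in> F' V" "B = germ T F' r' x V t" by (rule germsE[OF B])
  have W: "openin T (U \<inter> V)" using U V by auto
  show ?thesis
    by (rule that[of "U \<inter> V" "r U (U \<inter> V) s" "r' V (U \<inter> V) t"])
      (use U V W in \<open>auto simp: germ_res[OF P(1)] germ_res[OF P(2)] intro: presheafD(1)[OF P(1)] presheafD(1)[OF P(2)]\<close>)
qed

lemma germs_common3:
  assumes P: "presheaf T F r" "presheaf T F' r'" "presheaf T F'' r''"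
    and A: "A \<in> germs T F r x" and B: "B \<in> germs T F' r' x" and C: "C \<in> germs T F'' r'' x"
  obtains U s t u where "openin T U" "x \<in> U" "s \<in> F U" "t \<in> F' U" "u \<in> F'' U"
    "A = germ T F r x U s" "B = germ T F' r' x U t" "C = germ T F'' r'' x U u"
proof -
  obtain U s t where U: "openin T U" "x \<in> U" "s \<in> F U" "t \<in> F' U"
    "A = germ T F r x U s" "B = germ T F' r' x U t" by (rule germs_common2[OF P(1,2) A B])
  obtain V u where V: "openin T V" "x \<in> V" "u \<in> F'' V" "C = germ T F'' r'' x V u" by (rule germsE[OF C])
  have W: "openin T (U \<inter> V)" using U V by auto
  show ?thesis
    by (rule that[of "U \<inter> V" "r U (U \<inter> V) s" "r' U (U \<inter> V) t" "r'' V (U \<inter> V) u"])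
      (use U V W in \<open>auto simp: germ_res[OF P(1)] germ_res[OF P(2)] germ_res[OF P(3)]
         intro: presheafD(1)[OF P(1)] presheafD(1)[OF P(2)] presheafD(1)[OF P(3)]\<close>)
qed

text \<open>By naturality every representative contributes the same germ, so the union over the
  class is that germ.\<close>

lemma germ_map:
  assumes "presheaf T F r" "presheaf T F' r'"
    and cl: "\<And>U s. openin T U \<Longrightarrow> s \<in> F U \<Longrightarrow> m U s \<in> F' U"
    and nat: "\<And>U V s. openin T U \<Longrightarrow> openin T V \<Longrightarrow> V \<subseteq> U \<Longrightarrow> s \<in> F U \<Longrightarrow> r' U V (m U s) = m V (r U V s)"
    and U: "openin T U" "x \<in> U" "s \<in> F U"
  shows "(\<Union>(V, t)\<in>germ T F r x U s. germ T F' r' x V (m V t)) = germ T F' r' x U (m U s)"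
proof -
  have "germ T F' r' x V (m V t) = germ T F' r' x U (m U s)" if "(V, t) \<in> germ T F r x U s" for V t
    using that
  proof (rule germ_memD)
    fix W assume W: "openin T V" "x \<in> V" "t \<in> F V" "openin T W" "x \<in> W" "W \<subseteq> U" "W \<subseteq> V" "r U W s = r V W t"
    show ?thesis
      by (rule germ_eqI[OF assms(2), of _ _ _ _ W]) (use W U in \<open>auto simp: nat intro: cl\<close>)
  qed
  then show ?thesis
    by (intro UN_constant_eq[OF germ_self[where F = F and s = s and r = r, OF U]]) auto
qed

text \<open>The common pattern of addition and multiplication in stalks and of the scalar action.
  Three presheaves are needed because the scalar action mixes functions with sections of the
  module.\<close>

lemma germ_binop:
  assumes P: "presheaf T F r" "presheaf T F' r'" "presheaf T F'' r''"
    and cl: "\<And>U s t. openin T U \<Longrightarrow> s \<in> F U \<Longrightarrow> t \<in> F' U \<Longrightarrow> m U s t \<in> F'' U"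
    and nat: "\<And>U V s t. openin T U \<Longrightarrow> openin T V \<Longrightarrow> V \<subseteq> U \<Longrightarrow> s \<in> F U \<Longrightarrow> t \<in> F' U \<Longrightarrow>
       r'' U V (m U s t) = m V (r U V s) (r' U V t)"
    and U: "openin T U" "x \<in> U" "s \<in> F U" "t \<in> F' U"
  shows "(\<Union>(V, a)\<in>germ T F r x U s. \<Union>(W, b)\<in>germ T F' r' x U t.
      germ T F'' r'' x (V \<inter> W) (m (V \<inter> W) (r V (V \<inter> W) a) (r' W (V \<inter> W) b))) = germ T F'' r'' x U (m U s t)"
proof -
  have "germ T F'' r'' x (V \<inter> W) (m (V \<inter> W) (r V (V \<inter> W) a) (r' W (V \<inter> W) b)) = germ T F'' r'' x U (m U s t)"
    if a: "(V, a) \<in> germ T F r x U s" and b: "(W, b) \<in> germ T F' r' x U t" for V a W b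
  proof -
    obtain V' where V: "openin T V" "x \<in> V" "a \<in> F V" "openin T V'" "x \<in> V'" "V' \<subseteq> U" "V' \<subseteq> V" "r U V' s = r V V' a"
      by (rule germ_memD[OF a])
    obtain W' where W: "openin T W" "x \<in> W" "b \<in> F' W" "openin T W'" "x \<in> W'" "W' \<subseteq> U" "W' \<subseteq> W" "r' U W' t = r' W W' b"
      by (rule germ_memD[OF b])
    \<comment> \<open>On \<open>Z\<close> both arbitrary representatives agree with the fixed ones
      \<open>s\<close> and \<open>t\<close>, hence so do the results of the operation.\<close>
    define Z where "Z = V' \<inter> W'"
    have Z: "openin T Z" "x \<in> Z" "Z \<subseteq> V'" "Z \<subseteq> W'" "openin T (V \<inter> W)" "Z \<subseteq> V \<inter> W" "Z \<subseteq> U"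
      using V W by (auto simp: Z_def)
    have s: "r U Z s = r V Z a"
      using presheafD(3)[OF P(1) U(1) V(4) V(6) U(3) Z(1,3)] presheafD(3)[OF P(1) V(1) V(4) V(7) V(3) Z(1,3)] V(8) by simp
    have t: "r' U Z t = r' W Z b"
      using presheafD(3)[OF P(2) U(1) W(4) W(6) U(4) Z(1,4)] presheafD(3)[OF P(2) W(1) W(4) W(7) W(3) Z(1,4)] W(8) by simp
    have a': "r V (V \<inter> W) a \<in> F (V \<inter> W)" "r (V \<inter> W) Z (r V (V \<inter> W) a) = r V Z a"
      using presheafD[OF P(1) V(1) Z(5) _ V(3)] Z by auto
    have b': "r' W (V \<inter> W) b \<in> F' (V \<inter> W)" "r' (V \<inter> W) Z (r' W (V \<inter> W) b) = r' W Z b"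
      using presheafD[OF P(2) W(1) Z(5) _ W(3)] Z by auto
    show ?thesis
      by (rule germ_eqI[OF P(3), of _ _ _ _ Z]) (use Z U a' b' s t in \<open>auto simp: nat cl\<close>)
  qed
  note * = this
  have "(\<Union>(W, b)\<in>germ T F' r' x U t.
      germ T F'' r'' x (V \<inter> W) (m (V \<inter> W) (r V (V \<inter> W) a) (r' W (V \<inter> W) b))) = germ T F'' r'' x U (m U s t)"
    if "(V, a) \<in> germ T F r x U s" for V a
    by (rule UN_constant_eq[OF germ_self[where F = F' and s = t and r = r', OF U(1,2,4)]]) (auto simp: *[OF that])
  then show ?thesis
    by (intro UN_constant_eq[OF germ_self[where F = F and s = s and r = r, OF U(1-3)]]) auto
qed

section \<open>Stalks of the structure sheaf\<close>

context ringed_space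
begin

lemma O_presheaf: "presheaf (pts S) (\<lambda>U. carrier (Osec S U)) (Ores S)"
  using structure_sheaf by (simp add: sheaf_def)

lemma Ores_hom:
  assumes "openin (pts S) U" "openin (pts S) V" "V \<subseteq> U"
  shows "a \<in> carrier (Osec S U) \<Longrightarrow> Ores S U V a \<in> carrier (Osec S V)"
    and "a \<in> carrier (Osec S U) \<Longrightarrow> b \<in> carrier (Osec S U) \<Longrightarrow>
      Ores S U V (a \<oplus>\<^bsub>Osec S U\<^esub> b) = Ores S U V a \<oplus>\<^bsub>Osec S V\<^esub> Ores S U V b"
    and "a \<in> carrier (Osec S U) \<Longrightarrow> b \<in> carrier (Osec S U) \<Longrightarrow>
      Ores S U V (a \<otimes>\<^bsub>Osec S U\<^esub> b) = Ores S U V a \<otimes>\<^bsub>Osec S V\<^esub> Ores S U V b"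
    and "Ores S U V \<one>\<^bsub>Osec S U\<^esub> = \<one>\<^bsub>Osec S V\<^esub>"
    and "Ores S U V \<zero>\<^bsub>Osec S U\<^esub> = \<zero>\<^bsub>Osec S V\<^esub>"
  using restriction_hom[OF assms] ring_hom_zero[OF restriction_hom[OF assms]] sections_cring assms
  by (auto simp: ring_hom_def cring_def Pi_iff)

lemma O_closed:
  assumes "openin (pts S) U" 
  shows "a \<in> carrier (Osec S U) \<Longrightarrow> b \<in> carrier (Osec S U) \<Longrightarrow> a \<oplus>\<^bsub>Osec S U\<^esub> b \<in> carrier (Osec S U)"
    and "a \<in> carrier (Osec S U) \<Longrightarrow> b \<in> carrier (Osec S U) \<Longrightarrow> a \<otimes>\<^bsub>Osec S U\<^esub> b \<in> carrier (Osec S U)"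
    and "\<one>\<^bsub>Osec S U\<^esub> \<in> carrier (Osec S U)" "\<zero>\<^bsub>Osec S U\<^esub> \<in> carrier (Osec S U)"
proof -
  interpret cring "Osec S U" using sections_cring[OF assms] .
  show "a \<in> carrier (Osec S U) \<Longrightarrow> b \<in> carrier (Osec S U) \<Longrightarrow> a \<oplus>\<^bsub>Osec S U\<^esub> b \<in> carrier (Osec S U)"
    and "a \<in> carrier (Osec S U) \<Longrightarrow> b \<in> carrier (Osec S U) \<Longrightarrow> a \<otimes>\<^bsub>Osec S U\<^esub> b \<in> carrier (Osec S U)"
    and "\<one>\<^bsub>Osec S U\<^esub> \<in> carrier (Osec S U)" "\<zero>\<^bsub>Osec S U\<^esub> \<in> carrier (Osec S U)" by auto
qed

lemma stalk_ring_carrier: "carrier (stalk_ring S x) = germs (pts S) (\<lambda>U. carrier (Osec S U)) (Ores S) x"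
  by (simp add: stalk_ring_def)

lemma Ogerm_closed: "openin (pts S) U \<Longrightarrow> x \<in> U \<Longrightarrow> a \<in> carrier (Osec S U) \<Longrightarrow> Ogerm S x U a \<in> carrier (stalk_ring S x)"
  unfolding stalk_ring_carrier by (rule germ_in_germs)

text \<open>One and zero of the stalk are defined as germs over the whole space; rewriting them over
  an arbitrary \<open>U\<close> lets them be combined with germs of sections over
  \<open>U\<close>.\<close>

lemma Ogerm_ops:
  assumes "openin (pts S) U" "x \<in> U"
  shows "a \<in> carrier (Osec S U) \<Longrightarrow> b \<in> carrier (Osec S U) \<Longrightarrow>
      Ogerm S x U a \<oplus>\<^bsub>stalk_ring S x\<^esub> Ogerm S x U b = Ogerm S x U (a \<oplus>\<^bsub>Osec S U\<^esub> b)"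
    and "a \<in> carrier (Osec S U) \<Longrightarrow> b \<in> carrier (Osec S U) \<Longrightarrow>
      Ogerm S x U a \<otimes>\<^bsub>stalk_ring S x\<^esub> Ogerm S x U b = Ogerm S x U (a \<otimes>\<^bsub>Osec S U\<^esub> b)"
    and "\<one>\<^bsub>stalk_ring S x\<^esub> = Ogerm S x U \<one>\<^bsub>Osec S U\<^esub>"
    and "\<zero>\<^bsub>stalk_ring S x\<^esub> = Ogerm S x U \<zero>\<^bsub>Osec S U\<^esub>"
proof -
  have U: "U \<subseteq> topspace (pts S)" using openin_subset assms by auto
  show "Ogerm S x U a \<oplus>\<^bsub>stalk_ring S x\<^esub> Ogerm S x U b = Ogerm S x U (a \<oplus>\<^bsub>Osec S U\<^esub> b)"
    if "a \<in> carrier (Osec S U)" "b \<in> carrier (Osec S U)"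
    unfolding stalk_ring_def
    using germ_binop[OF O_presheaf O_presheaf O_presheaf, of "\<lambda>U a b. a \<oplus>\<^bsub>Osec S U\<^esub> b" U x a b] assms that
    by (simp add: O_closed Ores_hom)
  show "Ogerm S x U a \<otimes>\<^bsub>stalk_ring S x\<^esub> Ogerm S x U b = Ogerm S x U (a \<otimes>\<^bsub>Osec S U\<^esub> b)"
    if "a \<in> carrier (Osec S U)" "b \<in> carrier (Osec S U)"
    unfolding stalk_ring_def
    using germ_binop[OF O_presheaf O_presheaf O_presheaf, of "\<lambda>U a b. a \<otimes>\<^bsub>Osec S U\<^esub> b" U x a b] assms that
    by (simp add: O_closed Ores_hom)
  show "\<one>\<^bsub>stalk_ring S x\<^esub> = Ogerm S x U \<one>\<^bsub>Osec S U\<^esub>"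
    using germ_res[OF O_presheaf, of "topspace (pts S)" "\<one>\<^bsub>Osec S (topspace (pts S))\<^esub>" U x] assms U
    by (simp add: stalk_ring_def Ores_hom O_closed)
  show "\<zero>\<^bsub>stalk_ring S x\<^esub> = Ogerm S x U \<zero>\<^bsub>Osec S U\<^esub>"
    using germ_res[OF O_presheaf, of "topspace (pts S)" "\<zero>\<^bsub>Osec S (topspace (pts S))\<^esub>" U x] assms U
    by (simp add: stalk_ring_def Ores_hom O_closed)
qed

end

section \<open>Stalks of a sheaf of modules\<close>

locale sheaf_of_modules = ringed_space S + O_module S E
  for S :: "('x, 'a) ringed_space_data" and E :: "('x, 'a, 'e) module_sheaf_data"
begin

abbreviation "M U \<equiv> carrier (Msec E U)"

lemma M_presheaf: "presheaf (pts S) M (Mres E)"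
  using module_sheaf by (simp add: sheaf_def)

lemma M_closed:
  assumes "openin (pts S) U"
  shows "s \<in> M U \<Longrightarrow> t \<in> M U \<Longrightarrow> s \<oplus>\<^bsub>Msec E U\<^esub> t \<in> M U"
    and "a \<in> carrier (Osec S U) \<Longrightarrow> s \<in> M U \<Longrightarrow> a \<odot>\<^bsub>Msec E U\<^esub> s \<in> M U"
    and "\<zero>\<^bsub>Msec E U\<^esub> \<in> M U"
proof -
  interpret module "Osec S U" "Msec E U" using sections_module[OF assms] .
  show "s \<in> M U \<Longrightarrow> t \<in> M U \<Longrightarrow> s \<oplus>\<^bsub>Msec E U\<^esub> t \<in> M U"
    and "a \<in> carrier (Osec S U) \<Longrightarrow> s \<in> M U \<Longrightarrow> a \<odot>\<^bsub>Msec E U\<^esub> s \<in> M U"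
    and "\<zero>\<^bsub>Msec E U\<^esub> \<in> M U" by auto
qed

lemma Mres_closed: "openin (pts S) U \<Longrightarrow> openin (pts S) V \<Longrightarrow> V \<subseteq> U \<Longrightarrow> s \<in> M U \<Longrightarrow> Mres E U V s \<in> M V"
  by (rule presheafD(1)[OF M_presheaf])

text \<open>\<open>O_module\<close> speaks of sums and multiples only. Writing zero as the zero
  section times zero, compatibility with multiples forces it to restrict to zero.\<close>

lemma Mres_zero:
  assumes "openin (pts S) U" "openin (pts S) V" "V \<subseteq> U"
  shows "Mres E U V \<zero>\<^bsub>Msec E U\<^esub> = \<zero>\<^bsub>Msec E V\<^esub>"
proof -
  interpret U: module "Osec S U" "Msec E U" using sections_module assms by blast
  interpret V: module "Osec S V" "Msec E V" using sections_module assms by blast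
  have "Mres E U V (\<zero>\<^bsub>Osec S U\<^esub> \<odot>\<^bsub>Msec E U\<^esub> \<zero>\<^bsub>Msec E U\<^esub>) = \<zero>\<^bsub>Osec S V\<^esub> \<odot>\<^bsub>Msec E V\<^esub> Mres E U V \<zero>\<^bsub>Msec E U\<^esub>"
    using restriction_smult[OF assms O_closed(4)[OF assms(1)] M_closed(3)[OF assms(1)]] Ores_hom(5)[OF assms] by simp
  then show ?thesis using Mres_closed[OF assms] by simp
qed

lemma stalk_module_carrier: "carrier (stalk_module S E x) = germs (pts S) M (Mres E) x"
  by (simp add: stalk_module_def)

lemma Mgerm_closed: "openin (pts S) U \<Longrightarrow> x \<in> U \<Longrightarrow> s \<in> M U \<Longrightarrow> Mgerm S E x U s \<in> carrier (stalk_module S E x)"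
  unfolding stalk_module_carrier by (rule germ_in_germs)

lemma Mgerm_ops:
  assumes "openin (pts S) U" "x \<in> U"
  shows "s \<in> M U \<Longrightarrow> t \<in> M U \<Longrightarrow>
      Mgerm S E x U s \<oplus>\<^bsub>stalk_module S E x\<^esub> Mgerm S E x U t = Mgerm S E x U (s \<oplus>\<^bsub>Msec E U\<^esub> t)"
    and "a \<in> carrier (Osec S U) \<Longrightarrow> s \<in> M U \<Longrightarrow>
      Ogerm S x U a \<odot>\<^bsub>stalk_module S E x\<^esub> Mgerm S E x U s = Mgerm S E x U (a \<odot>\<^bsub>Msec E U\<^esub> s)"
    and "\<zero>\<^bsub>stalk_module S E x\<^esub> = Mgerm S E x U \<zero>\<^bsub>Msec E U\<^esub>"
proof -
  have U: "U \<subseteq> topspace (pts S)" using openin_subset assms by auto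
  show "Mgerm S E x U s \<oplus>\<^bsub>stalk_module S E x\<^esub> Mgerm S E x U t = Mgerm S E x U (s \<oplus>\<^bsub>Msec E U\<^esub> t)"
    if "s \<in> M U" "t \<in> M U"
    unfolding stalk_module_def
    using germ_binop[OF M_presheaf M_presheaf M_presheaf, of "\<lambda>U a b. a \<oplus>\<^bsub>Msec E U\<^esub> b" U x s t] assms that
    by (simp add: M_closed restriction_add)
  show "Ogerm S x U a \<odot>\<^bsub>stalk_module S E x\<^esub> Mgerm S E x U s = Mgerm S E x U (a \<odot>\<^bsub>Msec E U\<^esub> s)"
    if "a \<in> carrier (Osec S U)" "s \<in> M U"
    unfolding stalk_module_def
    using germ_binop[OF O_presheaf M_presheaf M_presheaf, of "\<lambda>U a b. a \<odot>\<^bsub>Msec E U\<^esub> b" U x a s] assms that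
    by (simp add: M_closed restriction_smult)
  show "\<zero>\<^bsub>stalk_module S E x\<^esub> = Mgerm S E x U \<zero>\<^bsub>Msec E U\<^esub>"
    using germ_res[OF M_presheaf, of "topspace (pts S)" "\<zero>\<^bsub>Msec E (topspace (pts S))\<^esub>" U x] assms U
    by (simp add: stalk_module_def Mres_zero M_closed)
qed

text \<open>Each axiom is inherited from the sections over an open set common to all germs involved.
  That the stalk of the structure sheaf is a commutative ring is a premise: for a locally ringed
  space it is part of \<open>local_ring\<close>.\<close>

lemma stalk_is_module:
  assumes K: "cring (stalk_ring S x)" and x: "x \<in> topspace (pts S)"
  shows "module (stalk_ring S x) (stalk_module S E x)"
proof -
  note common = germs_common3[OF O_presheaf O_presheaf M_presheaf, of _ x]
    and common' = germs_common3[OF O_presheaf M_presheaf M_presheaf, of _ x]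
    and common'' = germs_common3[OF M_presheaf M_presheaf M_presheaf, of _ x]
  let ?R = "stalk_ring S x" and ?M = "stalk_module S E x"
  show ?thesis
  proof (rule module_criteria)
    show "\<zero>\<^bsub>?M\<^esub> \<in> carrier ?M"
      using x by (simp add: Mgerm_ops(3)[of "topspace (pts S)"] Mgerm_closed M_closed)
    show "\<forall>v w. v \<in> carrier ?M \<and> w \<in> carrier ?M \<longrightarrow> v \<oplus>\<^bsub>?M\<^esub> w \<in> carrier ?M"
    proof (intro allI impI; elim conjE)
      fix v w assume "v \<in> carrier ?M" "w \<in> carrier ?M"
      then obtain U s t where "openin (pts S) U" "x \<in> U" "s \<in> M U" "t \<in> M U" "v = Mgerm S E x U s" "w = Mgerm S E x U t"
        unfolding stalk_module_carrier by (rule germs_common2[OF M_presheaf M_presheaf])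
      then show "v \<oplus>\<^bsub>?M\<^esub> w \<in> carrier ?M"
        by (simp add: Mgerm_ops M_closed Mgerm_closed)
    qed
    show "\<forall>c v. c \<in> carrier ?R \<and> v \<in> carrier ?M \<longrightarrow>
        c \<odot>\<^bsub>?M\<^esub> v \<in> carrier ?M"
    proof (intro allI impI; elim conjE)
      fix c v assume "c \<in> carrier ?R" "v \<in> carrier ?M"
      then obtain U s t where "openin (pts S) U" "x \<in> U" "s \<in> carrier (Osec S U)" "t \<in> M U"
        "c = Ogerm S x U s" "v = Mgerm S E x U t"
        unfolding stalk_module_carrier stalk_ring_carrier by (rule germs_common2[OF O_presheaf M_presheaf])
      then show "c \<odot>\<^bsub>?M\<^esub> v \<in> carrier ?M"
        by (simp add: Mgerm_ops Ogerm_ops M_closed O_closed Mgerm_closed)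
    qed
    show "\<forall>v\<in>carrier ?M. \<exists>w\<in>carrier ?M. v \<oplus>\<^bsub>?M\<^esub> w = \<zero>\<^bsub>?M\<^esub>"
    proof
      fix v assume "v \<in> carrier ?M"
      then obtain U s where U: "openin (pts S) U" "x \<in> U" "s \<in> M U" "v = Mgerm S E x U s"
        unfolding stalk_module_carrier by (rule germsE)
      interpret module "Osec S U" "Msec E U" using sections_module U by blast
      show "\<exists>w\<in>carrier ?M. v \<oplus>\<^bsub>?M\<^esub> w = \<zero>\<^bsub>?M\<^esub>"
        by (rule bexI[of _ "Mgerm S E x U (\<ominus>\<^bsub>Msec E U\<^esub> s)"])
          (use U in \<open>auto simp: Mgerm_ops(1) Mgerm_ops(3)[OF U(1,2)] Mgerm_closed M.r_neg\<close>)
    qed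
    show "\<forall>v w. v \<in> carrier ?M \<and> w \<in> carrier ?M \<longrightarrow>
        v \<oplus>\<^bsub>?M\<^esub> w = w \<oplus>\<^bsub>?M\<^esub> v"
    proof (intro allI impI; elim conjE)
      fix v w assume "v \<in> carrier ?M" "w \<in> carrier ?M"
      then obtain U s t where "openin (pts S) U" "x \<in> U" "s \<in> M U" "t \<in> M U"
        "v = Mgerm S E x U s" "w = Mgerm S E x U t"
        unfolding stalk_module_carrier stalk_ring_carrier by (rule germs_common2[OF M_presheaf M_presheaf])
      then show "v \<oplus>\<^bsub>?M\<^esub> w = w \<oplus>\<^bsub>?M\<^esub> v"
        by (simp add: Mgerm_ops Ogerm_ops M_closed O_closed abelian_monoid.a_comm[OF abelian_group.axioms(1)[OF module.axioms(2)[OF sections_module]]])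
    qed
    show "\<forall>v w z. v \<in> carrier ?M \<and> w \<in> carrier ?M \<and> z \<in> carrier ?M \<longrightarrow>
        v \<oplus>\<^bsub>?M\<^esub> w \<oplus>\<^bsub>?M\<^esub> z = v \<oplus>\<^bsub>?M\<^esub> (w \<oplus>\<^bsub>?M\<^esub> z)"
    proof (intro allI impI; elim conjE)
      fix v w z assume "v \<in> carrier ?M" "w \<in> carrier ?M" "z \<in> carrier ?M"
      then obtain U s t u where "openin (pts S) U" "x \<in> U" "s \<in> M U" "t \<in> M U" "u \<in> M U"
        "v = Mgerm S E x U s" "w = Mgerm S E x U t" "z = Mgerm S E x U u"
        unfolding stalk_module_carrier stalk_ring_carrier by (rule common'')
      then show "v \<oplus>\<^bsub>?M\<^esub> w \<oplus>\<^bsub>?M\<^esub> z = v \<oplus>\<^bsub>?M\<^esub> (w \<oplus>\<^bsub>?M\<^esub> z)"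
        by (simp add: Mgerm_ops Ogerm_ops M_closed O_closed abelian_monoid.a_assoc[OF abelian_group.axioms(1)[OF module.axioms(2)[OF sections_module]]])
    qed
    show "\<forall>v\<in>carrier ?M. v \<oplus>\<^bsub>?M\<^esub> \<zero>\<^bsub>?M\<^esub> = v"
    proof
      fix v assume "v \<in> carrier ?M"
      then obtain U s where U: "openin (pts S) U" "x \<in> U" "s \<in> M U" "v = Mgerm S E x U s"
        unfolding stalk_module_carrier by (rule germsE)
      interpret module "Osec S U" "Msec E U" using sections_module U by blast
      show "v \<oplus>\<^bsub>?M\<^esub> \<zero>\<^bsub>?M\<^esub> = v"
        using U by (simp add: Mgerm_ops(3)[OF U(1,2)] Mgerm_ops(1))
    qed
    show "\<forall>v\<in>carrier ?M. \<one>\<^bsub>?R\<^esub> \<odot>\<^bsub>?M\<^esub> v = v"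
    proof
      fix v assume "v \<in> carrier ?M"
      then obtain U s where U: "openin (pts S) U" "x \<in> U" "s \<in> M U" "v = Mgerm S E x U s"
        unfolding stalk_module_carrier by (rule germsE)
      interpret module "Osec S U" "Msec E U" using sections_module U by blast
      show "\<one>\<^bsub>?R\<^esub> \<odot>\<^bsub>?M\<^esub> v = v"
        using U by (simp add: Ogerm_ops(3)[OF U(1,2)] Mgerm_ops(2))
    qed
    show "\<forall>a b v. a \<in> carrier ?R \<and> b \<in> carrier ?R \<and> v \<in> carrier ?M \<longrightarrow>
        (a \<otimes>\<^bsub>?R\<^esub> b) \<odot>\<^bsub>?M\<^esub> v = a \<odot>\<^bsub>?M\<^esub> (b \<odot>\<^bsub>?M\<^esub> v)"
    proof (intro allI impI; elim conjE)
      fix a b v assume "a \<in> carrier ?R" "b \<in> carrier ?R" "v \<in> carrier ?M"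
      then obtain U s t u where "openin (pts S) U" "x \<in> U" "s \<in> carrier (Osec S U)" "t \<in> carrier (Osec S U)" "u \<in> M U"
        "a = Ogerm S x U s" "b = Ogerm S x U t" "v = Mgerm S E x U u"
        unfolding stalk_module_carrier stalk_ring_carrier by (rule common)
      then show "(a \<otimes>\<^bsub>?R\<^esub> b) \<odot>\<^bsub>?M\<^esub> v = a \<odot>\<^bsub>?M\<^esub> (b \<odot>\<^bsub>?M\<^esub> v)"
        by (simp add: Mgerm_ops Ogerm_ops M_closed O_closed module.smult_assoc1[OF sections_module])
    qed
    show "\<forall>a b v. a \<in> carrier ?R \<and> b \<in> carrier ?R \<and> v \<in> carrier ?M \<longrightarrow>
        (a \<oplus>\<^bsub>?R\<^esub> b) \<odot>\<^bsub>?M\<^esub> v = a \<odot>\<^bsub>?M\<^esub> v \<oplus>\<^bsub>?M\<^esub> b \<odot>\<^bsub>?M\<^esub> v"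
    proof (intro allI impI; elim conjE)
      fix a b v assume "a \<in> carrier ?R" "b \<in> carrier ?R" "v \<in> carrier ?M"
      then obtain U s t u where "openin (pts S) U" "x \<in> U" "s \<in> carrier (Osec S U)" "t \<in> carrier (Osec S U)" "u \<in> M U"
        "a = Ogerm S x U s" "b = Ogerm S x U t" "v = Mgerm S E x U u"
        unfolding stalk_module_carrier stalk_ring_carrier by (rule common)
      then show "(a \<oplus>\<^bsub>?R\<^esub> b) \<odot>\<^bsub>?M\<^esub> v = a \<odot>\<^bsub>?M\<^esub> v \<oplus>\<^bsub>?M\<^esub> b \<odot>\<^bsub>?M\<^esub> v"
        by (simp add: Mgerm_ops Ogerm_ops M_closed O_closed module.smult_l_distr[OF sections_module])
    qed
    show "\<forall>a v w. a \<in> carrier ?R \<and> v \<in> carrier ?M \<and> w \<in> carrier ?M \<longrightarrow>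
        a \<odot>\<^bsub>?M\<^esub> (v \<oplus>\<^bsub>?M\<^esub> w) = a \<odot>\<^bsub>?M\<^esub> v \<oplus>\<^bsub>?M\<^esub> a \<odot>\<^bsub>?M\<^esub> w"
    proof (intro allI impI; elim conjE)
      fix a v w assume "a \<in> carrier ?R" "v \<in> carrier ?M" "w \<in> carrier ?M"
      then obtain U s t u where "openin (pts S) U" "x \<in> U" "s \<in> carrier (Osec S U)" "t \<in> M U" "u \<in> M U"
        "a = Ogerm S x U s" "v = Mgerm S E x U t" "w = Mgerm S E x U u"
        unfolding stalk_module_carrier stalk_ring_carrier by (rule common')
      then show "a \<odot>\<^bsub>?M\<^esub> (v \<oplus>\<^bsub>?M\<^esub> w) = a \<odot>\<^bsub>?M\<^esub> v \<oplus>\<^bsub>?M\<^esub> a \<odot>\<^bsub>?M\<^esub> w"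
        by (simp add: Mgerm_ops Ogerm_ops M_closed O_closed module.smult_r_distr[OF sections_module])
    qed
  qed (rule K)
qed

end

lemma stalk_map_germ:
  assumes "presheaf (pts S) (\<lambda>U. carrier (Msec E U)) (Mres E)" "presheaf (pts S) (\<lambda>U. carrier (Msec F U)) (Mres F)"
    and "\<And>U s. openin (pts S) U \<Longrightarrow> s \<in> carrier (Msec E U) \<Longrightarrow> \<psi> U s \<in> carrier (Msec F U)"
    and "\<And>U V s. openin (pts S) U \<Longrightarrow> openin (pts S) V \<Longrightarrow> V \<subseteq> U \<Longrightarrow> s \<in> carrier (Msec E U) \<Longrightarrow>
      Mres F U V (\<psi> U s) = \<psi> V (Mres E U V s)"
    and "openin (pts S) U" "x \<in> U" "s \<in> carrier (Msec E U)"
  shows "stalk_map S F \<psi> x (Mgerm S E x U s) = Mgerm S F x U (\<psi> U s)"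
  unfolding stalk_map_def by (rule germ_map[OF assms(1,2,3,4,5,6,7)])

section \<open>Fractions\<close>

text \<open>If no power of \<open>a\<close> were zero, the zero ideal would avoid all powers of
  \<open>a\<close>. By Zorn's lemma there is then an ideal maximal among those that avoid them; it
  is prime, yet does not contain \<open>a\<close>.\<close>

lemma (in cring) nilpotent_if_in_all_primes:
  assumes a: "a \<in> carrier R" and primes: "\<And>P. primeideal P R \<Longrightarrow> a \<in> P"
  obtains n :: nat where "a [^] n = \<zero>"
proof (rule ccontr)
  assume "\<not> thesis"
  then have nz: "a [^] n \<noteq> \<zero>" for n :: nat using that by blast
  define \<A> where "\<A> = {I. ideal I R \<and> (\<forall>n::nat. a [^] n \<notin> I)}"
  have "\<exists>M\<in>\<A>. \<forall>Y\<in>\<A>. M \<subseteq> Y \<longrightarrow> Y = M"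
  proof (rule subset_Zorn_nonempty)
    have "{\<zero>} \<in> \<A>" using nz zeroideal by (auto simp: \<A>_def)
    then show "\<A> \<noteq> {}" by blast
  next
    fix C assume C: "C \<noteq> {}" "subset.chain \<A> C"
    then have "subset.chain {I. ideal I R} C" by (auto simp: pred_on.chain_def \<A>_def)
    from chain_Union_is_ideal[OF this] have "ideal (\<Union>C) R" using C(1) by simp
    moreover have "C \<subseteq> \<A>" using C(2) by (auto simp: pred_on.chain_def)
    ultimately show "\<Union>C \<in> \<A>" by (auto simp: \<A>_def)
  qed
  then obtain M where M: "M \<in> \<A>" and max: "\<And>Y. Y \<in> \<A> \<Longrightarrow> M \<subseteq> Y \<Longrightarrow> Y = M" by blast
  interpret M: ideal M R using M by (simp add: \<A>_def)
  \<comment> \<open>Adjoining an element outside \<open>M\<close> gives a strictly larger ideal,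
    which by maximality must contain a power of \<open>a\<close>.\<close>
  have pow: "\<exists>n::nat. \<exists>i\<in>M. \<exists>r\<in>carrier R. a [^] n = i \<oplus> r \<otimes> x" if x: "x \<in> carrier R" "x \<notin> M" for x
  proof -
    have id: "ideal (M <+> PIdl x) R" by (intro add_ideals M.is_ideal cgenideal_ideal x)
    have "M \<subseteq> M <+> PIdl x"
    proof
      fix m assume m: "m \<in> M"
      have "m = m \<oplus> \<zero> \<otimes> x" using m x by simp
      then show "m \<in> M <+> PIdl x" using m unfolding set_add_def' cgenideal_def by blast
    qed
    moreover have "x \<in> M <+> PIdl x"
    proof -
      have "x = \<zero> \<oplus> \<one> \<otimes> x" using x by simp
      then show ?thesis using M.zero_closed unfolding set_add_def' cgenideal_def by blast
    qed
    ultimately have "M <+> PIdl x \<notin> \<A>" using max x by blast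
    then obtain n :: nat where "a [^] n \<in> M <+> PIdl x" using id by (auto simp: \<A>_def)
    then show ?thesis unfolding set_add_def' cgenideal_def by blast
  qed
  have "primeideal M R"
  proof (rule primeidealI)
    show "carrier R \<noteq> M"
      using M nat_pow_closed[OF a] by (auto simp: \<A>_def)
  next
    fix x y assume xy: "x \<in> carrier R" "y \<in> carrier R" "x \<otimes> y \<in> M"
    show "x \<in> M \<or> y \<in> M"
    proof (rule ccontr)
      assume "\<not> (x \<in> M \<or> y \<in> M)"
      then obtain n m i j r s where n: "i \<in> M" "r \<in> carrier R" "a [^] (n::nat) = i \<oplus> r \<otimes> x"
        and m: "j \<in> M" "s \<in> carrier R" "a [^] (m::nat) = j \<oplus> s \<otimes> y"
        using pow xy by metis
      \<comment> \<open>Multiplying the two expressions, every term contains \<open>i\<close>,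
        \<open>j\<close> or \<open>x \<otimes> y\<close> as a factor and so lies in
        \<open>M\<close>, which was to avoid this power.\<close>
      have "a [^] (n + m) = (i \<oplus> r \<otimes> x) \<otimes> (j \<oplus> s \<otimes> y)"
        using a n m by (simp add: nat_pow_mult[symmetric])
      also have "\<dots> = i \<otimes> (j \<oplus> s \<otimes> y) \<oplus> (r \<otimes> x \<otimes> j \<oplus> r \<otimes> s \<otimes> (x \<otimes> y))"
        using n m xy M.a_Hcarr by (simp add: l_distr r_distr m_ac a_ac)
      also have "\<dots> \<in> M"
        using n(1,2) m(1,2) xy M.a_Hcarr
          M.a_closed[OF M.I_r_closed[OF n(1)] M.a_closed[OF M.I_l_closed[OF m(1)] M.I_l_closed[OF xy(3)]]]
        by simp
      finally show False using M by (auto simp: \<A>_def)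
    qed
  qed (rule M.is_ideal, rule is_cring)
  then have "a [^] (1::nat) \<in> M" using primes a by simp
  then show False using M unfolding \<A>_def by blast
qed

locale fractions = cring A for A (structure) +
  fixes S assumes sub: "S \<subseteq> carrier A" and one: "\<one> \<in> S" and mult: "\<And>s t. s \<in> S \<Longrightarrow> t \<in> S \<Longrightarrow> s \<otimes> t \<in> S"
begin

lemma S_closed: "s \<in> S \<Longrightarrow> s \<in> carrier A"
  using sub by auto

text \<open>Transitivity of equality of fractions. As \<open>S\<close> may contain zero divisors,
  equality involves a multiplier. The one used here is \<open>h \<otimes> h' \<otimes> s\<close>: it
  combines the two given multipliers and contains the denominator \<open>s\<close> of the middle
  fraction, which cannot be cancelled.\<close>

lemma frac_subset:
  assumes "a \<in> carrier A" "s \<in> S" "b \<in> carrier A" "t \<in> S" "h \<in> S" and eq: "h \<otimes> (a \<otimes> t) = h \<otimes> (b \<otimes> s)"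
  shows "frac A S a s \<subseteq> frac A S b t"
proof
  fix p assume "p \<in> frac A S a s"
  then obtain c u h' where p: "p = (c, u)" "c \<in> carrier A" "u \<in> S" "h' \<in> S" "h' \<otimes> (a \<otimes> u) = h' \<otimes> (c \<otimes> s)"
    unfolding frac_def by auto
  note cl = assms(1,3) p(2) S_closed[OF assms(2)] S_closed[OF assms(4)] S_closed[OF assms(5)] S_closed[OF p(3)] S_closed[OF p(4)]
  have "(h \<otimes> h' \<otimes> s) \<otimes> (b \<otimes> u) = h' \<otimes> u \<otimes> (h \<otimes> (b \<otimes> s))" using cl by (simp add: m_ac)
  also have "\<dots> = h \<otimes> t \<otimes> (h' \<otimes> (a \<otimes> u))" using cl by (simp add: eq[symmetric] m_ac)
  also have "\<dots> = (h \<otimes> h' \<otimes> s) \<otimes> (c \<otimes> t)" using cl by (simp add: p(5) m_ac)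
  finally have "\<exists>h\<in>S. h \<otimes> (b \<otimes> u) = h \<otimes> (c \<otimes> t)"
    using mult assms(2,5) p(4) by blast
  then show "p \<in> frac A S b t" unfolding frac_def using p by auto
qed

lemma frac_eqI:
  assumes "a \<in> carrier A" "s \<in> S" "b \<in> carrier A" "t \<in> S" "h \<in> S" "h \<otimes> (a \<otimes> t) = h \<otimes> (b \<otimes> s)"
  shows "frac A S a s = frac A S b t"
  using frac_subset[OF assms] frac_subset[OF assms(3,4,1,2,5) assms(6)[symmetric]] by auto

lemma frac_memD:
  assumes "(b, t) \<in> frac A S a s"
  obtains h where "b \<in> carrier A" "t \<in> S" "h \<in> S" "h \<otimes> (a \<otimes> t) = h \<otimes> (b \<otimes> s)"
  using assms unfolding frac_def by auto

lemma frac_self: "a \<in> carrier A \<Longrightarrow> s \<in> S \<Longrightarrow> (a, s) \<in> frac A S a s"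
  unfolding frac_def using one by auto

lemma frac_closed: "a \<in> carrier A \<Longrightarrow> s \<in> S \<Longrightarrow> frac A S a s \<in> carrier (localization A S)"
  by (auto simp: localization_def)

lemma UN2_const:
  assumes "p \<in> Z" "q \<in> B" "\<And>a s b t. (a, s) \<in> Z \<Longrightarrow> (b, t) \<in> B \<Longrightarrow> f a s b t = c"
  shows "(\<Union>(a, s)\<in>Z. \<Union>(b, t)\<in>B. f a s b t) = c"
  by (rule UN_constant_eq[OF assms(1)]) (auto intro!: UN_constant_eq[OF assms(2)] simp: assms(3))

lemma localization_mult:
  assumes ab: "a \<in> carrier A" "s \<in> S" "b \<in> carrier A" "t \<in> S"
  shows "frac A S a s \<otimes>\<^bsub>localization A S\<^esub> frac A S b t = frac A S (a \<otimes> b) (s \<otimes> t)"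
proof -
  have "(\<Union>(a', s')\<in>frac A S a s. \<Union>(b', t')\<in>frac A S b t. frac A S (a' \<otimes> b') (s' \<otimes> t')) = frac A S (a \<otimes> b) (s \<otimes> t)"
  proof (rule UN2_const[OF frac_self frac_self])
    fix a' s' b' t' assume "(a', s') \<in> frac A S a s" "(b', t') \<in> frac A S b t"
    then obtain h h' where h: "a' \<in> carrier A" "s' \<in> S" "h \<in> S" "h \<otimes> (a \<otimes> s') = h \<otimes> (a' \<otimes> s)"
      and h': "b' \<in> carrier A" "t' \<in> S" "h' \<in> S" "h' \<otimes> (b \<otimes> t') = h' \<otimes> (b' \<otimes> t)"
      by (elim frac_memD)
    note cl = ab(1,3) h(1) h'(1) ab(2,4)[THEN S_closed] h(2,3)[THEN S_closed] h'(2,3)[THEN S_closed]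
    have "(h \<otimes> h') \<otimes> (a' \<otimes> b' \<otimes> (s \<otimes> t)) = (h \<otimes> (a' \<otimes> s)) \<otimes> (h' \<otimes> (b' \<otimes> t))"
      using cl by (simp add: m_ac)
    also have "\<dots> = (h \<otimes> (a \<otimes> s')) \<otimes> (h' \<otimes> (b \<otimes> t'))" by (simp only: h(4) h'(4))
    also have "\<dots> = (h \<otimes> h') \<otimes> (a \<otimes> b \<otimes> (s' \<otimes> t'))" using cl by (simp add: m_ac)
    finally show "frac A S (a' \<otimes> b') (s' \<otimes> t') = frac A S (a \<otimes> b) (s \<otimes> t)"
      using ab h h' by (intro frac_eqI[of _ _ _ _ "h \<otimes> h'"]) (auto intro: mult)
  qed (use ab in auto)
  then show ?thesis by (simp add: localization_def)
qed

lemma localization_add: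
  assumes ab: "a \<in> carrier A" "s \<in> S" "b \<in> carrier A" "t \<in> S"
  shows "frac A S a s \<oplus>\<^bsub>localization A S\<^esub> frac A S b t = frac A S (a \<otimes> t \<oplus> b \<otimes> s) (s \<otimes> t)"
proof -
  have "(\<Union>(a', s')\<in>frac A S a s. \<Union>(b', t')\<in>frac A S b t. frac A S (a' \<otimes> t' \<oplus> b' \<otimes> s') (s' \<otimes> t')) =
      frac A S (a \<otimes> t \<oplus> b \<otimes> s) (s \<otimes> t)"
  proof (rule UN2_const[OF frac_self frac_self])
    fix a' s' b' t' assume "(a', s') \<in> frac A S a s" "(b', t') \<in> frac A S b t"
    then obtain h h' where h: "a' \<in> carrier A" "s' \<in> S" "h \<in> S" "h \<otimes> (a \<otimes> s') = h \<otimes> (a' \<otimes> s)"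
      and h': "b' \<in> carrier A" "t' \<in> S" "h' \<in> S" "h' \<otimes> (b \<otimes> t') = h' \<otimes> (b' \<otimes> t)"
      by (elim frac_memD)
    note cl = ab(1,3) h(1) h'(1) ab(2,4)[THEN S_closed] h(2,3)[THEN S_closed] h'(2,3)[THEN S_closed]
    have "(h \<otimes> h') \<otimes> ((a' \<otimes> t' \<oplus> b' \<otimes> s') \<otimes> (s \<otimes> t)) =
        (h \<otimes> (a' \<otimes> s)) \<otimes> (h' \<otimes> t' \<otimes> t) \<oplus> (h' \<otimes> (b' \<otimes> t)) \<otimes> (h \<otimes> s' \<otimes> s)"
      using cl by (simp add: m_ac l_distr r_distr)
    also have "\<dots> = (h \<otimes> (a \<otimes> s')) \<otimes> (h' \<otimes> t' \<otimes> t) \<oplus> (h' \<otimes> (b \<otimes> t')) \<otimes> (h \<otimes> s' \<otimes> s)"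
      by (simp only: h(4) h'(4))
    also have "\<dots> = (h \<otimes> h') \<otimes> ((a \<otimes> t \<oplus> b \<otimes> s) \<otimes> (s' \<otimes> t'))"
      using cl by (simp add: m_ac l_distr r_distr)
    finally show "frac A S (a' \<otimes> t' \<oplus> b' \<otimes> s') (s' \<otimes> t') = frac A S (a \<otimes> t \<oplus> b \<otimes> s) (s \<otimes> t)"
      using ab h h' S_closed by (intro frac_eqI[of _ _ _ _ "h \<otimes> h'"]) (auto intro: mult)
  qed (use ab in auto)
  then show ?thesis by (simp add: localization_def)
qed

end

section \<open>The spectrum of a ring\<close>

lemma zariski_prime: "openin (zariski A) U \<Longrightarrow> P \<in> U \<Longrightarrow> primeideal P A"
  by (auto simp: openin_zariski zariski_open_def)

lemma zariski_basic_open: "a \<in> carrier A \<Longrightarrow> openin (zariski A) {P. primeideal P A \<and> a \<notin> P}"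
  unfolding openin_zariski zariski_open_def by (intro exI[of _ "{a}"]) auto

lemma primeideal_fractions:
  assumes "primeideal P A"
  shows "fractions A (carrier A - P)"
proof -
  interpret primeideal P A by fact
  have "\<one>\<^bsub>A\<^esub> \<notin> P" using I_notcarr one_imp_carrier by auto
  then show ?thesis
    by unfold_locales (use I_prime in auto)
qed

lemma Spec_simps:
  "pts (Spec A) = zariski A"
  "carrier (Osec (Spec A) U) = spec_sections A U"
  "s \<otimes>\<^bsub>Osec (Spec A) U\<^esub> t = (\<lambda>P\<in>U. s P \<otimes>\<^bsub>localization A (carrier A - P)\<^esub> t P)"
  "s \<oplus>\<^bsub>Osec (Spec A) U\<^esub> t = (\<lambda>P\<in>U. s P \<oplus>\<^bsub>localization A (carrier A - P)\<^esub> t P)"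
  "\<one>\<^bsub>Osec (Spec A) U\<^esub> = (\<lambda>P\<in>U. \<one>\<^bsub>localization A (carrier A - P)\<^esub>)"
  "\<zero>\<^bsub>Osec (Spec A) U\<^esub> = (\<lambda>P\<in>U. \<zero>\<^bsub>localization A (carrier A - P)\<^esub>)"
  "Ores (Spec A) U V s = restrict s V"
  by (simp_all add: Spec_def)

definition frac_section :: "('a, 'm) ring_scheme \<Rightarrow> 'a set set \<Rightarrow> 'a \<Rightarrow> 'a \<Rightarrow> 'a set \<Rightarrow> ('a \<times> 'a) set" where
  "frac_section A U a f = (\<lambda>P\<in>U. frac A (carrier A - P) a f)"

context cring
begin

lemma frac_section_closed:
  assumes "openin (zariski R) U" "a \<in> carrier R" "f \<in> carrier R" "\<And>P. P \<in> U \<Longrightarrow> f \<notin> P"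
  shows "frac_section R U a f \<in> carrier (Osec (Spec R) U)"
proof -
  have "frac R (carrier R - P) a f \<in> carrier (localization R (carrier R - P))" if "P \<in> U" for P
    using fractions.frac_closed[OF primeideal_fractions[OF zariski_prime[OF assms(1) that]]] assms that by auto
  moreover have "\<exists>V a' f'. openin (zariski R) V \<and> P \<in> V \<and> V \<subseteq> U \<and> a' \<in> carrier R \<and> f' \<in> carrier R \<and>
      (\<forall>Q\<in>V. f' \<notin> Q \<and> frac_section R U a f Q = frac R (carrier R - Q) a' f')" if "P \<in> U" for P
    using assms that by (intro exI[of _ U] exI[of _ a] exI[of _ f]) (auto simp: frac_section_def)
  ultimately show ?thesis
    unfolding Spec_simps spec_sections_def by (auto simp: frac_section_def)
qed

lemma frac_section_mult:
  assumes "openin (zariski R) U" "a \<in> carrier R" "f \<in> carrier R" "b \<in> carrier R" "g \<in> carrier R"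
    "\<And>P. P \<in> U \<Longrightarrow> f \<notin> P" "\<And>P. P \<in> U \<Longrightarrow> g \<notin> P"
  shows "frac_section R U a f \<otimes>\<^bsub>Osec (Spec R) U\<^esub> frac_section R U b g = frac_section R U (a \<otimes> b) (f \<otimes> g)"
  unfolding Spec_simps frac_section_def
  using fractions.localization_mult[OF primeideal_fractions[OF zariski_prime[OF assms(1)]]] assms
  by (intro restrict_ext) auto

lemma frac_section_add:
  assumes "openin (zariski R) U" "a \<in> carrier R" "f \<in> carrier R" "b \<in> carrier R" "g \<in> carrier R"
    "\<And>P. P \<in> U \<Longrightarrow> f \<notin> P" "\<And>P. P \<in> U \<Longrightarrow> g \<notin> P"
  shows "frac_section R U a f \<oplus>\<^bsub>Osec (Spec R) U\<^esub> frac_section R U b g = frac_section R U (a \<otimes> g \<oplus> b \<otimes> f) (f \<otimes> g)"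
  unfolding Spec_simps frac_section_def
  using fractions.localization_add[OF primeideal_fractions[OF zariski_prime[OF assms(1)]]] assms
  by (intro restrict_ext) auto

lemma frac_section_one: "\<one>\<^bsub>Osec (Spec R) U\<^esub> = frac_section R U \<one> \<one>"
  by (simp add: Spec_simps frac_section_def localization_def)

text \<open>Equality of the cross products in the ring itself serves all primes at once, with the
  unit as multiplier.\<close>

lemma frac_section_eq:
  assumes "openin (zariski R) U" "a \<in> carrier R" "f \<in> carrier R" "b \<in> carrier R" "g \<in> carrier R"
    "\<And>P. P \<in> U \<Longrightarrow> f \<notin> P" "\<And>P. P \<in> U \<Longrightarrow> g \<notin> P" and eq: "a \<otimes> g = b \<otimes> f"
  shows "frac_section R U a f = frac_section R U b g"
  unfolding frac_section_def
proof (rule restrict_ext)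
  fix P assume P: "P \<in> U"
  interpret fractions R "carrier R - P" by (rule primeideal_fractions[OF zariski_prime[OF assms(1) P]])
  show "frac R (carrier R - P) a f = frac R (carrier R - P) b g"
    by (rule frac_eqI[OF _ _ _ _ one]) (use assms P in auto)
qed

end

lemma prime_one_notin: "primeideal P A \<Longrightarrow> \<one>\<^bsub>A\<^esub> \<notin> P"
  using fractions.one[OF primeideal_fractions] by auto

section \<open>The function field of an integral scheme\<close>

lemma lrs_morphism_hom:
  assumes "lrs_morphism S Y f \<phi>" "openin (pts Y) V"
  shows "\<phi> V \<in> ring_hom (Osec Y V) (Osec S (preim S f V))"
  using assms unfolding lrs_morphism_def by simp

lemma lrs_morphism_res:
  assumes "lrs_morphism S Y f \<phi>" "openin (pts Y) V" "openin (pts Y) W" "W \<subseteq> V" "t \<in> carrier (Osec Y V)"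
  shows "\<phi> W (Ores Y V W t) = Ores S (preim S f V) (preim S f W) (\<phi> V t)"
  using assms unfolding lrs_morphism_def by blast

lemma lrs_morphism_preim:
  assumes "lrs_morphism S Y f \<phi>" "openin (pts Y) V"
  shows "openin (pts S) (preim S f V)"
  using assms openin_continuous_map_preimage[of "pts S" "pts Y" f V] unfolding lrs_morphism_def preim_def by simp

text \<open>Every point lies in the closure of \<epsilon>, so each of its open neighbourhoods meets
  the set consisting of \<epsilon> alone.\<close>

lemma generic_point_mem:
  assumes "generic_point S \<epsilon>" "openin (pts S) U" "U \<noteq> {}"
  shows "\<epsilon> \<in> U"
proof -
  obtain y where y: "y \<in> U" using assms(3) by blast
  then have "y \<in> pts S closure_of {\<epsilon>}"
    using assms openin_subset unfolding generic_point_def by blast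
  then show ?thesis using assms(2) y unfolding in_closure_of by blast
qed

lemma (in domain) pow_eq_zero:
  assumes "x \<in> carrier R" "x [^] (n::nat) = \<zero>"
  shows "x = \<zero>"
  using assms(2)
proof (induct n)
  case (Suc n)
  then show ?case using assms(1) integral[of "x [^] n" x] by auto
qed simp

lemma integral_scheme_ringed_space: "integral_scheme S \<Longrightarrow> ringed_space S"
  by (simp add: integral_scheme_def scheme_def locally_ringed_space_def)

text \<open>In an affine chart, a germ at the generic prime \<open>P\<close> is a fraction \<open>a / g\<close>. If \<open>a\<close> is not in \<open>P\<close>, the
  germ is invertible. Otherwise no prime avoids \<open>a\<close>, because \<open>P\<close> would lie in the open set of all such
  primes; hence \<open>a\<close> is nilpotent and the germ vanishes, the rings of sections being domains.\<close>

theorem function_field_is_field: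
  assumes S: "integral_scheme S" and \<epsilon>: "generic_point S \<epsilon>"
  shows "field (function_field S \<epsilon>)"
proof -
  interpret ringed_space S by (rule integral_scheme_ringed_space[OF S])
  have top: "\<epsilon> \<in> topspace (pts S)" using \<epsilon> by (simp add: generic_point_def)
  have loc: "local_ring (stalk_ring S \<epsilon>)"
    using S top by (simp add: integral_scheme_def scheme_def locally_ringed_space_def)
  interpret K: cring "stalk_ring S \<epsilon>" using loc by (simp add: local_ring_def)
  have charts: "\<forall>x\<in>topspace (pts S). \<exists>U (A :: 'b ring) f \<phi>.
      openin (pts S) U \<and> x \<in> U \<and> cring A \<and> lrs_isomorphism (open_subspace S U) (Spec A) f \<phi>"
    using S by (simp add: integral_scheme_def scheme_def)
  \<comment> \<open>A local ring has a maximal ideal, which is proper; the zero ring has no proper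
    ideal.\<close>
  have nontriv: "\<one>\<^bsub>stalk_ring S \<epsilon>\<^esub> \<noteq> \<zero>\<^bsub>stalk_ring S \<epsilon>\<^esub>"
  proof
    assume eq: "\<one>\<^bsub>stalk_ring S \<epsilon>\<^esub> = \<zero>\<^bsub>stalk_ring S \<epsilon>\<^esub>"
    obtain m where "maximalideal m (stalk_ring S \<epsilon>)" using loc by (auto simp: local_ring_def)
    then interpret m: maximalideal m "stalk_ring S \<epsilon>" .
    have "carrier (stalk_ring S \<epsilon>) = m"
      using K.one_zeroD[OF eq] m.zero_closed m.a_Hcarr by auto
    then show False using m.I_notcarr by simp
  qed
  have unit: "x = \<zero>\<^bsub>stalk_ring S \<epsilon>\<^esub> \<or> x \<in> Units (stalk_ring S \<epsilon>)" if x: "x \<in> carrier (stalk_ring S \<epsilon>)" for x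
  proof -
    obtain U and A :: "'b ring" and f \<phi> where U: "openin (pts S) U" "\<epsilon> \<in> U" and A: "cring A"
      and iso: "lrs_isomorphism (open_subspace S U) (Spec A) f \<phi>"
      using charts[rule_format, OF top] by blast
    interpret A: cring A by (rule A)
    let ?S = "open_subspace S U"
    have mor: "lrs_morphism ?S (Spec A) f \<phi>" and homeo: "homeomorphic_map (pts ?S) (zariski A) f"
      and bij: "\<And>V. openin (zariski A) V \<Longrightarrow>
        bij_betw (\<phi> V) (carrier (Osec (Spec A) V)) (carrier (Osec S (preim ?S f V)))"
      using iso by (simp_all add: lrs_isomorphism_def Spec_simps open_subspace_def)
    have ptsU: "pts ?S = subtopology (pts S) U" "Osec ?S = Osec S" "Ores ?S = Ores S"
      by (simp_all add: open_subspace_def)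
    have topU: "topspace (pts ?S) = U" using openin_subset[OF U(1)] by (auto simp: ptsU)
    have opn: "openin (pts S) (preim ?S f V)" "preim ?S f V \<subseteq> U" if "openin (zariski A) V" for V
      using lrs_morphism_preim[OF mor] that U by (auto simp: Spec_simps ptsU openin_open_subtopology)
    \<comment> \<open>The point \<open>f \<epsilon>\<close> is generic in the spectrum: the chart is
      surjective, so the preimage of a nonempty open set is nonempty and open, and contains
      \<epsilon>.\<close>
    have gen: "f \<epsilon> \<in> V" if "openin (zariski A) V" "V \<noteq> {}" for V
    proof -
      have "f ` U = topspace (zariski A)" using homeomorphic_imp_surjective_map[OF homeo] topU by simp
      moreover obtain y where "y \<in> V" using \<open>V \<noteq> {}\<close> by blast
      ultimately obtain z where "z \<in> U" "f z \<in> V" using openin_subset[OF \<open>openin (zariski A) V\<close>] by (metis imageE subsetD)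
      then have "preim ?S f V \<noteq> {}" unfolding preim_def topU by blast
      then have "\<epsilon> \<in> preim ?S f V" using generic_point_mem[OF \<epsilon> opn(1)[OF that(1)]] by simp
      then show ?thesis by (simp add: preim_def)
    qed
    obtain W0 s0 where W0: "openin (pts S) W0" "\<epsilon> \<in> W0" "s0 \<in> carrier (Osec S W0)" "x = Ogerm S \<epsilon> W0 s0"
      using x unfolding stalk_ring_carrier by (rule germsE)
    define W where "W = W0 \<inter> U"
    have W: "openin (pts S) W" "\<epsilon> \<in> W" "W \<subseteq> U" "W \<subseteq> W0" using W0 U by (auto simp: W_def)
    define s where "s = Ores S W0 W s0"
    have s: "s \<in> carrier (Osec S W)" "x = Ogerm S \<epsilon> W s"
      using W0 W by (auto simp: s_def Ores_hom germ_res[OF O_presheaf])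
    define Z where "Z = f ` W"
    have Z: "openin (zariski A) Z"
      using homeomorphic_imp_open_map[OF homeo] W U unfolding open_map_def Z_def
      by (simp add: ptsU openin_open_subtopology)
    have preZ: "preim ?S f Z = W"
      using homeomorphic_imp_injective_map[OF homeo] W unfolding preim_def topU Z_def by (auto dest: inj_onD)
    obtain \<sigma> where \<sigma>: "\<sigma> \<in> carrier (Osec (Spec A) Z)" "\<phi> Z \<sigma> = s"
      using bij_betw_imp_surj_on[OF bij[OF Z]] s(1) unfolding preZ by (metis imageE)
    have "f \<epsilon> \<in> Z" using W by (simp add: Z_def)
    moreover have "\<forall>P\<in>Z. \<exists>V a f. openin (zariski A) V \<and> P \<in> V \<and> V \<subseteq> Z \<and> a \<in> carrier A \<and> f \<in> carrier A \<and>
          (\<forall>Q\<in>V. f \<notin> Q \<and> \<sigma> Q = frac A (carrier A - Q) a f)"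
      using \<sigma>(1) unfolding Spec_simps spec_sections_def mem_Collect_eq by (rule conjunct2)
    ultimately obtain V a g where V: "openin (zariski A) V" "f \<epsilon> \<in> V" "V \<subseteq> Z" and a: "a \<in> carrier A" and g: "g \<in> carrier A"
      and ag: "\<And>Q. Q \<in> V \<Longrightarrow> g \<notin> Q \<and> \<sigma> Q = frac A (carrier A - Q) a g"
      by metis
    \<comment> \<open>\<open>V'\<close> is left free because two choices are needed: all of
      \<open>V\<close> when \<open>a\<close> vanishes at the generic prime, and the part of
      \<open>V\<close> where \<open>a\<close> avoids every prime otherwise.\<close>
    have res: "Ores S W (preim ?S f V') s = \<phi> V' (frac_section A V' a g)"
      "\<epsilon> \<in> preim ?S f V'" "preim ?S f V' \<subseteq> W" "x = Ogerm S \<epsilon> (preim ?S f V') (\<phi> V' (frac_section A V' a g))"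
      if V': "openin (zariski A) V'" "f \<epsilon> \<in> V'" "V' \<subseteq> V" for V'
    proof -
      have "restrict \<sigma> V' = frac_section A V' a g"
        using ag V' by (auto simp: frac_section_def intro!: restrict_ext)
      then show 1: "Ores S W (preim ?S f V') s = \<phi> V' (frac_section A V' a g)"
        using lrs_morphism_res[OF mor, of Z V' \<sigma>] Z V' V \<sigma> preZ by (simp add: Spec_simps ptsU subset_trans)
      show 2: "\<epsilon> \<in> preim ?S f V'" using V' U by (simp add: preim_def topU)
      show 3: "preim ?S f V' \<subseteq> W" using V' V preZ by (auto simp: preim_def)
      show "x = Ogerm S \<epsilon> (preim ?S f V') (\<phi> V' (frac_section A V' a g))"
        unfolding 1[symmetric] s(2) using germ_res[OF O_presheaf W(1) s(1) opn(1)[OF V'(1)] 2 3] by simp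
    qed
    show ?thesis
    proof (cases "a \<in> f \<epsilon>")
      case False
      let ?D = "{P. primeideal P A \<and> a \<notin> P}"
      define V' where "V' = V \<inter> ?D"
      have V': "openin (zariski A) V'" "f \<epsilon> \<in> V'" "V' \<subseteq> V"
        using V False zariski_basic_open[OF a] zariski_prime[OF V(1,2)] by (auto simp: V'_def)
      have nin: "\<And>P. P \<in> V' \<Longrightarrow> a \<notin> P" "\<And>P. P \<in> V' \<Longrightarrow> g \<notin> P" "\<And>P. P \<in> V' \<Longrightarrow> \<one>\<^bsub>A\<^esub> \<notin> P"
        "\<And>P. P \<in> V' \<Longrightarrow> g \<otimes>\<^bsub>A\<^esub> a \<notin> P"
      proof -
        fix P assume P: "P \<in> V'"
        then have "primeideal P A" by (simp add: V'_def)
        then show "a \<notin> P" "g \<notin> P" "\<one>\<^bsub>A\<^esub> \<notin> P" using P ag by (auto simp: V'_def prime_one_notin)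
        then show "g \<otimes>\<^bsub>A\<^esub> a \<notin> P" using primeideal.I_prime[OF \<open>primeideal P A\<close> g a] by blast
      qed
      let ?p = "preim ?S f V'"
      have hom: "\<phi> V' \<in> ring_hom (Osec (Spec A) V') (Osec S ?p)"
        using lrs_morphism_hom[OF mor, of V'] V' by (simp add: Spec_simps ptsU)
      let ?u = "frac_section A V' a g" and ?v = "frac_section A V' g a"
      have u: "?u \<in> carrier (Osec (Spec A) V')" and v: "?v \<in> carrier (Osec (Spec A) V')"
        using A.frac_section_closed V' a g nin by auto
      have "?u \<otimes>\<^bsub>Osec (Spec A) V'\<^esub> ?v = frac_section A V' (a \<otimes>\<^bsub>A\<^esub> g) (g \<otimes>\<^bsub>A\<^esub> a)"
        using A.frac_section_mult V' a g nin by simp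
      also have "\<dots> = frac_section A V' \<one>\<^bsub>A\<^esub> \<one>\<^bsub>A\<^esub>"
        using V' a g nin by (intro A.frac_section_eq) (auto simp: A.m_comm)
      also have "\<dots> = \<one>\<^bsub>Osec (Spec A) V'\<^esub>" by (simp add: A.frac_section_one)
      finally have uv: "\<phi> V' ?u \<otimes>\<^bsub>Osec S ?p\<^esub> \<phi> V' ?v = \<one>\<^bsub>Osec S ?p\<^esub>"
        using ring_hom_mult[OF hom u v] ring_hom_one[OF hom] by simp
      note p = opn(1)[OF V'(1)] res(2)[OF V']
      have cl: "\<phi> V' ?u \<in> carrier (Osec S ?p)" "\<phi> V' ?v \<in> carrier (Osec S ?p)"
        using ring_hom_closed[OF hom] u v by auto
      have "x \<otimes>\<^bsub>stalk_ring S \<epsilon>\<^esub> Ogerm S \<epsilon> ?p (\<phi> V' ?v) = \<one>\<^bsub>stalk_ring S \<epsilon>\<^esub>"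
        using Ogerm_ops(2)[OF p cl] Ogerm_ops(3)[OF p] uv res(4)[OF V'] by simp
      moreover have y: "Ogerm S \<epsilon> ?p (\<phi> V' ?v) \<in> carrier (stalk_ring S \<epsilon>)" by (rule Ogerm_closed[OF p cl(2)])
      ultimately have "Ogerm S \<epsilon> ?p (\<phi> V' ?v) \<otimes>\<^bsub>stalk_ring S \<epsilon>\<^esub> x = \<one>\<^bsub>stalk_ring S \<epsilon>\<^esub>"
        "x \<otimes>\<^bsub>stalk_ring S \<epsilon>\<^esub> Ogerm S \<epsilon> ?p (\<phi> V' ?v) = \<one>\<^bsub>stalk_ring S \<epsilon>\<^esub>"
        using K.m_comm[OF y x] by simp_all
      then have "x \<in> Units (stalk_ring S \<epsilon>)"
        using x y unfolding Units_def by blast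
      then show ?thesis by simp
    next
      case True
      have primes: "a \<in> P" if "primeideal P A" for P
      proof (rule ccontr)
        assume "a \<notin> P"
        then have "f \<epsilon> \<in> {P. primeideal P A \<and> a \<notin> P}"
          using gen[OF zariski_basic_open[OF a]] that by blast
        then show False using True by simp
      qed
      obtain n :: nat where n: "a [^]\<^bsub>A\<^esub> n = \<zero>\<^bsub>A\<^esub>"
        by (rule A.nilpotent_if_in_all_primes[OF a primes])
      let ?p = "preim ?S f V"
      note p = opn(1)[OF V(1)] res(2)[OF V(1,2) subset_refl]
      have hom: "\<phi> V \<in> ring_hom (Osec (Spec A) V) (Osec S ?p)"
        using lrs_morphism_hom[OF mor, of V] V by (simp add: Spec_simps ptsU)
      interpret D: domain "Osec S ?p"
        using S p unfolding integral_scheme_def by blast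
      have nin: "g [^]\<^bsub>A\<^esub> m \<notin> P" "\<one>\<^bsub>A\<^esub> \<notin> P" if "P \<in> V" for P and m :: nat
      proof -
        have P: "primeideal P A" using zariski_prime[OF V(1) that] .
        then show one: "\<one>\<^bsub>A\<^esub> \<notin> P" by (rule prime_one_notin)
        show "g [^]\<^bsub>A\<^esub> m \<notin> P"
        proof (induct m)
          case (Suc m)
          then show ?case using primeideal.I_prime[OF P A.nat_pow_closed[OF g] g, of m] ag[OF that] by auto
        qed (use one in simp)
      qed
      \<comment> \<open>The section \<open>?u m\<close> is the \<open>m\<close>-th power of the
        fraction of \<open>a\<close> by \<open>g\<close>. For the exponent \<open>n\<close> its
        numerator is zero.\<close>
      let ?u = "\<lambda>m::nat. frac_section A V (a [^]\<^bsub>A\<^esub> m) (g [^]\<^bsub>A\<^esub> m)"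
      have u: "?u m \<in> carrier (Osec (Spec A) V)" for m
        using A.frac_section_closed[OF V(1)] a g nin by auto
      have mult: "?u (Suc m) = ?u m \<otimes>\<^bsub>Osec (Spec A) V\<^esub> ?u 1" for m
        using A.frac_section_mult[OF V(1), of "a [^]\<^bsub>A\<^esub> m" "g [^]\<^bsub>A\<^esub> m" a g] a g nin ag by simp
      have cl: "\<phi> V (?u 1) \<in> carrier (Osec S ?p)" using ring_hom_closed[OF hom u] .
      have pow: "\<phi> V (?u m) = \<phi> V (?u 1) [^]\<^bsub>Osec S ?p\<^esub> m" for m
      proof (induct m)
        case 0
        then show ?case using ring_hom_one[OF hom] by (simp add: A.frac_section_one)
      next
        case (Suc m)
        have "\<phi> V (?u (Suc m)) = \<phi> V (?u m) \<otimes>\<^bsub>Osec S ?p\<^esub> \<phi> V (?u 1)"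
          unfolding mult by (rule ring_hom_mult[OF hom u u])
        then show ?case using Suc by simp
      qed
      have z: "frac_section A V \<zero>\<^bsub>A\<^esub> \<one>\<^bsub>A\<^esub> \<in> carrier (Osec (Spec A) V)"
        using A.frac_section_closed[OF V(1)] nin by auto
      \<comment> \<open>The definition of \<open>ring_hom\<close> says nothing about zero. The image
        of the zero fraction is found from \<open>z + z = z\<close>, which forces
        \<open>z = 0\<close> in the ring of sections of \<open>S\<close>.\<close>
      have "frac_section A V \<zero>\<^bsub>A\<^esub> \<one>\<^bsub>A\<^esub> \<oplus>\<^bsub>Osec (Spec A) V\<^esub> frac_section A V \<zero>\<^bsub>A\<^esub> \<one>\<^bsub>A\<^esub> = frac_section A V \<zero>\<^bsub>A\<^esub> \<one>\<^bsub>A\<^esub>"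
        using A.frac_section_add[OF V(1), of "\<zero>\<^bsub>A\<^esub>" "\<one>\<^bsub>A\<^esub>" "\<zero>\<^bsub>A\<^esub>" "\<one>\<^bsub>A\<^esub>"] nin by simp
      then have "\<phi> V (frac_section A V \<zero>\<^bsub>A\<^esub> \<one>\<^bsub>A\<^esub>) \<oplus>\<^bsub>Osec S ?p\<^esub> \<phi> V (frac_section A V \<zero>\<^bsub>A\<^esub> \<one>\<^bsub>A\<^esub>) =
          \<phi> V (frac_section A V \<zero>\<^bsub>A\<^esub> \<one>\<^bsub>A\<^esub>)"
        using ring_hom_add[OF hom z z] by simp
      then have "\<phi> V (frac_section A V \<zero>\<^bsub>A\<^esub> \<one>\<^bsub>A\<^esub>) = \<zero>\<^bsub>Osec S ?p\<^esub>"
        using ring_hom_closed[OF hom z] D.add.l_cancel_one by simp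
      moreover have "?u n = frac_section A V \<zero>\<^bsub>A\<^esub> \<one>\<^bsub>A\<^esub>"
        unfolding n using A.nat_pow_closed[OF g] nin by (intro A.frac_section_eq V(1)) auto
      ultimately have "\<phi> V (?u 1) [^]\<^bsub>Osec S ?p\<^esub> n = \<zero>\<^bsub>Osec S ?p\<^esub>" using pow[of n] by simp
      then have "\<phi> V (?u 1) = \<zero>\<^bsub>Osec S ?p\<^esub>" using D.pow_eq_zero[OF cl] by blast
      then show ?thesis
        using res(4)[OF V(1,2) subset_refl] Ogerm_ops(4)[OF p] a g by simp
    qed
  qed
  show ?thesis
  proof (rule K.cring_fieldI, intro equalityI subsetI)
    fix x assume x: "x \<in> Units (stalk_ring S \<epsilon>)"
    then obtain y where y: "y \<in> carrier (stalk_ring S \<epsilon>)" "y \<otimes>\<^bsub>stalk_ring S \<epsilon>\<^esub> x = \<one>\<^bsub>stalk_ring S \<epsilon>\<^esub>"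
      using K.Units_l_inv_ex by blast
    have "x \<noteq> \<zero>\<^bsub>stalk_ring S \<epsilon>\<^esub>" using y(2) K.r_null[OF y(1)] nontriv by metis
    then show "x \<in> carrier (stalk_ring S \<epsilon>) - {\<zero>\<^bsub>stalk_ring S \<epsilon>\<^esub>}" using x K.Units_closed by simp
  next
    fix x assume "x \<in> carrier (stalk_ring S \<epsilon>) - {\<zero>\<^bsub>stalk_ring S \<epsilon>\<^esub>}"
    then show "x \<in> Units (stalk_ring S \<epsilon>)" using unit[of x] by simp
  qed
qed

section \<open>Scalars\<close>

text \<open>A scalar \<open>c\<close> becomes the fraction of \<open>c\<close> by one on the whole
  spectrum, is pulled back along the structure morphism and then restricted. Each of the three maps
  is a ring homomorphism.\<close>

lemma scalar_section_hom:
  assumes k: "cring k" and S: "ringed_space S" and mor: "lrs_morphism S (Spec k) \<pi> \<phi>" and U: "openin (pts S) U"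
  shows "scalar_section k S \<pi> \<phi> U \<in> ring_hom k (Osec S U)"
    and "openin (pts S) V \<Longrightarrow> V \<subseteq> U \<Longrightarrow> c \<in> carrier k \<Longrightarrow>
      Ores S U V (scalar_section k S \<pi> \<phi> U c) = scalar_section k S \<pi> \<phi> V c"
proof -
  interpret k: cring k by (rule k)
  interpret ringed_space S by (rule S)
  let ?Sp = "topspace (zariski k)"
  have Sp: "openin (zariski k) ?Sp" by simp
  have one: "\<And>P. P \<in> ?Sp \<Longrightarrow> \<one>\<^bsub>k\<^esub> \<notin> P" using zariski_prime[OF Sp] prime_one_notin by blast
  let ?p = "preim S \<pi> ?Sp"
  have "continuous_map (pts S) (pts (Spec k)) \<pi>" using mor by (simp add: lrs_morphism_def)
  from continuous_map_funspace[OF this] have "\<pi> \<in> topspace (pts S) \<rightarrow> ?Sp" by (simp add: Spec_simps)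
  \<comment> \<open>The definition of \<open>scalar_section\<close> starts from the preimage of the
    spectrum, which is the whole space because a continuous map takes its values in the target
    space.\<close>
  then have p: "?p = topspace (pts S)" unfolding preim_def by auto
  have hom: "\<phi> ?Sp \<in> ring_hom (Osec (Spec k) ?Sp) (Osec S ?p)"
    using lrs_morphism_hom[OF mor, of ?Sp] by (simp add: Spec_simps)
  have "(\<lambda>c. frac_section k ?Sp c \<one>\<^bsub>k\<^esub>) \<in> ring_hom k (Osec (Spec k) ?Sp)"
    by (rule ring_hom_memI)
      (use one in \<open>auto simp: k.frac_section_mult[OF Sp] k.frac_section_add[OF Sp] k.frac_section_one
         intro: k.frac_section_closed[OF Sp]\<close>)
  then have c: "(\<lambda>c. \<phi> ?Sp (frac_section k ?Sp c \<one>\<^bsub>k\<^esub>)) \<in> ring_hom k (Osec S ?p)"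
    using ring_hom_trans[OF _ hom] by (simp add: comp_def)
  have eq: "scalar_section k S \<pi> \<phi> U c = Ores S ?p U (\<phi> ?Sp (frac_section k ?Sp c \<one>\<^bsub>k\<^esub>))" for U c
    by (simp add: scalar_section_def Let_def frac_section_def)
  have Up: "U \<subseteq> ?p" using openin_subset[OF U] p by simp
  have "Ores S ?p U \<in> ring_hom (Osec S ?p) (Osec S U)"
    using restriction_hom[OF _ U Up] p by simp
  then show "scalar_section k S \<pi> \<phi> U \<in> ring_hom k (Osec S U)"
    using ring_hom_trans[OF c] unfolding eq[abs_def] by (simp add: comp_def)
  show "Ores S U V (scalar_section k S \<pi> \<phi> U c) = scalar_section k S \<pi> \<phi> V c"
    if "openin (pts S) V" "V \<subseteq> U" "c \<in> carrier k"
    unfolding eq using presheafD(3)[OF O_presheaf _ U Up _ that(1,2)] p ring_hom_closed[OF c that(3)] by simp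
qed

text \<open>Allows a scalar to be multiplied with the germ of a section that is only given over
  \<open>U\<close>.\<close>

lemma scalar_germ_eq:
  assumes "cring k" "ringed_space S" "lrs_morphism S (Spec k) \<pi> \<phi>" and U: "openin (pts S) U" "x \<in> U"
    and c: "c \<in> carrier k"
  shows "scalar_germ k S \<pi> \<phi> x c = Ogerm S x U (scalar_section k S \<pi> \<phi> U c)"
proof -
  interpret ringed_space S by fact
  have top: "openin (pts S) (topspace (pts S))" "U \<subseteq> topspace (pts S)" using openin_subset[OF U(1)] by auto
  show ?thesis
    unfolding scalar_germ_def
    using germ_res[OF O_presheaf top(1) _ U(1,2) top(2), of "scalar_section k S \<pi> \<phi> (topspace (pts S)) c"]
      scalar_section_hom(2)[OF assms(1-3) top(1) U(1) top(2) c]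
      ring_hom_closed[OF scalar_section_hom(1)[OF assms(1-3) top(1)] c] by simp
qed

lemma scalar_germ_hom:
  assumes "cring k" "ringed_space S" "lrs_morphism S (Spec k) \<pi> \<phi>" and x: "x \<in> topspace (pts S)"
  shows "scalar_germ k S \<pi> \<phi> x \<in> ring_hom k (stalk_ring S x)"
proof -
  interpret ringed_space S by fact
  have top: "openin (pts S) (topspace (pts S))" by simp
  note h = scalar_section_hom(1)[OF assms(1-3) top]
  show ?thesis unfolding scalar_germ_def
    by (rule ring_hom_memI)
      (simp_all add: Ogerm_closed[OF top x] Ogerm_ops(1,2)[OF top x] Ogerm_ops(3)[OF top x] ring_hom_closed[OF h]
        ring_hom_mult[OF h] ring_hom_add[OF h] ring_hom_one[OF h])
qed

section \<open>Extension of scalars\<close>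

lemma algebra_module_simps [simp]:
  "carrier (algebra_module \<iota> K) = carrier K"
  "\<zero>\<^bsub>algebra_module \<iota> K\<^esub> = \<zero>\<^bsub>K\<^esub>"
  "x \<oplus>\<^bsub>algebra_module \<iota> K\<^esub> y = x \<oplus>\<^bsub>K\<^esub> y"
  "c \<odot>\<^bsub>algebra_module \<iota> K\<^esub> x = \<iota> c \<otimes>\<^bsub>K\<^esub> x"
  by (simp_all add: algebra_module_def)

locale scalars = k: cring k + K: cring K for k :: "('k, 'm) ring_scheme" and K :: "('c, 'n) ring_scheme" +
  fixes \<iota> assumes hom: "\<iota> \<in> ring_hom k K"
begin

abbreviation "A \<equiv> algebra_module \<iota> K"
abbreviation "ext \<equiv> scalar_extension k K \<iota>"
abbreviation "ten M \<equiv> pure_tensor k M A"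
abbreviation "ext_map \<equiv> scalar_extension_map k K \<iota>"

lemmas \<iota>_closed [simp] = ring_hom_closed[OF hom]

lemma A_module: "module k A"
proof (rule module_criteria)
  show "\<forall>v\<in>carrier A. \<exists>w\<in>carrier A. v \<oplus>\<^bsub>A\<^esub> w = \<zero>\<^bsub>A\<^esub>"
    using K.r_neg K.a_inv_closed by auto
qed (auto simp: K.a_ac K.m_assoc K.l_distr K.r_distr ring_hom_mult[OF hom] ring_hom_add[OF hom]
     ring_hom_one[OF hom] intro: k.is_cring)

lemma tensor: "module k M \<Longrightarrow> tensor k M A"
  by (intro tensor.intro A_module)

lemma ext_simps [simp]:
  "carrier (ext M) = carrier (tensor_product k M A)"
  "\<zero>\<^bsub>ext M\<^esub> = \<zero>\<^bsub>tensor_product k M A\<^esub>"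
  "x \<oplus>\<^bsub>ext M\<^esub> y = x \<oplus>\<^bsub>tensor_product k M A\<^esub> y"
  by (simp_all add: scalar_extension_def Let_def)

lemma ext_smult: "b \<odot>\<^bsub>ext M\<^esub> x = tensor_map k M A M A (\<lambda>v. v) (\<lambda>a. b \<otimes>\<^bsub>K\<^esub> a) x"
  by (simp add: scalar_extension_def Let_def)

lemma mult_hom: "b \<in> carrier K \<Longrightarrow> (\<lambda>a. b \<otimes>\<^bsub>K\<^esub> a) \<in> module_hom k A A"
  by (rule module_homI) (auto simp: K.r_distr K.m_lcomm)

lemma smult_hom:
  assumes "module k M" "b \<in> carrier K"
  shows "(\<lambda>x. b \<odot>\<^bsub>ext M\<^esub> x) \<in> module_hom k (tensor_product k M A) (tensor_product k M A)"
  unfolding ext_smult by (rule tensor_map(1)[OF tensor tensor module_hom_ident mult_hom]) (rule assms)+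

lemma smult_ten:
  assumes "module k M" "b \<in> carrier K" "v \<in> carrier M" "c \<in> carrier K"
  shows "b \<odot>\<^bsub>ext M\<^esub> ten M v c = ten M v (b \<otimes>\<^bsub>K\<^esub> c)"
  unfolding ext_smult using assms by (subst tensor_map(2)[OF tensor tensor module_hom_ident mult_hom]) auto

text \<open>For fixed elements of \<open>K\<close> both sides of each axiom about scalars are
  \<open>k\<close>-linear in the vector. It is therefore enough to compare them on pure tensors,
  where they are identities in the second factor.\<close>

lemma ext_module:
  assumes M: "module k M"
  shows "module K (ext M)"
proof -
  interpret t: tensor k M A by (rule tensor[OF M])
  note sm = module_homD[OF smult_hom[OF M]]
  show ?thesis
  proof (rule module_criteria)
    show "\<forall>v\<in>carrier (ext M). \<exists>w\<in>carrier (ext M). v \<oplus>\<^bsub>ext M\<^esub> w = \<zero>\<^bsub>ext M\<^esub>"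
      using t.T.M.r_neg t.T.M.a_inv_closed by (metis ext_simps)
    show "\<forall>a b v. a \<in> carrier K \<and> b \<in> carrier K \<and> v \<in> carrier (ext M) \<longrightarrow>
       (a \<otimes>\<^bsub>K\<^esub> b) \<odot>\<^bsub>ext M\<^esub> v = a \<odot>\<^bsub>ext M\<^esub> (b \<odot>\<^bsub>ext M\<^esub> v)"
    proof (intro allI impI; elim conjE)
      fix a b v assume ab: "a \<in> carrier K" "b \<in> carrier K" and v: "v \<in> carrier (ext M)"
      show "(a \<otimes>\<^bsub>K\<^esub> b) \<odot>\<^bsub>ext M\<^esub> v = a \<odot>\<^bsub>ext M\<^esub> (b \<odot>\<^bsub>ext M\<^esub> v)"
        by (rule t.hom_eqI[OF t.T.module_axioms smult_hom[OF M] module_hom_comp[OF smult_hom[OF M] smult_hom[OF M]]])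
          (use ab v in \<open>auto simp: smult_ten[OF M] K.m_assoc\<close>)
    qed
    show "\<forall>v\<in>carrier (ext M). \<one>\<^bsub>K\<^esub> \<odot>\<^bsub>ext M\<^esub> v = v"
    proof
      fix v assume v: "v \<in> carrier (ext M)"
      show "\<one>\<^bsub>K\<^esub> \<odot>\<^bsub>ext M\<^esub> v = v"
        by (rule t.hom_eqI[OF t.T.module_axioms smult_hom[OF M] module_hom_ident])
          (use v in \<open>auto simp: smult_ten[OF M]\<close>)
    qed
    show "\<forall>a b v. a \<in> carrier K \<and> b \<in> carrier K \<and> v \<in> carrier (ext M) \<longrightarrow>
       (a \<oplus>\<^bsub>K\<^esub> b) \<odot>\<^bsub>ext M\<^esub> v = a \<odot>\<^bsub>ext M\<^esub> v \<oplus>\<^bsub>ext M\<^esub> b \<odot>\<^bsub>ext M\<^esub> v"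
    proof (intro allI impI; elim conjE)
      fix a b v assume ab: "a \<in> carrier K" "b \<in> carrier K" and v: "v \<in> carrier (ext M)"
      have h: "(\<lambda>v. a \<odot>\<^bsub>ext M\<^esub> v \<oplus>\<^bsub>t.T\<^esub> b \<odot>\<^bsub>ext M\<^esub> v) \<in> module_hom k t.T t.T"
        by (rule module_homI) (use ab in \<open>auto simp: sm t.T.M.a_ac t.T.smult_r_distr\<close>)
      show "(a \<oplus>\<^bsub>K\<^esub> b) \<odot>\<^bsub>ext M\<^esub> v = a \<odot>\<^bsub>ext M\<^esub> v \<oplus>\<^bsub>ext M\<^esub> b \<odot>\<^bsub>ext M\<^esub> v"
        unfolding ext_simps
        by (rule t.hom_eqI[OF t.T.module_axioms smult_hom[OF M] h])
          (use ab v in \<open>auto simp: smult_ten[OF M] K.l_distr t.ten_add_right[simplified]\<close>)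
    qed
  qed (auto simp: sm t.T.M.a_ac intro: K.is_cring)
qed

lemma ext_induct [consumes 2, case_names zero pure add]:
  assumes "module k M" "x \<in> carrier (ext M)"
    and "P \<zero>\<^bsub>ext M\<^esub>" "\<And>v c. v \<in> carrier M \<Longrightarrow> c \<in> carrier K \<Longrightarrow> P (ten M v c)"
    and "\<And>x y. x \<in> carrier (ext M) \<Longrightarrow> y \<in> carrier (ext M) \<Longrightarrow> P x \<Longrightarrow> P y \<Longrightarrow> P (x \<oplus>\<^bsub>ext M\<^esub> y)"
  shows "P x"
  using tensor.tensor_induct[OF tensor[OF assms(1)], of x P] assms(2-) by simp

lemma ten_closed: "module k M \<Longrightarrow> v \<in> carrier M \<Longrightarrow> c \<in> carrier K \<Longrightarrow> ten M v c \<in> carrier (ext M)"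
  using tensor.ten_closed[OF tensor] by simp

text \<open>The scalar moves to the second factor, where it multiplies through
  \<open>\<iota>\<close> and thus becomes a scalar of \<open>K\<close>.\<close>

lemma ten_smult:
  assumes "module k M" "v \<in> carrier M" "a \<in> carrier k" "c \<in> carrier K"
  shows "ten M (a \<odot>\<^bsub>M\<^esub> v) c = \<iota> a \<odot>\<^bsub>ext M\<^esub> ten M v c"
  using tensor.ten_smult_left[OF tensor, of M a v c] tensor.ten_smult_right[OF tensor, of M a v c] assms
  by (simp add: smult_ten)

lemma ext_map_ten:
  assumes "module k M" "module k M'" "f \<in> module_hom k M M'" "v \<in> carrier M" "c \<in> carrier K"
  shows "ext_map M M' f (ten M v c) = ten M' (f v) c"
  unfolding scalar_extension_map_def
  using tensor_map(2)[OF tensor tensor assms(3) module_hom_ident, of v c] assms by simp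

lemma ext_map_hom:
  assumes M: "module k M" "module k M'" and f: "f \<in> module_hom k M M'"
  shows "ext_map M M' f \<in> module_hom K (ext M) (ext M')"
proof -
  interpret t: tensor k M A by (rule tensor[OF M(1)])
  interpret t': tensor k M' A by (rule tensor[OF M(2)])
  have h: "ext_map M M' f \<in> module_hom k t.T t'.T"
    unfolding scalar_extension_map_def
    by (rule tensor_map(1)[OF t.tensor_axioms t'.tensor_axioms f module_hom_ident])
  show ?thesis
  proof (rule module_homI)
    fix b x assume b: "b \<in> carrier K" and x: "x \<in> carrier (ext M)"
    show "ext_map M M' f (b \<odot>\<^bsub>ext M\<^esub> x) = b \<odot>\<^bsub>ext M'\<^esub> ext_map M M' f x"
      by (rule t.hom_eqI[OF t'.T.module_axioms module_hom_comp[OF smult_hom[OF M(1) b] h]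
            module_hom_comp[OF h smult_hom[OF M(2) b]]])
        (use b x in \<open>simp_all add: smult_ten M ext_map_ten[OF M f] module_homD[OF f]\<close>)
  qed (simp_all add: module_homD[OF h])
qed

lemma ext_map_comp:
  assumes M: "module k M" "module k M'" "module k M''" and f: "f \<in> module_hom k M M'" and g: "g \<in> module_hom k M' M''"
    and x: "x \<in> carrier (ext M)"
  shows "ext_map M' M'' g (ext_map M M' f x) = ext_map M M'' (\<lambda>v. g (f v)) x"
  using M(1) x
proof (induct rule: ext_induct)
  case zero
  show ?case
    using module_hom_zero[OF ext_module ext_module ext_map_hom] M f g module_hom_comp[OF f g] by metis
next
  case (pure v c)
  then show ?case using M f g by (simp add: ext_map_ten module_homD[OF f] module_hom_comp[OF f g])
next
  case (add x y)
  then show ?case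
    by (simp only: module_homD[OF ext_map_hom[OF M(1,2) f]] module_homD[OF ext_map_hom[OF M(2,3) g]]
        module_homD[OF ext_map_hom[OF M(1,3) module_hom_comp[OF f g]]])
qed

lemma ext_map_ident:
  assumes M: "module k M" and f: "f \<in> module_hom k M M" "\<And>v. v \<in> carrier M \<Longrightarrow> f v = v" and x: "x \<in> carrier (ext M)"
  shows "ext_map M M f x = x"
  using M x
proof (induct rule: ext_induct)
  case zero
  show ?case using module_hom_zero[OF ext_module[OF M] ext_module[OF M] ext_map_hom[OF M M f(1)]] .
next
  case (add x y)
  then show ?case by (simp only: module_homD[OF ext_map_hom[OF M M f(1)]])
qed (simp add: ext_map_ten M f)

text \<open>The product of \<open>f v\<close> and \<open>c\<close> is bilinear over
  \<open>k\<close>, so it descends to the tensor product, and the result is linear over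
  \<open>K\<close>. Applied to coordinate functions of \<open>M\<close>, this supplies coordinates
  on the extension.\<close>

lemma ext_functional:
  assumes M: "module k M" and f: "f \<in> module_hom k M A"
  obtains h where "h \<in> carrier (ext M) \<rightarrow> carrier K"
    "\<And>x y. x \<in> carrier (ext M) \<Longrightarrow> y \<in> carrier (ext M) \<Longrightarrow> h (x \<oplus>\<^bsub>ext M\<^esub> y) = h x \<oplus>\<^bsub>K\<^esub> h y"
    "\<And>b x. b \<in> carrier K \<Longrightarrow> x \<in> carrier (ext M) \<Longrightarrow> h (b \<odot>\<^bsub>ext M\<^esub> x) = b \<otimes>\<^bsub>K\<^esub> h x"
    "\<And>v c. v \<in> carrier M \<Longrightarrow> c \<in> carrier K \<Longrightarrow> h (ten M v c) = f v \<otimes>\<^bsub>K\<^esub> c"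
proof -
  interpret t: tensor k M A by (rule tensor[OF M])
  note fD = module_homD[OF f, simplified]
  obtain h where h: "h \<in> module_hom k t.T A"
    and ht: "\<And>v c. v \<in> carrier M \<Longrightarrow> c \<in> carrier A \<Longrightarrow> h (ten M v c) = f v \<otimes>\<^bsub>K\<^esub> c"
    by (rule t.lift[OF A_module, of "\<lambda>v c. f v \<otimes>\<^bsub>K\<^esub> c"])
      (auto simp: fD K.l_distr K.r_distr K.m_ac)
  have "h (b \<odot>\<^bsub>ext M\<^esub> x) = b \<otimes>\<^bsub>K\<^esub> h x" if "b \<in> carrier K" "x \<in> carrier (ext M)" for b x
    by (rule t.hom_eqI[OF A_module module_hom_comp[OF smult_hom[OF M that(1)] h] module_hom_comp[OF h mult_hom[OF that(1)]]])
      (use that in \<open>simp_all add: smult_ten M ht fD K.m_lcomm\<close>)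
  then show ?thesis
    using that[of h] module_homD[OF h] ht by auto
qed

end

text \<open>A finite basis together with its coordinate functions;
  \<open>algebra_module (\<lambda>a. a) k\<close> is \<open>k\<close> as a module over itself. In
  this form a basis survives extension of scalars: vectors, functions and the expansion identity all
  extend, whereas linear independence alone gives nothing to extend.\<close>

definition dual_bases :: "('k, 'm) ring_scheme \<Rightarrow> ('k, 'v, 'l) module_scheme \<Rightarrow> 'i set \<Rightarrow> ('i \<Rightarrow> 'v) \<Rightarrow> ('i \<Rightarrow> 'v \<Rightarrow> 'k) \<Rightarrow> bool"
  where "dual_bases k M I v c \<longleftrightarrow> finite I \<and> v \<in> I \<rightarrow> carrier M \<and>
    (\<forall>i\<in>I. c i \<in> module_hom k M (algebra_module (\<lambda>a. a) k)) \<and>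
    (\<forall>i\<in>I. \<forall>j\<in>I. c i (v j) = (if i = j then \<one>\<^bsub>k\<^esub> else \<zero>\<^bsub>k\<^esub>)) \<and>
    (\<forall>m\<in>carrier M. m = (\<Oplus>\<^bsub>M\<^esub>i\<in>I. c i m \<odot>\<^bsub>M\<^esub> v i))"

text \<open>The \<open>i\<close>-th coordinate function, applied to a vanishing combination,
  isolates its \<open>i\<close>-th coefficient, which proves independence; the expansion identity
  gives spanning.\<close>

lemma (in vectorspace) dual_bases_dim:
  assumes "dual_bases K V I v c"
  shows "fin_dim" "dim = card I"
proof -
  have I: "finite I" and v: "v \<in> I \<rightarrow> carrier V"
    and c: "\<And>i. i \<in> I \<Longrightarrow> c i \<in> module_hom K V (algebra_module (\<lambda>a. a) K)"
    and cv: "\<And>i j. i \<in> I \<Longrightarrow> j \<in> I \<Longrightarrow> c i (v j) = (if i = j then \<one>\<^bsub>K\<^esub> else \<zero>\<^bsub>K\<^esub>)"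
    and span: "\<And>m. m \<in> carrier V \<Longrightarrow> m = (\<Oplus>\<^bsub>V\<^esub>i\<in>I. c i m \<odot>\<^bsub>V\<^esub> v i)"
    using assms unfolding dual_bases_def by auto
  have Amod: "module K (algebra_module (\<lambda>a. a) K)"
    by (rule scalars.A_module)
      (simp add: scalars_def scalars_axioms_def R.is_cring ring_hom_def)
  note cD = module_homD[OF c, simplified]
  \<comment> \<open>A vector repeated at two indices would have a coordinate equal to both one and
    zero. Injectivity is what lets \<open>card I\<close> count the basis.\<close>
  have inj: "inj_on v I"
    using cv zero_not_one by (intro inj_onI) (metis one_not_zero)
  let ?B = "v ` I"
  have B: "finite ?B" "?B \<subseteq> carrier V" using I v by auto
  have "lin_indpt ?B"
  proof (rule finite_lin_indpt2[OF B])
    fix a assume a: "a \<in> ?B \<rightarrow> carrier K" and 0: "lincomb a ?B = \<zero>\<^bsub>V\<^esub>"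
    have sum: "lincomb a ?B = (\<Oplus>\<^bsub>V\<^esub>j\<in>I. a (v j) \<odot>\<^bsub>V\<^esub> v j)"
      unfolding lincomb_def using a v inj by (subst M.finsum_reindex) auto
    show "\<forall>w\<in>?B. a w = \<zero>\<^bsub>K\<^esub>"
    proof
      fix w assume "w \<in> ?B"
      then obtain i where i: "i \<in> I" "w = v i" by auto
      have "\<zero>\<^bsub>K\<^esub> = c i (\<Oplus>\<^bsub>V\<^esub>j\<in>I. a (v j) \<odot>\<^bsub>V\<^esub> v j)"
        using module_hom_zero[OF module_axioms Amod c[OF i(1)]] 0 sum by simp
      also have "\<dots> = (\<Oplus>\<^bsub>algebra_module (\<lambda>a. a) K\<^esub>j\<in>I. c i (a (v j) \<odot>\<^bsub>V\<^esub> v j))"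
        using a v by (intro module_hom_finsum[OF module_axioms Amod c[OF i(1)]]) auto
      also have "\<dots> = (\<Oplus>\<^bsub>algebra_module (\<lambda>a. a) K\<^esub>j\<in>{i}. c i (a (v j) \<odot>\<^bsub>V\<^esub> v j))"
        using a v i I cv cD
        by (intro abelian_monoid.finsum_mono_neutral[OF abelian_group.axioms(1)[OF module.axioms(2)[OF Amod]]])
          (auto simp: Pi_iff)
      also have "\<dots> = a (v i)"
        using a v i cv cD
        by (subst abelian_monoid.finsum_insert[OF abelian_group.axioms(1)[OF module.axioms(2)[OF Amod]]])
          (auto simp: Pi_iff abelian_monoid.finsum_empty[OF abelian_group.axioms(1)[OF module.axioms(2)[OF Amod]]])
      finally show "a w = \<zero>\<^bsub>K\<^esub>" using i by simp
    qed
  qed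
  moreover have "gen_set ?B"
  proof
    show "span ?B \<subseteq> carrier V" using B by (simp add: span_is_subset2)
    show "carrier V \<subseteq> span ?B"
    proof
      fix m assume m: "m \<in> carrier V"
      have "m = (\<Oplus>\<^bsub>V\<^esub>i\<in>I. c i m \<odot>\<^bsub>V\<^esub> v i)" by (rule span[OF m])
      also have "\<dots> = lincomb (\<lambda>w. c (the_inv_into I v w) m) ?B"
        unfolding lincomb_def using v inj m cD
        by (subst M.finsum_reindex) (auto simp: the_inv_into_f_f intro!: M.finsum_cong')
      also have "\<dots> \<in> span ?B"
        using B inj m cD by (auto simp: finite_span the_inv_into_f_f)
      finally show "m \<in> span ?B" .
    qed
  qed
  ultimately show "fin_dim" "dim = card I"
    using B dim_basis[OF B(1)] card_image[OF inj] by (auto simp: fin_dim_def basis_def)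
qed

text \<open>Coefficients with respect to a basis are unique. This makes them linear in the vector
  and identifies those of a basis vector.\<close>

lemma (in vectorspace) dual_bases_exist:
  assumes "fin_dim"
  obtains B c where "dual_bases K V B (\<lambda>b. b) c"
proof -
  obtain B where B: "finite B" "basis B" using finite_basis_exists[OF assms] by blast
  have BV: "B \<subseteq> carrier V" using B by (simp add: basis_def)
  \<comment> \<open>Coefficient families are taken extensional, so that uniqueness is equality of
    functions; \<open>uniq\<close> then reads coefficients off arbitrary families.\<close>
  have ex: "\<exists>!a. a \<in> B \<rightarrow>\<^sub>E carrier K \<and> lincomb a B = m" if "m \<in> carrier V" for m
    using basis_criterion[OF B(1) BV] B(2) that by auto
  define a where "a m = (THE a. a \<in> B \<rightarrow>\<^sub>E carrier K \<and> lincomb a B = m)" for m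
  have a: "a m \<in> B \<rightarrow>\<^sub>E carrier K \<and> lincomb (a m) B = m" if "m \<in> carrier V" for m
    unfolding a_def by (rule theI'[OF ex[OF that]])
  have uniq: "x b = a m b" if "x \<in> B \<rightarrow> carrier K" "lincomb x B = m" "b \<in> B" for x m b
  proof -
    have m: "m \<in> carrier V" using that BV by auto
    have "lincomb (restrict x B) B = m"
      using that BV lincomb_cong[OF refl BV, of "restrict x B" x] by auto
    then have "restrict x B = a m" using ex[OF m] a[OF m] that(1) by auto
    then show ?thesis using that by (metis restrict_apply')
  qed
  have "dual_bases K V B (\<lambda>b. b) (\<lambda>b m. a m b)"
    unfolding dual_bases_def
  proof (intro conjI ballI)
    fix b assume b: "b \<in> B"
    show "(\<lambda>m. a m b) \<in> module_hom K V (algebra_module (\<lambda>a. a) K)"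
    proof (rule module_homI)
      fix v w assume vw: "v \<in> carrier V" "w \<in> carrier V"
      have "lincomb (\<lambda>b. a v b \<oplus>\<^bsub>K\<^esub> a w b) B = v \<oplus>\<^bsub>V\<^esub> w"
        using lincomb_sum[OF B(1) BV, of "a v" "a w"] a vw by (auto simp: PiE_def)
      then show "a (v \<oplus>\<^bsub>V\<^esub> w) b = a v b \<oplus>\<^bsub>algebra_module (\<lambda>a. a) K\<^esub> a w b"
        using a vw b by (subst uniq[symmetric]) (auto simp: PiE_def Pi_iff)
    next
      fix c v assume cv: "c \<in> carrier K" "v \<in> carrier V"
      have "lincomb (\<lambda>b. c \<otimes>\<^bsub>K\<^esub> a v b) B = c \<odot>\<^bsub>V\<^esub> v"
        using lincomb_smult[OF BV, of "a v" c] a cv by (auto simp: PiE_def)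
      then show "a (c \<odot>\<^bsub>V\<^esub> v) b = c \<odot>\<^bsub>algebra_module (\<lambda>a. a) K\<^esub> a v b"
        using a cv b by (subst uniq[symmetric]) (auto simp: PiE_def Pi_iff)
    qed (use a b in \<open>auto simp: PiE_def Pi_iff\<close>)
  next
    fix b c assume bc: "b \<in> B" "c \<in> B"
    have "lincomb (\<lambda>b. if b = c then \<one>\<^bsub>K\<^esub> else \<zero>\<^bsub>K\<^esub>) B = (\<Oplus>\<^bsub>V\<^esub>b\<in>{c}. (if b = c then \<one>\<^bsub>K\<^esub> else \<zero>\<^bsub>K\<^esub>) \<odot>\<^bsub>V\<^esub> b)"
      unfolding lincomb_def using bc BV B(1) by (intro M.finsum_mono_neutral) auto
    also have "\<dots> = c" using bc BV by auto
    finally show "a c b = (if b = c then \<one>\<^bsub>K\<^esub> else \<zero>\<^bsub>K\<^esub>)"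
      using bc by (subst uniq[symmetric, of "\<lambda>b. if b = c then \<one>\<^bsub>K\<^esub> else \<zero>\<^bsub>K\<^esub>"]) auto
  next
    fix m assume "m \<in> carrier V"
    then show "m = (\<Oplus>\<^bsub>V\<^esub>i\<in>B. a m i \<odot>\<^bsub>V\<^esub> i)" using a[of m] by (simp add: lincomb_def)
  qed (use B BV in auto)
  then show ?thesis using that by blast
qed

text \<open>The new coordinates are the old ones extended by \<open>ext_functional\<close>. The
  expansion identity is checked on pure tensors: expand the first factor in \<open>M\<close>, then
  let the coefficients cross to the second factor.\<close>

lemma (in scalars) ext_dual_bases:
  assumes M: "module k M" and d: "dual_bases k M I v c"
  obtains c' where "dual_bases K (ext M) I (\<lambda>i. ten M (v i) \<one>\<^bsub>K\<^esub>) c'"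
proof -
  have I: "finite I" and v: "\<And>i. i \<in> I \<Longrightarrow> v i \<in> carrier M"
    and c: "\<And>i. i \<in> I \<Longrightarrow> c i \<in> module_hom k M (algebra_module (\<lambda>a. a) k)"
    and cv: "\<And>i j. i \<in> I \<Longrightarrow> j \<in> I \<Longrightarrow> c i (v j) = (if i = j then \<one>\<^bsub>k\<^esub> else \<zero>\<^bsub>k\<^esub>)"
    and span: "\<And>m. m \<in> carrier M \<Longrightarrow> m = (\<Oplus>\<^bsub>M\<^esub>i\<in>I. c i m \<odot>\<^bsub>M\<^esub> v i)"
    using d unfolding dual_bases_def by auto
  interpret M: module k M by (rule M)
  interpret t: tensor k M A by (rule tensor[OF M])
  interpret X: module K "ext M" by (rule ext_module[OF M])
  have \<iota>c: "(\<lambda>m. \<iota> (c i m)) \<in> module_hom k M A" if "i \<in> I" for i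
    by (rule module_homI)
      (use module_homD[OF c[OF that], simplified] in \<open>auto simp: ring_hom_add[OF hom] ring_hom_mult[OF hom]\<close>)
  \<comment> \<open>Packs the conclusions of \<open>ext_functional\<close> into one predicate, so
    that a function can be chosen for all indices at once.\<close>
  define good where "good i h \<longleftrightarrow> h \<in> carrier (ext M) \<rightarrow> carrier K \<and>
      (\<forall>x y. x \<in> carrier (ext M) \<longrightarrow> y \<in> carrier (ext M) \<longrightarrow> h (x \<oplus>\<^bsub>ext M\<^esub> y) = h x \<oplus>\<^bsub>K\<^esub> h y) \<and>
      (\<forall>b x. b \<in> carrier K \<longrightarrow> x \<in> carrier (ext M) \<longrightarrow> h (b \<odot>\<^bsub>ext M\<^esub> x) = b \<otimes>\<^bsub>K\<^esub> h x) \<and>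
      (\<forall>m a. m \<in> carrier M \<longrightarrow> a \<in> carrier K \<longrightarrow> h (ten M m a) = \<iota> (c i m) \<otimes>\<^bsub>K\<^esub> a)" for i h
  have "\<exists>h. good i h" if "i \<in> I" for i
    by (rule ext_functional[OF M \<iota>c[OF that]]) (auto simp: good_def)
  then obtain c' where "\<And>i. i \<in> I \<Longrightarrow> good i (c' i)" by metis
  then have c'1: "\<And>i x. i \<in> I \<Longrightarrow> x \<in> carrier (ext M) \<Longrightarrow> c' i x \<in> carrier K"
    and c'2: "\<And>i x y. i \<in> I \<Longrightarrow> x \<in> carrier (ext M) \<Longrightarrow> y \<in> carrier (ext M) \<Longrightarrow> c' i (x \<oplus>\<^bsub>ext M\<^esub> y) = c' i x \<oplus>\<^bsub>K\<^esub> c' i y"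
    and c'3: "\<And>i b x. i \<in> I \<Longrightarrow> b \<in> carrier K \<Longrightarrow> x \<in> carrier (ext M) \<Longrightarrow> c' i (b \<odot>\<^bsub>ext M\<^esub> x) = b \<otimes>\<^bsub>K\<^esub> c' i x"
    and c'4: "\<And>i m a. i \<in> I \<Longrightarrow> m \<in> carrier M \<Longrightarrow> a \<in> carrier K \<Longrightarrow> c' i (ten M m a) = \<iota> (c i m) \<otimes>\<^bsub>K\<^esub> a"
    by (auto simp: good_def Pi_iff)
  let ?t = "\<lambda>i. ten M (v i) \<one>\<^bsub>K\<^esub>"
  have t: "\<And>i. i \<in> I \<Longrightarrow> ?t i \<in> carrier (ext M)" using v ten_closed[OF M] by simp
  have cK: "\<And>i m. i \<in> I \<Longrightarrow> m \<in> carrier M \<Longrightarrow> c i m \<in> carrier k"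
    using module_homD(1)[OF c] by simp
  have "x = (\<Oplus>\<^bsub>ext M\<^esub>i\<in>I. c' i x \<odot>\<^bsub>ext M\<^esub> ?t i)" if "x \<in> carrier (ext M)" for x
    using M that
  proof (induct rule: ext_induct)
    case zero
    have "c' i \<zero>\<^bsub>ext M\<^esub> = \<zero>\<^bsub>K\<^esub>" if "i \<in> I" for i
      using c'3[OF that K.zero_closed X.zero_closed] c'1[OF that X.zero_closed] X.lmult_0[OF X.zero_closed] by simp
    then have "(\<Oplus>\<^bsub>ext M\<^esub>i\<in>I. c' i \<zero>\<^bsub>ext M\<^esub> \<odot>\<^bsub>ext M\<^esub> ?t i) = (\<Oplus>\<^bsub>ext M\<^esub>i\<in>I. \<zero>\<^bsub>ext M\<^esub>)"
      using t X.lmult_0 by (intro X.finsum_cong') (auto simp del: ext_simps)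
    then show ?case using X.finsum_zero by simp
  next
    case (pure m a)
    have "ten M m a = ten M (\<Oplus>\<^bsub>M\<^esub>i\<in>I. c i m \<odot>\<^bsub>M\<^esub> v i) a" using span[OF pure(1)] by simp
    also have "\<dots> = (\<Oplus>\<^bsub>ext M\<^esub>i\<in>I. ten M (c i m \<odot>\<^bsub>M\<^esub> v i) a)"
    proof -
      have "(\<lambda>m. ten M m a) \<in> module_hom k M (tensor_product k M A)"
        using tensor.ten_add_left[OF tensor[OF M]] tensor.ten_smult_left[OF tensor[OF M]] tensor.ten_closed[OF tensor[OF M]] pure
        by (intro module_homI) auto
      then have "ten M (\<Oplus>\<^bsub>M\<^esub>i\<in>I. c i m \<odot>\<^bsub>M\<^esub> v i) a = (\<Oplus>\<^bsub>tensor_product k M A\<^esub>i\<in>I. ten M (c i m \<odot>\<^bsub>M\<^esub> v i) a)"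
        using v cK pure by (intro module_hom_finsum[OF M t.T.module_axioms]) (auto simp: Pi_iff)
      \<comment> \<open>A finite sum depends only on the additive structure, which
        \<open>ext M\<close> shares with the tensor product, although the one is a module over
        \<open>K\<close> and the other over \<open>k\<close>.\<close>
      moreover have "add (ext M) = add t.T" by (simp add: scalar_extension_def Let_def)
      ultimately show ?thesis by (simp add: finsum_def finprod_def)
    qed
    also have "\<dots> = (\<Oplus>\<^bsub>ext M\<^esub>i\<in>I. c' i (ten M m a) \<odot>\<^bsub>ext M\<^esub> ?t i)"
      using v cK pure M ten_closed[OF M] c'1
      by (intro X.finsum_cong') (auto simp: c'4 ten_smult smult_ten K.m_comm simp del: ext_simps)
    finally show ?case .
  next
    case (add x y)
    have "x \<oplus>\<^bsub>ext M\<^esub> y = (\<Oplus>\<^bsub>ext M\<^esub>i\<in>I. c' i x \<odot>\<^bsub>ext M\<^esub> ?t i \<oplus>\<^bsub>ext M\<^esub> c' i y \<odot>\<^bsub>ext M\<^esub> ?t i)"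
      using add t c'1 by (subst X.finsum_addf) (auto simp del: ext_simps)
    also have "\<dots> = (\<Oplus>\<^bsub>ext M\<^esub>i\<in>I. c' i (x \<oplus>\<^bsub>ext M\<^esub> y) \<odot>\<^bsub>ext M\<^esub> ?t i)"
      using add t c'1 by (intro X.finsum_cong') (auto simp: c'2 X.smult_l_distr simp del: ext_simps)
    finally show ?case .
  qed
  then have "dual_bases K (ext M) I ?t c'"
    unfolding dual_bases_def using I t cv v c'1 c'2 c'3
    by (auto simp: c'4 ring_hom_one[OF hom] ring_hom_zero[OF hom k.ring_axioms K.ring_axioms] simp del: ext_simps intro!: module_homI)
  then show ?thesis using that by blast
qed

section \<open>Finite direct sums of modules\<close>

lemma sum_module_simps [simp]:
  "carrier (sum_module I M) = (\<Pi>\<^sub>E i\<in>I. carrier (M i))"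
  "\<zero>\<^bsub>sum_module I M\<^esub> = (\<lambda>i\<in>I. \<zero>\<^bsub>M i\<^esub>)"
  "v \<oplus>\<^bsub>sum_module I M\<^esub> w = (\<lambda>i\<in>I. v i \<oplus>\<^bsub>M i\<^esub> w i)"
  "c \<odot>\<^bsub>sum_module I M\<^esub> v = (\<lambda>i\<in>I. c \<odot>\<^bsub>M i\<^esub> v i)"
  by (simp_all add: sum_module_def)

lemma sum_module_is_module:
  assumes "cring R" and M: "\<And>i. i \<in> I \<Longrightarrow> module R (M i)"
  shows "module R (sum_module I M)"
proof -
  note ag = abelian_group.axioms(1)[OF module.axioms(2)[OF M]]
  show ?thesis
  proof (rule module_criteria)
    show "\<forall>v\<in>carrier (sum_module I M). \<exists>w\<in>carrier (sum_module I M). v \<oplus>\<^bsub>sum_module I M\<^esub> w = \<zero>\<^bsub>sum_module I M\<^esub>"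
    proof
      fix v assume v: "v \<in> carrier (sum_module I M)"
      have "\<exists>w\<in>carrier (M i). v i \<oplus>\<^bsub>M i\<^esub> w = \<zero>\<^bsub>M i\<^esub>" if "i \<in> I" for i
      proof -
        have vi: "v i \<in> carrier (M i)" using v that by auto
        show ?thesis
          using abelian_group.r_neg[OF module.axioms(2)[OF M[OF that]] vi]
            abelian_group.a_inv_closed[OF module.axioms(2)[OF M[OF that]] vi] by blast
      qed
      then obtain w where "\<And>i. i \<in> I \<Longrightarrow> w i \<in> carrier (M i) \<and> v i \<oplus>\<^bsub>M i\<^esub> w i = \<zero>\<^bsub>M i\<^esub>" by metis
      then show "\<exists>w\<in>carrier (sum_module I M). v \<oplus>\<^bsub>sum_module I M\<^esub> w = \<zero>\<^bsub>sum_module I M\<^esub>"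
        by (intro bexI[of _ "restrict w I"]) (auto intro!: restrict_ext)
    qed
  qed (auto simp: assms(1) abelian_monoid.zero_closed[OF ag] abelian_monoid.a_closed[OF ag] module.smult_closed[OF M]
        module.smult_assoc1[OF M] module.smult_l_distr[OF M] module.smult_r_distr[OF M]
        abelian_monoid.a_assoc[OF ag] module.smult_one[OF M] abelian_monoid.r_zero[OF ag]
        PiE_mem restrict_def PiE_iff extensional_def fun_eq_iff
      intro: abelian_monoid.a_comm[OF ag])
qed

lemma sum_incl_hom:
  assumes M: "\<And>i. i \<in> I \<Longrightarrow> module R (M i)" and i: "i \<in> I"
  shows "sum_incl I M i \<in> module_hom R (M i) (sum_module I M)"
proof -
  note ag = abelian_group.axioms(1)[OF module.axioms(2)[OF M]]
  show ?thesis
    by (rule module_homI)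
      (use i in \<open>auto simp: sum_incl_def abelian_monoid.zero_closed[OF ag] abelian_monoid.l_zero[OF ag]
        module.rmult_0[OF M] fun_eq_iff\<close>)
qed

lemma sum_proj_hom:
  assumes "i \<in> I"
  shows "(\<lambda>v. v i) \<in> module_hom R (sum_module I M) (M i)"
  using assms by (intro module_homI) auto

lemma sum_module_finsum_apply:
  assumes "cring R" and M: "\<And>i. i \<in> I \<Longrightarrow> module R (M i)" and "i \<in> I" "g \<in> A \<rightarrow> carrier (sum_module I M)"
  shows "(\<Oplus>\<^bsub>sum_module I M\<^esub>a\<in>A. g a) i = (\<Oplus>\<^bsub>M i\<^esub>a\<in>A. g a i)"
  using module_hom_finsum[OF sum_module_is_module[OF assms(1,2)] M[OF assms(3)] sum_proj_hom[OF assms(3)] assms(4)]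
  by simp

text \<open>Indices are pairs of a summand and a basis element, so that counting them yields the
  factor \<open>n\<close> in the dimension.\<close>

lemma power_dual_bases:
  assumes V: "module k V" and d: "dual_bases k V B v c"
  shows "dual_bases k (power_module V n) ({..<n} \<times> B) (\<lambda>(j, b). sum_incl {..<n} (\<lambda>_. V) j (v b)) (\<lambda>(j, b) w. c b (w j))"
proof -
  interpret V: module k V by (rule V)
  have P: "module k (power_module V n)"
    by (rule sum_module_is_module) (auto intro: V V.R.is_cring)
  interpret P: module k "power_module V n" by (rule P)
  let ?A = "algebra_module (\<lambda>a. a) k"
  have A: "module k ?A"
    by (rule scalars.A_module) (simp add: scalars_def scalars_axioms_def V.R.is_cring ring_hom_def)
  have B: "finite B" and v: "\<And>b. b \<in> B \<Longrightarrow> v b \<in> carrier V"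
    and c: "\<And>b. b \<in> B \<Longrightarrow> c b \<in> module_hom k V ?A"
    and cv: "\<And>b b'. b \<in> B \<Longrightarrow> b' \<in> B \<Longrightarrow> c b (v b') = (if b = b' then \<one>\<^bsub>k\<^esub> else \<zero>\<^bsub>k\<^esub>)"
    and span: "\<And>m. m \<in> carrier V \<Longrightarrow> m = (\<Oplus>\<^bsub>V\<^esub>b\<in>B. c b m \<odot>\<^bsub>V\<^esub> v b)"
    using d unfolding dual_bases_def by auto
  have c0: "c b \<zero>\<^bsub>V\<^esub> = \<zero>\<^bsub>k\<^esub>" if "b \<in> B" for b using module_hom_zero[OF V A c[OF that]] by simp
  have cK: "\<And>b w. b \<in> B \<Longrightarrow> w \<in> carrier V \<Longrightarrow> c b w \<in> carrier k" using module_homD(1)[OF c] by simp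
  have incl: "\<And>j w. j < n \<Longrightarrow> w \<in> carrier V \<Longrightarrow> sum_incl {..<n} (\<lambda>_. V) j w \<in> carrier (power_module V n)"
    by (auto simp: sum_incl_def)
  show ?thesis
    unfolding dual_bases_def
  proof (intro conjI ballI)
    show "finite ({..<n} \<times> B)" using B by simp
    show "(\<lambda>(j, b). sum_incl {..<n} (\<lambda>_. V) j (v b)) \<in> {..<n} \<times> B \<rightarrow> carrier (power_module V n)"
      using incl v by (auto simp del: sum_module_simps)
  next
    fix p assume "p \<in> {..<n} \<times> B"
    then obtain j b where p: "p = (j, b)" "j \<in> {..<n}" "b \<in> B" by auto
    show "(case p of (j, b) \<Rightarrow> \<lambda>w. c b (w j)) \<in> module_hom k (power_module V n) ?A"
      using module_hom_comp[OF sum_proj_hom[OF p(2)] c[OF p(3)]] p(1) by simp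
  next
    fix p q assume "p \<in> {..<n} \<times> B" "q \<in> {..<n} \<times> B"
    then obtain j b j' b' where "p = (j, b)" "q = (j', b')" "j < n" "j' < n" "b \<in> B" "b' \<in> B" by auto
    then show "(case p of (j, b) \<Rightarrow> \<lambda>w. c b (w j)) (case q of (j, b) \<Rightarrow> sum_incl {..<n} (\<lambda>_. V) j (v b)) =
        (if p = q then \<one>\<^bsub>k\<^esub> else \<zero>\<^bsub>k\<^esub>)"
      by (cases "j = j'") (simp_all add: sum_incl_def cv c0)
  next
    fix w assume w: "w \<in> carrier (power_module V n)"
    let ?g = "\<lambda>(j, b). c b (w j) \<odot>\<^bsub>power_module V n\<^esub> sum_incl {..<n} (\<lambda>_. V) j (v b)"
    have wj: "\<And>j. j < n \<Longrightarrow> w j \<in> carrier V" using w by auto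
    have g: "?g \<in> {..<n} \<times> B \<rightarrow> carrier (power_module V n)"
      using incl v wj cK P.smult_closed by (auto simp del: sum_module_simps)
    have sum: "(\<Oplus>\<^bsub>power_module V n\<^esub>p\<in>{..<n} \<times> B. ?g p) i = w i" if i: "i \<in> {..<n}" for i
    proof -
      have "(\<Oplus>\<^bsub>power_module V n\<^esub>p\<in>{..<n} \<times> B. ?g p) i = (\<Oplus>\<^bsub>V\<^esub>p\<in>{..<n} \<times> B. ?g p i)"
        by (rule sum_module_finsum_apply[OF V.R.is_cring V i g])
      \<comment> \<open>In component \<open>i\<close> only the pairs whose first entry is
        \<open>i\<close> contribute.\<close>
      also have "\<dots> = (\<Oplus>\<^bsub>V\<^esub>p\<in>{i} \<times> B. ?g p i)"
        using i B v wj cK by (intro V.M.finsum_mono_neutral) (auto simp: sum_incl_def split: if_split_asm)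
      also have "\<dots> = (\<Oplus>\<^bsub>V\<^esub>b\<in>B. ?g (i, b) i)"
      proof -
        have "{i} \<times> B = (\<lambda>b. (i, b)) ` B" by auto
        then show ?thesis
          using i v wj cK by (simp only:) (subst V.M.finsum_reindex, auto simp: inj_on_def sum_incl_def)
      qed
      also have "\<dots> = (\<Oplus>\<^bsub>V\<^esub>b\<in>B. c b (w i) \<odot>\<^bsub>V\<^esub> v b)"
        using i v wj cK by (intro V.M.finsum_cong') (auto simp: sum_incl_def)
      finally show ?thesis using span[OF wj] i by simp
    qed
    have "(\<Oplus>\<^bsub>power_module V n\<^esub>p\<in>{..<n} \<times> B. ?g p) \<in> carrier (power_module V n)"
      using P.finsum_closed[OF g] .
    then have "w = (\<Oplus>\<^bsub>power_module V n\<^esub>p\<in>{..<n} \<times> B. ?g p)"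
      using w sum by (intro PiE_ext[of w "{..<n}" "\<lambda>_. carrier V"]) (simp_all del: sum_module_simps(2-))
    then show "w = (\<Oplus>\<^bsub>power_module V n\<^esub>p\<in>{..<n} \<times> B.
        (case p of (j, b) \<Rightarrow> \<lambda>w. c b (w j)) w \<odot>\<^bsub>power_module V n\<^esub> (case p of (j, b) \<Rightarrow> sum_incl {..<n} (\<lambda>_. V) j (v b)))"
      by (simp add: case_prod_unfold del: sum_module_simps)
  qed
qed

lemma (in scalars) power_ext_dim:
  assumes k: "field k" and K: "field K" and V: "vectorspace k V" and fin: "vectorspace.fin_dim k V"
  shows "vectorspace K (ext (power_module V n))" "vectorspace.fin_dim K (ext (power_module V n))"
    "vectorspace.dim K (ext (power_module V n)) = n * vectorspace.dim k V"
proof -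
  interpret V: vectorspace k V by (rule V)
  have P: "module k (power_module V n)"
    by (rule sum_module_is_module) (auto intro: V.module_axioms k.is_cring)
  show vs: "vectorspace K (ext (power_module V n))"
    using ext_module[OF P] K by (simp add: vectorspace_def)
  obtain B c where B: "dual_bases k V B (\<lambda>b. b) c" by (rule V.dual_bases_exist[OF fin])
  obtain c' where "dual_bases K (ext (power_module V n)) ({..<n} \<times> B)
      (\<lambda>i. ten (power_module V n) (case i of (j, b) \<Rightarrow> sum_incl {..<n} (\<lambda>_. V) j b) \<one>\<^bsub>K\<^esub>) c'"
    by (rule ext_dual_bases[OF P power_dual_bases[OF V.module_axioms B]])
  from vectorspace.dual_bases_dim[OF vs this] V.dual_bases_dim[OF B]
  show "vectorspace.fin_dim K (ext (power_module V n))"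
    "vectorspace.dim K (ext (power_module V n)) = n * vectorspace.dim k V"
    by (simp_all add: card_cartesian_product)
qed

section \<open>Representations\<close>

lemma group_algebra_simps [simp]:
  "carrier (group_algebra k G) = carrier G \<rightarrow>\<^sub>E carrier k"
  "\<zero>\<^bsub>group_algebra k G\<^esub> = (\<lambda>g\<in>carrier G. \<zero>\<^bsub>k\<^esub>)"
  "\<one>\<^bsub>group_algebra k G\<^esub> = (\<lambda>g\<in>carrier G. if g = \<one>\<^bsub>G\<^esub> then \<one>\<^bsub>k\<^esub> else \<zero>\<^bsub>k\<^esub>)"
  "a \<oplus>\<^bsub>group_algebra k G\<^esub> b = (\<lambda>g\<in>carrier G. a g \<oplus>\<^bsub>k\<^esub> b g)"
  "a \<otimes>\<^bsub>group_algebra k G\<^esub> b = (\<lambda>g\<in>carrier G. \<Oplus>\<^bsub>k\<^esub> h\<in>carrier G. a h \<otimes>\<^bsub>k\<^esub> b (inv\<^bsub>G\<^esub> h \<otimes>\<^bsub>G\<^esub> g))"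
  by (simp_all add: group_algebra_def)

lemma group_algebra_abelian_group:
  assumes "cring k"
  shows "abelian_group (group_algebra k G)"
proof -
  interpret cring k by fact
  show ?thesis
  proof (rule abelian_groupI)
    fix a assume a: "a \<in> carrier (group_algebra k G)"
    have "\<And>g. g \<in> carrier G \<Longrightarrow> a g \<in> carrier k" using a by auto
    then show "\<exists>b\<in>carrier (group_algebra k G). b \<oplus>\<^bsub>group_algebra k G\<^esub> a = \<zero>\<^bsub>group_algebra k G\<^esub>"
      by (intro bexI[of _ "\<lambda>g\<in>carrier G. \<ominus>\<^bsub>k\<^esub> a g"]) (auto simp: l_neg intro!: restrict_ext)
    show "\<zero>\<^bsub>group_algebra k G\<^esub> \<oplus>\<^bsub>group_algebra k G\<^esub> a = a"
      using a by (auto simp: PiE_mem PiE_iff extensional_def fun_eq_iff)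
  qed (auto simp: PiE_iff a_ac intro!: restrict_ext)
qed

section \<open>The action of the group algebra on a representation\<close>

lemma representationD:
  assumes "representation G R M \<sigma>" "g \<in> carrier G"
  shows "v \<in> carrier M \<Longrightarrow> \<sigma> g v \<in> carrier M"
    and "v \<in> carrier M \<Longrightarrow> w \<in> carrier M \<Longrightarrow> \<sigma> g (v \<oplus>\<^bsub>M\<^esub> w) = \<sigma> g v \<oplus>\<^bsub>M\<^esub> \<sigma> g w"
    and "c \<in> carrier R \<Longrightarrow> v \<in> carrier M \<Longrightarrow> \<sigma> g (c \<odot>\<^bsub>M\<^esub> v) = c \<odot>\<^bsub>M\<^esub> \<sigma> g v"
  using module_homD[OF representation.linear[OF assms]] by auto

lemma representation_module: "representation G R M \<sigma> \<Longrightarrow> module R M"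
  by (simp add: representation_def)

lemma algebra_action_hom:
  assumes rep: "representation G R M \<sigma>" and a: "\<And>g. g \<in> carrier G \<Longrightarrow> a g \<in> carrier R"
  shows "algebra_action G M \<sigma> a \<in> module_hom R M M"
proof -
  interpret module R M by (rule representation_module[OF rep])
  note D = representationD[OF rep]
  show ?thesis
  proof (rule module_homI)
    fix v assume "v \<in> carrier M"
    then show "algebra_action G M \<sigma> a v \<in> carrier M"
      unfolding algebra_action_def using a D by (intro finsum_closed) auto
  next
    fix v w assume vw: "v \<in> carrier M" "w \<in> carrier M"
    have "algebra_action G M \<sigma> a (v \<oplus>\<^bsub>M\<^esub> w) = (\<Oplus>\<^bsub>M\<^esub>g\<in>carrier G. a g \<odot>\<^bsub>M\<^esub> \<sigma> g v \<oplus>\<^bsub>M\<^esub> a g \<odot>\<^bsub>M\<^esub> \<sigma> g w)"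
      unfolding algebra_action_def using a D vw by (intro finsum_cong') (auto simp: smult_r_distr)
    then show "algebra_action G M \<sigma> a (v \<oplus>\<^bsub>M\<^esub> w) = algebra_action G M \<sigma> a v \<oplus>\<^bsub>M\<^esub> algebra_action G M \<sigma> a w"
      unfolding algebra_action_def using a D vw by (simp add: finsum_addf Pi_iff)
  next
    fix c v assume cv: "c \<in> carrier R" "v \<in> carrier M"
    have "algebra_action G M \<sigma> a (c \<odot>\<^bsub>M\<^esub> v) = (\<Oplus>\<^bsub>M\<^esub>g\<in>carrier G. c \<odot>\<^bsub>M\<^esub> (a g \<odot>\<^bsub>M\<^esub> \<sigma> g v))"
      unfolding algebra_action_def using a D cv
      by (intro finsum_cong') (auto simp: smult_assoc1[symmetric] R.m_comm)
    then show "algebra_action G M \<sigma> a (c \<odot>\<^bsub>M\<^esub> v) = c \<odot>\<^bsub>M\<^esub> algebra_action G M \<sigma> a v"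
      unfolding algebra_action_def using a D cv by (simp add: finsum_smult Pi_iff)
  qed
qed

lemma algebra_action_mult:
  assumes rep: "representation G k M \<sigma>" and fin: "finite (carrier G)"
    and a: "a \<in> carrier (group_algebra k G)" and b: "b \<in> carrier (group_algebra k G)" and v: "v \<in> carrier M"
  shows "algebra_action G M \<sigma> (a \<otimes>\<^bsub>group_algebra k G\<^esub> b) v = algebra_action G M \<sigma> a (algebra_action G M \<sigma> b v)"
proof -
  interpret module k M by (rule representation_module[OF rep])
  interpret group G using rep by (rule representation.group_G)
  note D = representationD[OF rep]
  have aG: "\<And>g. g \<in> carrier G \<Longrightarrow> a g \<in> carrier k" and bG: "\<And>g. g \<in> carrier G \<Longrightarrow> b g \<in> carrier k"
    using a b by auto
  have "algebra_action G M \<sigma> (a \<otimes>\<^bsub>group_algebra k G\<^esub> b) v =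
      (\<Oplus>\<^bsub>M\<^esub>g\<in>carrier G. \<Oplus>\<^bsub>M\<^esub>h\<in>carrier G. (a h \<otimes>\<^bsub>k\<^esub> b (inv\<^bsub>G\<^esub> h \<otimes>\<^bsub>G\<^esub> g)) \<odot>\<^bsub>M\<^esub> \<sigma> g v)"
    unfolding algebra_action_def using aG bG D v
    by (intro M.finsum_cong') (auto simp: finsum_smult_r Pi_iff intro!: M.finsum_closed)
  also have "\<dots> = (\<Oplus>\<^bsub>M\<^esub>h\<in>carrier G. \<Oplus>\<^bsub>M\<^esub>g\<in>carrier G. (a h \<otimes>\<^bsub>k\<^esub> b (inv\<^bsub>G\<^esub> h \<otimes>\<^bsub>G\<^esub> g)) \<odot>\<^bsub>M\<^esub> \<sigma> g v)"
    using aG bG D v fin by (intro M.finsum_swap) auto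
  also have "\<dots> = (\<Oplus>\<^bsub>M\<^esub>h\<in>carrier G. a h \<odot>\<^bsub>M\<^esub> \<sigma> h (algebra_action G M \<sigma> b v))"
  proof (rule M.finsum_cong')
    fix h assume h: "h \<in> carrier G"
    have img: "carrier G = (\<lambda>g. h \<otimes>\<^bsub>G\<^esub> g) ` carrier G"
      using surj_const_mult[OF h] by simp
    have "(\<Oplus>\<^bsub>M\<^esub>g\<in>carrier G. (a h \<otimes>\<^bsub>k\<^esub> b (inv\<^bsub>G\<^esub> h \<otimes>\<^bsub>G\<^esub> g)) \<odot>\<^bsub>M\<^esub> \<sigma> g v) =
        (\<Oplus>\<^bsub>M\<^esub>g\<in>(\<lambda>g. h \<otimes>\<^bsub>G\<^esub> g) ` carrier G. (a h \<otimes>\<^bsub>k\<^esub> b (inv\<^bsub>G\<^esub> h \<otimes>\<^bsub>G\<^esub> g)) \<odot>\<^bsub>M\<^esub> \<sigma> g v)"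
      using img by simp
    also have "\<dots> = (\<Oplus>\<^bsub>M\<^esub>g\<in>carrier G. (a h \<otimes>\<^bsub>k\<^esub> b (inv\<^bsub>G\<^esub> h \<otimes>\<^bsub>G\<^esub> (h \<otimes>\<^bsub>G\<^esub> g))) \<odot>\<^bsub>M\<^esub> \<sigma> (h \<otimes>\<^bsub>G\<^esub> g) v)"
      using aG bG D v h inj_on_multc by (intro M.finsum_reindex) (auto simp: inj_on_def)
    also have "\<dots> = (\<Oplus>\<^bsub>M\<^esub>g\<in>carrier G. a h \<odot>\<^bsub>M\<^esub> \<sigma> h (b g \<odot>\<^bsub>M\<^esub> \<sigma> g v))"
      using aG bG D v h
      by (intro M.finsum_cong') (auto simp: m_assoc[symmetric] smult_assoc1 representation.act_mult[OF rep])
    also have "\<dots> = a h \<odot>\<^bsub>M\<^esub> (\<Oplus>\<^bsub>M\<^esub>g\<in>carrier G. \<sigma> h (b g \<odot>\<^bsub>M\<^esub> \<sigma> g v))"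
      using aG bG D v h by (intro finsum_smult[symmetric]) (auto simp: Pi_iff)
    also have "(\<Oplus>\<^bsub>M\<^esub>g\<in>carrier G. \<sigma> h (b g \<odot>\<^bsub>M\<^esub> \<sigma> g v)) = \<sigma> h (algebra_action G M \<sigma> b v)"
      unfolding algebra_action_def using aG bG D v h
      by (intro module_hom_finsum[OF module_axioms module_axioms representation.linear[OF rep h], symmetric]) auto
    finally show "(\<Oplus>\<^bsub>M\<^esub>g\<in>carrier G. (a h \<otimes>\<^bsub>k\<^esub> b (inv\<^bsub>G\<^esub> h \<otimes>\<^bsub>G\<^esub> g)) \<odot>\<^bsub>M\<^esub> \<sigma> g v) =
        a h \<odot>\<^bsub>M\<^esub> \<sigma> h (algebra_action G M \<sigma> b v)" .
  qed (use aG D module_homD(1)[OF algebra_action_hom[OF rep bG] v] in auto)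
  finally show ?thesis by (simp only: algebra_action_def[where a = a])
qed

lemma algebra_action_zero:
  assumes "representation G k M \<sigma>" "v \<in> carrier M"
  shows "algebra_action G M \<sigma> \<zero>\<^bsub>group_algebra k G\<^esub> v = \<zero>\<^bsub>M\<^esub>"
proof -
  interpret module k M by (rule representation_module[OF assms(1)])
  have "algebra_action G M \<sigma> \<zero>\<^bsub>group_algebra k G\<^esub> v = (\<Oplus>\<^bsub>M\<^esub>g\<in>carrier G. \<zero>\<^bsub>M\<^esub>)"
    unfolding algebra_action_def using representationD[OF assms(1)] assms(2)
    by (intro M.finsum_cong') auto
  then show ?thesis by simp
qed

text \<open>A linear map that commutes with group elements commutes with their linear combinations.
  Actions enter only through closedness and the intertwining relation, so the lemma applies to
  stalks without first making them representations.\<close>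

lemma algebra_action_equivariant:
  assumes "module R M" "module R N" "f \<in> module_hom R M N"
    and "\<And>g v. g \<in> carrier G \<Longrightarrow> v \<in> carrier M \<Longrightarrow> \<sigma> g v \<in> carrier M"
    and "\<And>g v. g \<in> carrier G \<Longrightarrow> v \<in> carrier M \<Longrightarrow> f (\<sigma> g v) = \<tau> g (f v)"
    and "\<And>g. g \<in> carrier G \<Longrightarrow> a g \<in> carrier R" "v \<in> carrier M"
  shows "f (algebra_action G M \<sigma> a v) = algebra_action G N \<tau> a (f v)"
proof -
  interpret M: module R M by fact
  interpret N: module R N by fact
  have "f (algebra_action G M \<sigma> a v) = (\<Oplus>\<^bsub>N\<^esub>g\<in>carrier G. f (a g \<odot>\<^bsub>M\<^esub> \<sigma> g v))"
    unfolding algebra_action_def using assms by (intro module_hom_finsum[OF assms(1-3)]) auto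
  also have "\<dots> = algebra_action G N \<tau> a (f v)"
    unfolding algebra_action_def using assms(4-) module_homD[OF assms(3)]
    by (intro N.finsum_cong') (auto simp flip: assms(5))
  finally show ?thesis .
qed

text \<open>All operations are carried along \<open>h\<close>: pull the arguments back, compute in
  \<open>V\<close>, push the result forward. An injection into another type thus produces an
  isomorphic copy with elements of that type.\<close>

lemma transport_representation:
  assumes rep: "representation G R V \<sigma>" and inj: "inj_on h (carrier V)"
  obtains M :: "('a, 'w) module" and \<tau> where "carrier M = h ` carrier V" "representation G R M \<tau>" "rep_iso G R V \<sigma> M \<tau> h"
proof -
  interpret module R V by (rule representation_module[OF rep])
  let ?i = "the_inv_into (carrier V) h"
  have i [simp]: "?i (h v) = v" if "v \<in> carrier V" for v using the_inv_into_f_f[OF inj that] .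
  define M :: "('a, 'w) module" where "M = \<lparr>carrier = h ` carrier V, mult = undefined, one = undefined,
    ring.zero = h \<zero>\<^bsub>V\<^esub>, ring.add = (\<lambda>x y. h (?i x \<oplus>\<^bsub>V\<^esub> ?i y)), smult = (\<lambda>c x. h (c \<odot>\<^bsub>V\<^esub> ?i x))\<rparr>"
  have M [simp]: "carrier M = h ` carrier V" "\<zero>\<^bsub>M\<^esub> = h \<zero>\<^bsub>V\<^esub>" "x \<oplus>\<^bsub>M\<^esub> y = h (?i x \<oplus>\<^bsub>V\<^esub> ?i y)"
    "c \<odot>\<^bsub>M\<^esub> x = h (c \<odot>\<^bsub>V\<^esub> ?i x)" for x y c
    by (simp_all add: M_def)
  define \<tau> where "\<tau> g x = h (\<sigma> g (?i x))" for g x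
  have mod: "module R M"
  proof (rule module_criteria)
    show "\<forall>x\<in>carrier M. \<exists>y\<in>carrier M. x \<oplus>\<^bsub>M\<^esub> y = \<zero>\<^bsub>M\<^esub>"
    proof
      fix x assume "x \<in> carrier M"
      then obtain v where v: "v \<in> carrier V" "x = h v" by auto
      then show "\<exists>y\<in>carrier M. x \<oplus>\<^bsub>M\<^esub> y = \<zero>\<^bsub>M\<^esub>"
        by (intro bexI[of _ "h (\<ominus>\<^bsub>V\<^esub> v)"]) (auto simp: M.r_neg)
    qed
  qed (auto simp: M.a_ac smult_assoc1 smult_l_distr smult_r_distr intro: R.is_cring)
  note D = representationD[OF rep]
  have "representation G R M \<tau>"
  proof (intro representation.intro representation_axioms.intro mod)
    show "group G" using representation.group_G[OF rep] .
    show "\<tau> g \<in> module_hom R M M" if "g \<in> carrier G" for g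
      by (rule module_homI) (auto simp: \<tau>_def D that)
  qed (auto simp: \<tau>_def D representation.act_mult[OF rep] representation.act_one[OF rep])
  moreover have "rep_iso G R V \<sigma> M \<tau> h"
    unfolding rep_iso_def using inj by (auto simp: bij_betw_def \<tau>_def intro!: module_homI)
  ultimately show ?thesis using that M(1) by blast
qed

text \<open>The orbit of a nonzero vector is finite, and its span is a nonzero subrepresentation,
  hence everything.\<close>

lemma irreducible_rep_fin_dim:
  assumes k: "field k" and finG: "finite (carrier G)" and irr: "irreducible_rep G k V \<sigma>"
  shows "vectorspace k V" "vectorspace.fin_dim k V"
proof -
  have rep: "representation G k V \<sigma>" using irr by (simp add: irreducible_rep_def)
  show vs: "vectorspace k V" using representation_module[OF rep] k by (simp add: vectorspace_def)
  interpret vectorspace k V by (rule vs)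
  interpret G: group G using representation.group_G[OF rep] .
  note D = representationD[OF rep]
  obtain v where v: "v \<in> carrier V" "v \<noteq> \<zero>\<^bsub>V\<^esub>"
    using irr M.zero_closed unfolding irreducible_rep_def by blast
  let ?B = "(\<lambda>g. \<sigma> g v) ` carrier G"
  have B: "finite ?B" "?B \<subseteq> carrier V" using finG v D by auto
  have sub: "submodule k (span ?B) V" by (rule span_is_submodule[OF B(2)])
  have "\<sigma> g x \<in> span ?B" if g: "g \<in> carrier G" and x: "x \<in> span ?B" for g x
  proof -
    obtain a where a: "a \<in> ?B \<rightarrow> carrier k" "x = lincomb a ?B"
      using x finite_span[OF B] by auto
    \<comment> \<open>The vectors sent into the span by \<open>\<sigma> g\<close> form a submodule.
      It contains the orbit, since \<open>g\<close> permutes the orbit, and therefore contains its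
      span.\<close>
    have pre: "submodule k {x \<in> carrier V. \<sigma> g x \<in> span ?B} V"
      by (rule submodule_vimage[OF module_axioms module_axioms representation.linear[OF rep g] sub])
    have "?B \<subseteq> {x \<in> carrier V. \<sigma> g x \<in> span ?B}"
    proof
      fix y assume "y \<in> ?B"
      then obtain h where h: "h \<in> carrier G" "y = \<sigma> h v" by auto
      then have "\<sigma> g y = \<sigma> (g \<otimes>\<^bsub>G\<^esub> h) v" using representation.act_mult[OF rep g h(1) v(1)] by simp
      also have "\<dots> \<in> span ?B" using in_own_span[OF B(2)] g h by blast
      finally show "y \<in> {x \<in> carrier V. \<sigma> g x \<in> span ?B}" using h D v by simp
    qed
    then have "span ?B \<subseteq> {x \<in> carrier V. \<sigma> g x \<in> span ?B}"
      by (rule span_is_subset[OF _ pre])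
    then show ?thesis using x by blast
  qed
  then have "subrepresentation G k V \<sigma> (span ?B)"
    unfolding subrepresentation_def using sub by auto
  moreover have "v \<in> span ?B"
    using in_own_span[OF B(2)] representation.act_one[OF rep v(1)] G.one_closed by (metis imageI subsetD)
  ultimately have "span ?B = carrier V"
    using irr v unfolding irreducible_rep_def by blast
  then show "vectorspace.fin_dim k V" using B unfolding fin_dim_def by blast
qed

text \<open>The definition of \<open>central_idempotents\<close> tests the idempotents on modules with elements of type
  \<open>nat \<Rightarrow> 'k\<close>, so \<open>V j\<close> has to be copied into that type. Its isotypical component is then everything,
  so \<open>e j\<close> acts surjectively and, being idempotent, as the identity.\<close>

lemma idempotent_action:
  fixes k :: "'k ring" and V :: "nat \<Rightarrow> ('k, 'v) module"
  assumes k: "field k" and finG: "finite (carrier G)" and irr: "irreducible_reps G k r V \<sigma>"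
    and e: "central_idempotents G k r V \<sigma> e" and i: "i \<le> r" and j: "j \<le> r" and v: "v \<in> carrier (V j)"
  shows "algebra_action G (V j) (\<sigma> j) (e i) v = (if i = j then v else \<zero>\<^bsub>V j\<^esub>)"
proof -
  have irrj: "irreducible_rep G k (V j) (\<sigma> j)" using irr j by (simp add: irreducible_reps_def)
  then have rep: "representation G k (V j) (\<sigma> j)" by (simp add: irreducible_rep_def)
  interpret vectorspace k "V j" by (rule irreducible_rep_fin_dim[OF k finG irrj])
  obtain B c where B: "dual_bases k (V j) B (\<lambda>b. b) c"
    by (rule dual_bases_exist[OF irreducible_rep_fin_dim(2)[OF k finG irrj]])
  obtain f and m :: nat where f: "B = f ` {..<m}"
  proof -
    have "finite B" using B by (simp add: dual_bases_def)
    then obtain m and f :: "nat \<Rightarrow> 'v" where "B = f ` {i. i < m}" by (auto simp: finite_conv_nat_seg_image)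
    then show ?thesis using that[of f m] by (auto simp: lessThan_def)
  qed
  \<comment> \<open>The coordinate vector of \<open>v\<close> in the enumerated basis, read as a
    function on the natural numbers; this embeds \<open>V j\<close> into the required type.\<close>
  define h :: "'v \<Rightarrow> nat \<Rightarrow> 'k" where "h v = (\<lambda>i\<in>{..<m}. c (f i) v)" for v
  have inj: "inj_on h (carrier (V j))"
  proof
    fix v w assume vw: "v \<in> carrier (V j)" "w \<in> carrier (V j)" "h v = h w"
    then have cb: "c b v = c b w" if "b \<in> B" for b
    proof -
      obtain l where "l < m" "b = f l" using \<open>b \<in> B\<close> f by auto
      then show ?thesis using fun_cong[OF vw(3), of l] by (simp add: h_def)
    qed
    have "v = (\<Oplus>\<^bsub>V j\<^esub>b\<in>B. c b v \<odot>\<^bsub>V j\<^esub> b)" using B vw unfolding dual_bases_def by blast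
    also have "\<dots> = (\<Oplus>\<^bsub>V j\<^esub>b\<in>B. c b w \<odot>\<^bsub>V j\<^esub> b)"
      using B vw cb module_homD(1)[of "c _" k "V j" "algebra_module (\<lambda>a. a) k"] unfolding dual_bases_def
      by (intro M.finsum_cong') (auto simp: Pi_iff)
    also have "\<dots> = w" using B vw unfolding dual_bases_def by metis
    finally show "v = w" .
  qed
  obtain M :: "('k, nat \<Rightarrow> 'k) module" and \<tau> where M: "carrier M = h ` carrier (V j)"
    and repM: "representation G k M \<tau>" and iso: "rep_iso G k (V j) (\<sigma> j) M \<tau> h"
    by (rule transport_representation[OF rep inj])
  interpret M: module k M by (rule representation_module[OF repM])
  have h: "h \<in> module_hom k (V j) M" and hg: "\<And>g v. g \<in> carrier G \<Longrightarrow> v \<in> carrier (V j) \<Longrightarrow> h (\<sigma> j g v) = \<tau> g (h v)"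
    using iso by (auto simp: rep_iso_def)
  have subM: "subrepresentation G k M \<tau> (carrier M)"
    unfolding subrepresentation_def using submodule_carrier[OF M.module_axioms] representationD(1)[OF repM] by auto
  have fg: "fin_gen_rep G k M \<tau>"
    unfolding fin_gen_rep_def
  proof (intro conjI repM exI[of _ "h ` B"] allI impI; (elim conjE)?)
    show "finite (h ` B)" "h ` B \<subseteq> carrier M" using B M by (auto simp: dual_bases_def)
  next
    fix N assume N: "subrepresentation G k M \<tau> N" "h ` B \<subseteq> N"
    then have sub: "submodule k {v \<in> carrier (V j). h v \<in> N} (V j)"
      by (intro submodule_vimage[OF module_axioms M.module_axioms h]) (simp add: subrepresentation_def)
    have "w \<in> {v \<in> carrier (V j). h v \<in> N}" if w: "w \<in> carrier (V j)" for w
    proof -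
      have "w = (\<Oplus>\<^bsub>V j\<^esub>b\<in>B. c b w \<odot>\<^bsub>V j\<^esub> b)" using B w unfolding dual_bases_def by blast
      also have "\<dots> = lincomb (\<lambda>b. c b w) B" by (simp add: lincomb_def)
      also have "\<dots> \<in> span B"
        using B w module_homD(1)[of "c _" k "V j" "algebra_module (\<lambda>a. a) k"]
        by (subst finite_span) (auto simp: dual_bases_def Pi_iff)
      also have "span B \<subseteq> {v \<in> carrier (V j). h v \<in> N}"
        using N(2) B by (intro span_is_subset[OF _ sub]) (auto simp: dual_bases_def)
      finally show ?thesis .
    qed
    then have "carrier M \<subseteq> N" using M by auto
    then show "N = carrier M" using N submodule.subset unfolding subrepresentation_def by blast
  qed
  have "isotypical_component G k (V j) (\<sigma> j) M \<tau> = carrier M"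
  proof
    show "isotypical_component G k (V j) (\<sigma> j) M \<tau> \<subseteq> carrier M"
      unfolding isotypical_component_def
      by (intro Inter_lower CollectI conjI subM allI impI) (auto simp: subrepresentation_def dest: submodule.subset)
    \<comment> \<open>The map \<open>h\<close> exhibits the whole copy as one of the
      subrepresentations isomorphic to \<open>V j\<close>, so every competitor in the intersection
      contains it.\<close>
    have "rep_iso G k (V j) (\<sigma> j) (M\<lparr>carrier := carrier M\<rparr>) \<tau> h" using iso by simp
    then show "carrier M \<subseteq> isotypical_component G k (V j) (\<sigma> j) M \<tau>"
      unfolding isotypical_component_def using subM by (intro Inter_greatest) blast
  qed
  then have im: "algebra_action G M \<tau> (e j) ` carrier M = carrier M"
    using e fg j by (simp add: central_idempotents_def)
  have eC: "e i \<in> carrier (group_algebra k G)" if "i \<le> r" for i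
    using e that unfolding central_idempotents_def by blast
  have eG: "\<And>g. g \<in> carrier G \<Longrightarrow> e j g \<in> carrier k" using eC[OF j] by auto
  have eq: "h (algebra_action G (V j) (\<sigma> j) (e j) w) = algebra_action G M \<tau> (e j) (h w)" if "w \<in> carrier (V j)" for w
    by (rule algebra_action_equivariant[OF module_axioms M.module_axioms h]) (use that eG hg representationD[OF rep] in auto)
  \<comment> \<open>Idempotence and orthogonality determine the effect of \<open>e i\<close> on
    vectors of the form \<open>e j\<close> times \<open>w\<close>. It remains to write
    \<open>v\<close> in this form, which is done in the copy \<open>M\<close> and pulled back along
    \<open>h\<close>.\<close>
  have act: "algebra_action G (V j) (\<sigma> j) (e i) (algebra_action G (V j) (\<sigma> j) (e j) w) =
      (if i = j then algebra_action G (V j) (\<sigma> j) (e j) w else \<zero>\<^bsub>V j\<^esub>)" if "w \<in> carrier (V j)" for w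
  proof -
    have "e i \<otimes>\<^bsub>group_algebra k G\<^esub> e j = (if i = j then e i else \<zero>\<^bsub>group_algebra k G\<^esub>)"
      using e i j unfolding central_idempotents_def by blast
    then show ?thesis
      using algebra_action_mult[OF rep finG eC[OF i] eC[OF j] that] algebra_action_zero[OF rep that] by auto
  qed
  have "h v \<in> carrier M" using M v by simp
  then have "h v \<in> algebra_action G M \<tau> (e j) ` carrier M" by (simp only: im)
  then obtain y where y: "y \<in> carrier M" "h v = algebra_action G M \<tau> (e j) y" by (elim imageE) simp
  obtain w where w: "w \<in> carrier (V j)" "y = h w" using y(1) M by auto
  have "h v = h (algebra_action G (V j) (\<sigma> j) (e j) w)" using y(2) w eq by simp
  then have "v = algebra_action G (V j) (\<sigma> j) (e j) w"
    using inj_onD[OF inj _ v] module_homD(1)[OF algebra_action_hom[OF rep eG] w(1)] by simp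
  then show ?thesis using act[OF w(1)] by simp
qed

section \<open>Group algebra elements on direct sums\<close>

lemma sum_action_representation:
  assumes rep: "\<And>i. i \<in> I \<Longrightarrow> representation G R (M i) (\<sigma> i)" and R: "cring R" and G: "group G"
  shows "representation G R (sum_module I M) (sum_action I \<sigma>)"
proof (intro representation.intro representation_axioms.intro G)
  show "module R (sum_module I M)" using sum_module_is_module[OF R representation_module[OF rep]] .
  note D = representationD[OF rep]
  interpret G: group G by (rule G)
  show "sum_action I \<sigma> g \<in> module_hom R (sum_module I M) (sum_module I M)" if g: "g \<in> carrier G" for g
    by (rule module_homI) (auto simp: sum_action_def D[OF _ g] PiE_iff intro!: restrict_ext)
  show "sum_action I \<sigma> (g \<otimes>\<^bsub>G\<^esub> h) v = sum_action I \<sigma> g (sum_action I \<sigma> h v)"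
    if "g \<in> carrier G" "h \<in> carrier G" "v \<in> carrier (sum_module I M)" for g h v
    using that by (auto simp: sum_action_def representation.act_mult[OF rep] PiE_iff intro!: restrict_ext)
  show "sum_action I \<sigma> \<one>\<^bsub>G\<^esub> v = v" if "v \<in> carrier (sum_module I M)" for v
    using that by (auto simp: sum_action_def representation.act_one[OF rep] PiE_iff extensional_def fun_eq_iff)
qed

text \<open>Each projection is linear and equivariant, so \<open>algebra_action_equivariant\<close>
  gives the result component by component.\<close>

lemma sum_algebra_action:
  assumes rep: "\<And>i. i \<in> I \<Longrightarrow> representation G R (M i) (\<sigma> i)" and R: "cring R" and G: "group G"
    and a: "\<And>g. g \<in> carrier G \<Longrightarrow> a g \<in> carrier R" and v: "v \<in> carrier (sum_module I M)"
  shows "algebra_action G (sum_module I M) (sum_action I \<sigma>) a v = (\<lambda>i\<in>I. algebra_action G (M i) (\<sigma> i) a (v i))"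
proof -
  have S: "representation G R (sum_module I M) (sum_action I \<sigma>)"
    by (rule sum_action_representation[OF rep R G])
  have cl: "algebra_action G (sum_module I M) (sum_action I \<sigma>) a v \<in> carrier (sum_module I M)"
    using module_homD(1)[OF algebra_action_hom[OF S a] v] .
  show ?thesis
  proof (rule PiE_ext[OF cl[unfolded sum_module_simps]])
    show "(\<lambda>i\<in>I. algebra_action G (M i) (\<sigma> i) a (v i)) \<in> (\<Pi>\<^sub>E i\<in>I. carrier (M i))"
    proof (intro restrict_PiE_iff[THEN iffD2] ballI)
      fix i assume i: "i \<in> I"
      show "algebra_action G (M i) (\<sigma> i) a (v i) \<in> carrier (M i)"
        by (rule module_homD(1)[OF algebra_action_hom[OF rep[OF i] a]]) (use v i in auto)
    qed
    fix i assume i: "i \<in> I"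
    show "algebra_action G (sum_module I M) (sum_action I \<sigma>) a v i = (\<lambda>i\<in>I. algebra_action G (M i) (\<sigma> i) a (v i)) i"
      using algebra_action_equivariant[OF representation_module[OF S] representation_module[OF rep[OF i]]
          sum_proj_hom[OF i], where \<sigma> = "sum_action I \<sigma>" and \<tau> = "\<sigma> i" and G = G and a = a and v = v]
        representationD(1)[OF S] a v i by (simp add: sum_action_def)
  qed
qed

text \<open>The sum is nested, powers inside a sum over \<open>j\<close>. Passing through both
  layers reduces the claim to \<open>idempotent_action\<close>: identity on the copies of
  \<open>V i\<close>, zero on all others.\<close>

lemma idempotent_action_sum:
  fixes k :: "'k ring" and V :: "nat \<Rightarrow> ('k, 'v) module"
  assumes k: "field k" and G: "group G" and fin: "finite (carrier G)" and irr: "irreducible_reps G k r V \<sigma>"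
    and e: "central_idempotents G k r V \<sigma> e" and i: "i \<le> r"
    and w: "w \<in> carrier (sum_module {..r} (\<lambda>i. power_module (V i) (n i)))"
  shows "algebra_action G (sum_module {..r} (\<lambda>i. power_module (V i) (n i)))
      (sum_action {..r} (\<lambda>i. power_action (n i) (\<sigma> i))) (e i) w =
    sum_incl {..r} (\<lambda>i. power_module (V i) (n i)) i (w i)"
proof -
  interpret k: field k by (rule k)
  have rep: "representation G k (V j) (\<sigma> j)" if "j \<in> {..r}" for j
    using irr that by (simp add: irreducible_reps_def irreducible_rep_def)
  have repW: "representation G k (power_module (V j) (n j)) (power_action (n j) (\<sigma> j))" if "j \<in> {..r}" for j
    by (rule sum_action_representation[OF rep[OF that] k.is_cring G])
  have eG: "\<And>g. g \<in> carrier G \<Longrightarrow> e i g \<in> carrier k"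
    using e i unfolding central_idempotents_def by auto
  have wj: "w j \<in> carrier (power_module (V j) (n j))" if "j \<in> {..r}" for j
    using w that by auto
  have "algebra_action G (power_module (V j) (n j)) (power_action (n j) (\<sigma> j)) (e i) (w j) =
      (if j = i then w i else \<zero>\<^bsub>power_module (V j) (n j)\<^esub>)" if j: "j \<in> {..r}" for j
  proof -
    have "algebra_action G (power_module (V j) (n j)) (power_action (n j) (\<sigma> j)) (e i) (w j) =
        (\<lambda>l\<in>{..<n j}. algebra_action G (V j) (\<sigma> j) (e i) (w j l))"
      by (rule sum_algebra_action[OF rep[OF j] k.is_cring G eG wj[OF j]])
    also have "\<dots> = (\<lambda>l\<in>{..<n j}. if i = j then w j l else \<zero>\<^bsub>V j\<^esub>)"
      using wj[OF j] j i by (intro restrict_ext idempotent_action[OF k fin irr e]) auto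
    finally show ?thesis
      using wj[OF j] by (auto simp: PiE_iff extensional_def fun_eq_iff)
  qed
  then show ?thesis
    using sum_algebra_action[OF repW k.is_cring G eG w] by (auto simp: sum_incl_def intro!: restrict_ext)
qed

section \<open>Group algebra elements after extension of scalars\<close>

context scalars
begin

text \<open>On a pure tensor the scalars \<open>\<iota> (a g)\<close> can be moved back into the
  first factor as \<open>a g\<close>, where they assemble to the action of \<open>a\<close> on
  \<open>M\<close>. Additivity does the rest.\<close>

lemma ext_algebra_action:
  assumes rep: "representation G k M \<sigma>" and a: "\<And>g. g \<in> carrier G \<Longrightarrow> a g \<in> carrier k" and x: "x \<in> carrier (ext M)"
  shows "algebra_action G (ext M) (scalar_extension_action k K \<iota> M \<sigma>) (\<lambda>g. \<iota> (a g)) x = ext_map M M (algebra_action G M \<sigma> a) x"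
proof -
  have M: "module k M" by (rule representation_module[OF rep])
  interpret M: module k M by (rule M)
  interpret X: module K "ext M" by (rule ext_module[OF M])
  note lin = representation.linear[OF rep]
  note D = representationD[OF rep]
  note E = module_homD[OF ext_map_hom[OF M M lin]]
  have h: "algebra_action G M \<sigma> a \<in> module_hom k M M" by (rule algebra_action_hom[OF rep a])
  note H = ext_map_hom[OF M M h]
  let ?L = "algebra_action G (ext M) (scalar_extension_action k K \<iota> M \<sigma>) (\<lambda>g. \<iota> (a g))"
  have L: "?L \<in> carrier (ext M) \<rightarrow> carrier (ext M)"
    unfolding algebra_action_def using E a by (auto intro!: X.finsum_closed simp del: ext_simps)
  show ?thesis using M x
  proof (induct rule: ext_induct)
    case zero
    have "?L \<zero>\<^bsub>ext M\<^esub> = (\<Oplus>\<^bsub>ext M\<^esub>g\<in>carrier G. \<zero>\<^bsub>ext M\<^esub>)"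
      unfolding algebra_action_def
      using module_hom_zero[OF X.module_axioms X.module_axioms ext_map_hom[OF M M lin]] a
      by (intro X.finsum_cong') (auto simp del: ext_simps)
    then show ?case using module_hom_zero[OF X.module_axioms X.module_axioms H] by simp
  next
    case (pure v c)
    have ten: "(\<lambda>v. ten M v c) \<in> module_hom k M (tensor_product k M A)"
      using tensor.ten_add_left[OF tensor[OF M]] tensor.ten_smult_left[OF tensor[OF M]] tensor.ten_closed[OF tensor[OF M]] pure
      by (intro module_homI) auto
    interpret t: tensor k M A by (rule tensor[OF M])
    have fs: "finsum (ext M) f I = finsum t.T f I" for f :: "'g \<Rightarrow> _" and I
    proof -
      have "add (ext M) = add t.T" by (simp add: scalar_extension_def Let_def)
      then show ?thesis by (simp add: finsum_def finprod_def)
    qed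
    have "?L (ten M v c) = (\<Oplus>\<^bsub>ext M\<^esub>g\<in>carrier G. ten M (a g \<odot>\<^bsub>M\<^esub> \<sigma> g v) c)"
      unfolding algebra_action_def using pure a D M lin ten_closed[OF M]
      by (intro X.finsum_cong') (auto simp: ext_map_ten ten_smult simp del: ext_simps)
    also have "\<dots> = ten M (algebra_action G M \<sigma> a v) c"
      unfolding algebra_action_def fs using pure a D
      by (intro module_hom_finsum[OF M t.T.module_axioms ten, symmetric]) auto
    finally show ?case using pure M h by (simp add: ext_map_ten)
  next
    case (add x y)
    have "?L (x \<oplus>\<^bsub>ext M\<^esub> y) = (\<Oplus>\<^bsub>ext M\<^esub>g\<in>carrier G. \<iota> (a g) \<odot>\<^bsub>ext M\<^esub> ext_map M M (\<sigma> g) x \<oplus>\<^bsub>ext M\<^esub> \<iota> (a g) \<odot>\<^bsub>ext M\<^esub> ext_map M M (\<sigma> g) y)"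
      unfolding algebra_action_def using add a E
      by (intro X.finsum_cong') (auto simp: X.smult_r_distr simp del: ext_simps)
    also have "\<dots> = ?L x \<oplus>\<^bsub>ext M\<^esub> ?L y"
      unfolding algebra_action_def using add a E by (intro X.finsum_addf) (auto simp del: ext_simps)
    finally show ?case using add module_homD(2)[OF H] by (simp del: ext_simps)
  qed
qed

end

section \<open>Sheaves with an action of the group algebra\<close>

lemma sheaf_unique:
  assumes "sheaf T F r" "\<And>U. U \<in> \<U> \<Longrightarrow> openin T U" "s \<in> F (\<Union>\<U>)" "t \<in> F (\<Union>\<U>)"
    "\<And>U. U \<in> \<U> \<Longrightarrow> r (\<Union>\<U>) U s = r (\<Union>\<U>) U t"
  shows "s = t"
proof -
  have "\<forall>U\<in>\<U>. openin T U" using assms(2) by blast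
  note S = assms(1)[unfolded sheaf_def, THEN conjunct2, THEN spec, THEN mp, OF this, THEN conjunct1]
  show ?thesis using S[rule_format, OF assms(3,4)] assms(5) by blast
qed

lemma sheaf_glue:
  assumes "sheaf T F r" "\<And>U. U \<in> \<U> \<Longrightarrow> openin T U" "\<And>U. U \<in> \<U> \<Longrightarrow> f U \<in> F U"
    "\<And>U V. U \<in> \<U> \<Longrightarrow> V \<in> \<U> \<Longrightarrow> r U (U \<inter> V) (f U) = r V (U \<inter> V) (f V)"
  obtains s where "s \<in> F (\<Union>\<U>)" "\<And>U. U \<in> \<U> \<Longrightarrow> r (\<Union>\<U>) U s = f U"
proof -
  have "\<forall>U\<in>\<U>. openin T U" using assms(2) by blast
  note S = assms(1)[unfolded sheaf_def, THEN conjunct2, THEN spec, THEN mp, OF this, THEN conjunct2, THEN spec, of f, THEN mp]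
  have "\<exists>s\<in>F (\<Union>\<U>). \<forall>U\<in>\<U>. r (\<Union>\<U>) U s = f U"
    by (rule S) (use assms(3,4) in blast)
  then show ?thesis using that by blast
qed

lemma sheaf_EndD:
  assumes "\<psi> \<in> carrier (sheaf_End S E)" "openin (pts S) U"
  shows "\<psi> U \<in> module_hom (Osec S U) (Msec E U) (Msec E U)"
    and "openin (pts S) V \<Longrightarrow> V \<subseteq> U \<Longrightarrow> s \<in> carrier (Msec E U) \<Longrightarrow> Mres E U V (\<psi> U s) = \<psi> V (Mres E U V s)"
  using assms by (simp_all add: sheaf_End_def)

lemma sheaf_End_simps:
  assumes "openin (pts S) U" "s \<in> carrier (Msec E U)"
  shows "(\<psi> \<otimes>\<^bsub>sheaf_End S E\<^esub> \<chi>) U s = \<psi> U (\<chi> U s)"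
    and "(\<psi> \<oplus>\<^bsub>sheaf_End S E\<^esub> \<chi>) U s = \<psi> U s \<oplus>\<^bsub>Msec E U\<^esub> \<chi> U s"
    and "\<one>\<^bsub>sheaf_End S E\<^esub> U s = s"
  using assms by (simp_all add: sheaf_End_def)

locale group_sheaf = sheaf_of_modules S E + OG_module k G S \<pi> \<phi> E \<rho>
  for k :: "'k ring" and G :: "'g monoid" and S :: "('x, 'a) ringed_space_data" and \<pi> \<phi>
    and E :: "('x, 'a, 'e) module_sheaf_data" and \<rho> +
  assumes k: "cring k" and G: "group G" and finG: "finite (carrier G)"
    and mor: "lrs_morphism S (Spec k) \<pi> \<phi>"
begin

abbreviation "GA \<equiv> group_algebra k G"
abbreviation "scal \<equiv> scalar_section k S \<pi> \<phi>"
abbreviation "opn U \<equiv> openin (pts S) U"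

sublocale k: cring k by (rule k)
sublocale G: group G by (rule G)

lemma \<rho>_End: "a \<in> carrier GA \<Longrightarrow> \<rho> a \<in> carrier (sheaf_End S E)"
  using action_hom by (simp add: ring_hom_def Pi_iff)

lemma \<rho>_hom: "a \<in> carrier GA \<Longrightarrow> opn U \<Longrightarrow> \<rho> a U \<in> module_hom (Osec S U) (Msec E U) (Msec E U)"
  by (rule sheaf_EndD(1)[OF \<rho>_End])

lemmas \<rho>_lin = module_homD[OF \<rho>_hom]

lemma \<rho>_res:
  "a \<in> carrier GA \<Longrightarrow> opn U \<Longrightarrow> opn V \<Longrightarrow> V \<subseteq> U \<Longrightarrow> s \<in> M U \<Longrightarrow> Mres E U V (\<rho> a U s) = \<rho> a V (Mres E U V s)"
  by (rule sheaf_EndD(2)[OF \<rho>_End])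

lemma \<rho>_add:
  "a \<in> carrier GA \<Longrightarrow> b \<in> carrier GA \<Longrightarrow> opn U \<Longrightarrow> s \<in> M U \<Longrightarrow> \<rho> (a \<oplus>\<^bsub>GA\<^esub> b) U s = \<rho> a U s \<oplus>\<^bsub>Msec E U\<^esub> \<rho> b U s"
  using ring_hom_add[OF action_hom, of a b] sheaf_End_simps(2) by metis

lemma \<rho>_mult:
  "a \<in> carrier GA \<Longrightarrow> b \<in> carrier GA \<Longrightarrow> opn U \<Longrightarrow> s \<in> M U \<Longrightarrow> \<rho> (a \<otimes>\<^bsub>GA\<^esub> b) U s = \<rho> a U (\<rho> b U s)"
  using ring_hom_mult[OF action_hom, of a b] sheaf_End_simps(1) by metis

lemma \<rho>_one: "opn U \<Longrightarrow> s \<in> M U \<Longrightarrow> \<rho> \<one>\<^bsub>GA\<^esub> U s = s"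
  using ring_hom_one[OF action_hom] sheaf_End_simps(3) by metis

lemma GA_zero: "\<zero>\<^bsub>GA\<^esub> \<in> carrier GA"
  by simp

text \<open>The definition of \<open>ring_hom\<close> says nothing about zero. Additivity of
  \<open>\<rho>\<close> applied to \<open>0 + 0 = 0\<close> gives a section equal to its own
  double.\<close>

lemma \<rho>_zero:
  assumes U: "opn U" and s: "s \<in> M U"
  shows "\<rho> \<zero>\<^bsub>GA\<^esub> U s = \<zero>\<^bsub>Msec E U\<^esub>"
proof -
  interpret U: module "Osec S U" "Msec E U" by (rule sections_module[OF U])
  have "\<zero>\<^bsub>GA\<^esub> \<oplus>\<^bsub>GA\<^esub> \<zero>\<^bsub>GA\<^esub> = \<zero>\<^bsub>GA\<^esub>" by (auto intro!: restrict_ext)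
  then have "\<rho> \<zero>\<^bsub>GA\<^esub> U s \<oplus>\<^bsub>Msec E U\<^esub> \<rho> \<zero>\<^bsub>GA\<^esub> U s = \<rho> \<zero>\<^bsub>GA\<^esub> U s"
    using \<rho>_add[OF GA_zero GA_zero U s] by metis
  then show ?thesis
    using \<rho>_lin(1)[OF GA_zero U s] by (metis U.M.add.l_cancel_one)
qed

lemma \<rho>_finsum:
  assumes I: "finite I" and e: "e \<in> I \<rightarrow> carrier GA" and U: "opn U" and s: "s \<in> M U"
  shows "\<rho> (\<Oplus>\<^bsub>GA\<^esub>i\<in>I. e i) U s = (\<Oplus>\<^bsub>Msec E U\<^esub>i\<in>I. \<rho> (e i) U s)"
proof -
  interpret U: module "Osec S U" "Msec E U" by (rule sections_module[OF U])
  interpret GA: abelian_group GA by (rule group_algebra_abelian_group[OF k])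
  show ?thesis using I e
  proof (induct I)
    case empty
    show ?case using \<rho>_zero[OF U s] by (simp del: group_algebra_simps)
  next
    case (insert i I)
    then have "e i \<in> carrier GA" "e \<in> I \<rightarrow> carrier GA" by (auto simp del: group_algebra_simps)
    moreover have "(\<lambda>i. \<rho> (e i) U s) \<in> I \<rightarrow> M U" "\<rho> (e i) U s \<in> M U"
      using calculation \<rho>_lin(1)[OF _ U s] by (auto simp del: group_algebra_simps)
    ultimately show ?case
      using insert(1-3) GA.finsum_closed \<rho>_add[OF _ _ U s]
      by (simp add: GA.finsum_insert U.M.finsum_insert del: group_algebra_simps)
  qed
qed

lemma group_elt_closed: "group_elt k G g \<in> carrier GA"
  by (auto simp: group_elt_def)

text \<open>Writes \<open>\<rho> a\<close> through group elements. The induction on the set of group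
  elements needs partial sums, so \<open>a\<close> is cut off to zero outside \<open>I\<close>; each
  step splits off one multiple of a group element, on which \<open>action_scalar\<close>
  applies.\<close>

lemma \<rho>_expand:
  assumes a: "a \<in> carrier GA" and I: "finite I" "I \<subseteq> carrier G" and U: "opn U" and s: "s \<in> M U"
  shows "\<rho> (\<lambda>g\<in>carrier G. if g \<in> I then a g else \<zero>\<^bsub>k\<^esub>) U s =
    (\<Oplus>\<^bsub>Msec E U\<^esub>g\<in>I. scal U (a g) \<odot>\<^bsub>Msec E U\<^esub> \<rho> (group_elt k G g) U s)"
proof -
  interpret U: module "Osec S U" "Msec E U" by (rule sections_module[OF U])
  have ak: "\<And>g. g \<in> carrier G \<Longrightarrow> a g \<in> carrier k" using a by auto
  have tm: "scal U (a g) \<odot>\<^bsub>Msec E U\<^esub> \<rho> (group_elt k G g) U s \<in> M U" if "g \<in> carrier G" for g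
    using \<rho>_lin(1)[OF group_elt_closed U s] ring_hom_closed[OF scalar_section_hom(1)[OF k ringed_space_axioms mor U] ak[OF that]]
    by simp
  show ?thesis using I
  proof (induct I)
    case empty
    have "(\<lambda>g\<in>carrier G. if g \<in> {} then a g else \<zero>\<^bsub>k\<^esub>) = \<zero>\<^bsub>GA\<^esub>" by (auto intro!: restrict_ext)
    then show ?case using \<rho>_zero[OF U s] by (simp del: group_algebra_simps)
  next
    case (insert g I)
    then have g: "g \<in> carrier G" "I \<subseteq> carrier G" by auto
    let ?x = "\<lambda>h\<in>carrier G. a g \<otimes>\<^bsub>k\<^esub> group_elt k G g h"
    let ?y = "\<lambda>h\<in>carrier G. if h \<in> I then a h else \<zero>\<^bsub>k\<^esub>"
    have x: "?x \<in> carrier GA" using ak[OF g(1)] by (auto simp: group_elt_def)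
    have y: "?y \<in> carrier GA" using ak by auto
    have "(\<lambda>h\<in>carrier G. if h \<in> insert g I then a h else \<zero>\<^bsub>k\<^esub>) = ?x \<oplus>\<^bsub>GA\<^esub> ?y"
      using insert(2) ak g by (auto simp: group_elt_def intro!: restrict_ext)
    then have "\<rho> (\<lambda>h\<in>carrier G. if h \<in> insert g I then a h else \<zero>\<^bsub>k\<^esub>) U s = \<rho> ?x U s \<oplus>\<^bsub>Msec E U\<^esub> \<rho> ?y U s"
      using \<rho>_add[OF x y U s] by metis
    also have "\<rho> ?x U s = scal U (a g) \<odot>\<^bsub>Msec E U\<^esub> \<rho> (group_elt k G g) U s"
      by (rule action_scalar[OF ak[OF g(1)] group_elt_closed U s])
    finally show ?case
      using insert(1,2) insert(3)[OF g(2)] tm g by (simp add: U.M.finsum_insert Pi_iff subset_iff)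
  qed
qed

lemma stalk_\<rho>:
  assumes "a \<in> carrier GA" "opn U" "x \<in> U" "s \<in> M U"
  shows "stalk_map S E (\<rho> a) x (Mgerm S E x U s) = Mgerm S E x U (\<rho> a U s)"
  using assms by (intro stalk_map_germ M_presheaf) (simp_all add: \<rho>_lin(1) \<rho>_res del: group_algebra_simps)

text \<open>Identifies the stalk of the sheaf endomorphism \<open>\<rho> a\<close> with a
  combination of group elements over the stalk ring. Only in the latter form can a map that is
  merely equivariant for \<open>G\<close> be moved past it.\<close>

lemma stalk_algebra_action:
  assumes a: "a \<in> carrier GA" and x: "x \<in> topspace (pts S)" and A: "A \<in> carrier (stalk_module S E x)"
    and R: "cring (stalk_ring S x)"
  shows "algebra_action G (stalk_module S E x) (stalk_action k G S E \<rho> x) (\<lambda>g. scalar_germ k S \<pi> \<phi> x (a g)) A =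
    stalk_map S E (\<rho> a) x A"
proof -
  obtain U s where U: "opn U" "x \<in> U" and s: "s \<in> M U" and A: "A = Mgerm S E x U s"
    using A unfolding stalk_module_carrier by (rule germsE)
  interpret X: module "stalk_ring S x" "stalk_module S E x" by (rule stalk_is_module[OF R x])
  interpret U: module "Osec S U" "Msec E U" by (rule sections_module[OF U(1)])
  have ak: "\<And>g. g \<in> carrier G \<Longrightarrow> a g \<in> carrier k" using a by auto
  have sc: "scal U (a g) \<in> carrier (Osec S U)" if "g \<in> carrier G" for g
    using ring_hom_closed[OF scalar_section_hom(1)[OF k ringed_space_axioms mor U(1)] ak[OF that]] .
  note el = \<rho>_lin(1)[OF group_elt_closed U(1) s]
  define m where "m g = scal U (a g) \<odot>\<^bsub>Msec E U\<^esub> \<rho> (group_elt k G g) U s" for g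
  have m: "m g \<in> M U" if "g \<in> carrier G" for g using sc[OF that] el by (simp add: m_def)
  have t: "scalar_germ k S \<pi> \<phi> x (a g) \<odot>\<^bsub>stalk_module S E x\<^esub> stalk_action k G S E \<rho> x g A = Mgerm S E x U (m g)"
    if g: "g \<in> carrier G" for g
    unfolding stalk_action_def A stalk_\<rho>[OF group_elt_closed U s] scalar_germ_eq[OF k ringed_space_axioms mor U ak[OF g]] m_def
    by (rule Mgerm_ops(2)[OF U sc[OF g] el])
  have "algebra_action G (stalk_module S E x) (stalk_action k G S E \<rho> x) (\<lambda>g. scalar_germ k S \<pi> \<phi> x (a g)) A =
      (\<Oplus>\<^bsub>stalk_module S E x\<^esub>g\<in>carrier G. Mgerm S E x U (m g))"
    unfolding algebra_action_def using t m Mgerm_closed[OF U] by (intro X.finsum_cong') auto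
  also have "\<dots> = Mgerm S E x U (\<Oplus>\<^bsub>Msec E U\<^esub>g\<in>carrier G. m g)"
  proof -
    \<comment> \<open>Taking germs over the fixed set \<open>U\<close> is additive, and induction
      extends this to finite sums.\<close>
    have "(\<Oplus>\<^bsub>stalk_module S E x\<^esub>g\<in>I. Mgerm S E x U (m g)) = Mgerm S E x U (\<Oplus>\<^bsub>Msec E U\<^esub>g\<in>I. m g)"
      if "finite I" "I \<subseteq> carrier G" for I
      using that
    proof (induct I)
      case empty
      then show ?case by (simp add: Mgerm_ops(3)[OF U])
    next
      case (insert g I)
      then have "g \<in> carrier G" "I \<subseteq> carrier G" by auto
      then have "m \<in> I \<rightarrow> M U" "m g \<in> M U" "(\<lambda>g. Mgerm S E x U (m g)) \<in> I \<rightarrow> carrier (stalk_module S E x)"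
        "Mgerm S E x U (m g) \<in> carrier (stalk_module S E x)"
        using m Mgerm_closed[OF U] by auto
      then show ?case
        using insert(1,2) insert(3)[OF \<open>I \<subseteq> carrier G\<close>]
        by (simp add: X.M.finsum_insert U.M.finsum_insert Mgerm_ops(1)[OF U] U.M.finsum_closed)
    qed
    then show ?thesis using finG by blast
  qed
  also have "(\<Oplus>\<^bsub>Msec E U\<^esub>g\<in>carrier G. m g) = \<rho> a U s"
  proof -
    have "(\<lambda>g\<in>carrier G. if g \<in> carrier G then a g else \<zero>\<^bsub>k\<^esub>) = a"
      using a by (auto simp: PiE_iff extensional_def fun_eq_iff)
    then show ?thesis using \<rho>_expand[OF a finG subset_refl U(1) s] by (simp only: m_def)
  qed
  finally show ?thesis unfolding A stalk_\<rho>[OF a U s] .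
qed

end

section \<open>The image of a central idempotent\<close>

text \<open>One idempotent at a time: each \<open>e i\<close> gives an instance, and what relates
  different \<open>e i\<close>, orthogonality and their sum, is left to
  \<open>direct_sum\<close>.\<close>

locale central_idempotent = group_sheaf +
  fixes e assumes e: "e \<in> carrier GA" and idem: "e \<otimes>\<^bsub>GA\<^esub> e = e"
    and central: "\<And>a. a \<in> carrier GA \<Longrightarrow> e \<otimes>\<^bsub>GA\<^esub> a = a \<otimes>\<^bsub>GA\<^esub> e"
begin

abbreviation "F \<equiv> image_sheaf S E (\<rho> e)"

lemma F_simps [simp]:
  "\<zero>\<^bsub>Msec F U\<^esub> = \<zero>\<^bsub>Msec E U\<^esub>" "s \<oplus>\<^bsub>Msec F U\<^esub> t = s \<oplus>\<^bsub>Msec E U\<^esub> t" "c \<odot>\<^bsub>Msec F U\<^esub> s = c \<odot>\<^bsub>Msec E U\<^esub> s"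
  by (simp_all add: image_sheaf_def)

lemma F_Mres: "Mres F = Mres E"
  by (simp add: image_sheaf_def)

lemma e_idem: "opn U \<Longrightarrow> s \<in> M U \<Longrightarrow> \<rho> e U (\<rho> e U s) = \<rho> e U s"
  using \<rho>_mult[OF e e] idem by simp

text \<open>A section of the image sheaf is only locally in the image of \<open>\<rho> e\<close>. By
  idempotence it is locally fixed by \<open>\<rho> e\<close>, and uniqueness in the sheaf makes it
  fixed globally. Conversely, a fixed section is its own preimage.\<close>

lemma F_carrier:
  assumes U: "opn U"
  shows "carrier (Msec F U) = {s \<in> M U. \<rho> e U s = s}"
proof (intro equalityI subsetI)
  fix s assume "s \<in> carrier (Msec F U)"
  then have s: "s \<in> M U" and loc: "\<And>x. x \<in> U \<Longrightarrow> \<exists>V t. opn V \<and> x \<in> V \<and> V \<subseteq> U \<and> t \<in> M V \<and> Mres E U V s = \<rho> e V t"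
    by (simp_all add: image_sheaf_def)
  \<comment> \<open>All open subsets of \<open>U\<close> on which \<open>s\<close> is fixed; local
    membership in the image shows that they cover \<open>U\<close>.\<close>
  define \<U> where "\<U> = {V. opn V \<and> V \<subseteq> U \<and> Mres E U V (\<rho> e U s) = Mres E U V s}"
  have "x \<in> \<Union>\<U>" if x: "x \<in> U" for x
  proof -
    obtain V t where V: "opn V" "x \<in> V" "V \<subseteq> U" "t \<in> M V" "Mres E U V s = \<rho> e V t" using loc[OF x] by blast
    have "Mres E U V (\<rho> e U s) = Mres E U V s"
      using \<rho>_res[OF e U V(1,3) s] V e_idem by simp
    then show ?thesis using V by (auto simp: \<U>_def)
  qed
  then have un: "\<Union>\<U> = U" by (auto simp: \<U>_def)
  have "\<rho> e U s = s"
    by (rule sheaf_unique[OF module_sheaf, of \<U>]) (use \<rho>_lin(1)[OF e U s] s in \<open>simp_all add: un, simp_all add: \<U>_def\<close>)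
  then show "s \<in> {s \<in> M U. \<rho> e U s = s}" using s by simp
next
  fix s assume "s \<in> {s \<in> M U. \<rho> e U s = s}"
  then have s: "s \<in> M U" "\<rho> e U s = s" by auto
  have "\<exists>V t. opn V \<and> x \<in> V \<and> V \<subseteq> U \<and> t \<in> M V \<and> Mres E U V s = \<rho> e V t" if x: "x \<in> U" for x
    using U s x presheafD(2)[OF M_presheaf U U subset_refl s(1)] by (intro exI[of _ U] exI[of _ s]) simp
  then show "s \<in> carrier (Msec F U)" using s by (simp add: image_sheaf_def)
qed

lemma F_sub: "opn U \<Longrightarrow> s \<in> carrier (Msec F U) \<Longrightarrow> s \<in> M U"
  by (simp add: F_carrier)

lemma F_submodule:
  assumes U: "opn U"
  shows "submodule (Osec S U) (carrier (Msec F U)) (Msec E U)"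
proof -
  interpret U: module "Osec S U" "Msec E U" by (rule sections_module[OF U])
  have "\<rho> e U \<zero>\<^bsub>Msec E U\<^esub> = \<zero>\<^bsub>Msec E U\<^esub>"
    by (rule module_hom_zero[OF U.module_axioms U.module_axioms \<rho>_hom[OF e U]])
  then show ?thesis
    unfolding F_carrier[OF U]
    by (intro submodule.intro U.module_axioms) (auto simp: \<rho>_lin[OF e U])
qed

lemma F_res: "opn U \<Longrightarrow> opn V \<Longrightarrow> V \<subseteq> U \<Longrightarrow> s \<in> carrier (Msec F U) \<Longrightarrow> Mres E U V s \<in> carrier (Msec F V)"
  using \<rho>_res[OF e, of U V s, symmetric] Mres_closed[of U V s] by (simp add: F_carrier)

lemma F_presheaf: "presheaf (pts S) (\<lambda>U. carrier (Msec F U)) (Mres F)"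
  unfolding presheaf_def F_Mres
proof (intro conjI allI impI ballI)
  fix U V assume "opn U \<and> opn V \<and> V \<subseteq> U"
  then show "Mres E U V \<in> carrier (Msec F U) \<rightarrow> carrier (Msec F V)" by (auto intro: F_res)
next
  fix U s assume "opn U" "s \<in> carrier (Msec F U)"
  then show "Mres E U U s = s" using presheafD(2)[OF M_presheaf, of U U s] by (simp add: F_carrier)
next
  fix U V W s assume "opn U \<and> opn V \<and> opn W \<and> W \<subseteq> V \<and> V \<subseteq> U" "s \<in> carrier (Msec F U)"
  then show "Mres E V W (Mres E U V s) = Mres E U W s"
    using presheafD(3)[OF M_presheaf, of U V s W] by (simp add: F_carrier)
qed

text \<open>Fixed sections are glued in \<open>E\<close>. The glued section and its image under
  \<open>\<rho> e\<close> agree on every member of the cover, so they are equal and the glued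
  section is fixed too.\<close>

lemma F_sheaf: "sheaf (pts S) (\<lambda>U. carrier (Msec F U)) (Mres F)"
  unfolding sheaf_def F_Mres
proof (intro conjI F_presheaf[unfolded F_Mres] allI impI ballI)
  fix \<U> s t assume op: "\<forall>U\<in>\<U>. opn U" and s: "s \<in> carrier (Msec F (\<Union>\<U>))" and t: "t \<in> carrier (Msec F (\<Union>\<U>))"
    and eq: "\<forall>U\<in>\<U>. Mres E (\<Union>\<U>) U s = Mres E (\<Union>\<U>) U t"
  have un: "opn (\<Union>\<U>)" using op by auto
  show "s = t"
    by (rule sheaf_unique[OF module_sheaf op[rule_format] F_sub[OF un s] F_sub[OF un t] eq[rule_format]])
next
  fix \<U> f assume op: "\<forall>U\<in>\<U>. opn U"
    and f: "(\<forall>U\<in>\<U>. f U \<in> carrier (Msec F U)) \<and> (\<forall>U\<in>\<U>. \<forall>V\<in>\<U>. Mres E U (U \<inter> V) (f U) = Mres E V (U \<inter> V) (f V))"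
  have un: "opn (\<Union>\<U>)" using op by auto
  obtain s where s: "s \<in> M (\<Union>\<U>)" "\<And>U. U \<in> \<U> \<Longrightarrow> Mres E (\<Union>\<U>) U s = f U"
    by (rule sheaf_glue[OF module_sheaf, of \<U> f]) (use op f F_sub in auto)
  have "\<rho> e (\<Union>\<U>) s = s"
  proof (rule sheaf_unique[OF module_sheaf, of \<U>])
    fix U assume U: "U \<in> \<U>"
    then have "\<rho> e U (f U) = f U" using f op by (simp add: F_carrier)
    then show "Mres E (\<Union>\<U>) U (\<rho> e (\<Union>\<U>) s) = Mres E (\<Union>\<U>) U s"
      using \<rho>_res[OF e un _ _ s(1), of U] op U s(2) by auto
  qed (use op s(1) \<rho>_lin(1)[OF e un s(1)] in auto)
  then show "\<exists>s\<in>carrier (Msec F (\<Union>\<U>)). \<forall>U\<in>\<U>. Mres E (\<Union>\<U>) U s = f U"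
    using s by (intro bexI[of _ s]) (auto simp: F_carrier[OF un])
qed

lemma F_O_module: "O_module S F"
proof (rule O_module.intro)
  show "module (Osec S U) (Msec F U)" if "opn U" for U
    using module.submodule_is_module[OF sections_module F_submodule] that by (simp add: image_sheaf_def)
  show "Mres F U V (s \<oplus>\<^bsub>Msec F U\<^esub> t) = Mres F U V s \<oplus>\<^bsub>Msec F V\<^esub> Mres F U V t"
    if "opn U" "opn V" "V \<subseteq> U" "s \<in> carrier (Msec F U)" "t \<in> carrier (Msec F U)" for U V s t
    using that restriction_add[of U V s t] by (simp add: F_sub F_Mres)
  show "Mres F U V (a \<odot>\<^bsub>Msec F U\<^esub> s) = Ores S U V a \<odot>\<^bsub>Msec F V\<^esub> Mres F U V s"
    if "opn U" "opn V" "V \<subseteq> U" "a \<in> carrier (Osec S U)" "s \<in> carrier (Msec F U)" for U V a s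
    using that restriction_smult[of U V a s] by (simp add: F_sub F_Mres)
qed (rule F_sheaf)

sublocale F: sheaf_of_modules S F
  by (intro sheaf_of_modules.intro ringed_space_axioms F_O_module)

text \<open>This is where centrality enters: applying \<open>e\<close> after \<open>a\<close> is the
  same as applying \<open>a\<close> after \<open>e\<close>, and \<open>e\<close> fixes
  \<open>s\<close>.\<close>

lemma F_stable:
  assumes "a \<in> carrier GA" "opn U" "s \<in> carrier (Msec F U)"
  shows "\<rho> a U s \<in> carrier (Msec F U)"
proof -
  have s: "s \<in> M U" "\<rho> e U s = s" using assms by (auto simp: F_carrier)
  have "\<rho> e U (\<rho> a U s) = \<rho> (a \<otimes>\<^bsub>GA\<^esub> e) U s"
    using \<rho>_mult[OF e assms(1,2) s(1)] central[OF assms(1)] by simp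
  also have "\<dots> = \<rho> a U s" using \<rho>_mult[OF assms(1) e assms(2) s(1)] s(2) by simp
  finally show ?thesis using \<rho>_lin(1)[OF assms(1,2) s(1)] assms(2) by (simp add: F_carrier)
qed

abbreviation "\<rho>F \<equiv> restrict_action S F \<rho>"

lemma \<rho>F_simps: "opn U \<Longrightarrow> s \<in> carrier (Msec F U) \<Longrightarrow> \<rho>F a U s = \<rho> a U s"
  by (simp add: restrict_action_def)

lemma F_OG_module: "OG_module k G S \<pi> \<phi> F \<rho>F"
proof (intro OG_module.intro F_O_module OG_module_axioms.intro)
  show "\<rho>F \<in> ring_hom GA (sheaf_End S F)"
  proof (rule ring_hom_memI)
    fix a assume a: "a \<in> carrier GA"
    have "\<rho>F a U \<in> module_hom (Osec S U) (Msec F U) (Msec F U)" if U: "opn U" for U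
      using U a F.M_closed[OF U]
      by (intro module_homI) (simp_all add: \<rho>F_simps F_stable \<rho>_lin F_sub del: group_algebra_simps)
    moreover have "Mres F U V (\<rho>F a U s) = \<rho>F a V (Mres F U V s)"
      if "opn U" "opn V" "V \<subseteq> U" "s \<in> carrier (Msec F U)" for U V s
      using that a by (simp add: \<rho>F_simps F_res \<rho>_res F_sub F_Mres del: group_algebra_simps)
    ultimately show "\<rho>F a \<in> carrier (sheaf_End S F)"
      by (auto simp: sheaf_End_def restrict_action_def)
  next
    fix a b assume a: "a \<in> carrier GA" and b: "b \<in> carrier GA"
    show "\<rho>F (a \<otimes>\<^bsub>GA\<^esub> b) = \<rho>F a \<otimes>\<^bsub>sheaf_End S F\<^esub> \<rho>F b"
      unfolding restrict_action_def sheaf_End_def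
      using a b F_stable by (auto simp: \<rho>_mult F_sub fun_eq_iff simp del: group_algebra_simps)
    show "\<rho>F (a \<oplus>\<^bsub>GA\<^esub> b) = \<rho>F a \<oplus>\<^bsub>sheaf_End S F\<^esub> \<rho>F b"
      unfolding restrict_action_def sheaf_End_def
      using a b by (auto simp: \<rho>_add F_sub fun_eq_iff simp del: group_algebra_simps)
  next
    show "\<rho>F \<one>\<^bsub>GA\<^esub> = \<one>\<^bsub>sheaf_End S F\<^esub>"
      unfolding restrict_action_def sheaf_End_def
      by (auto simp: \<rho>_one F_sub fun_eq_iff simp del: group_algebra_simps)
  qed
next
  fix c a U s assume "c \<in> carrier k" "a \<in> carrier GA" "opn U" "s \<in> carrier (Msec F U)"
  then show "\<rho>F (\<lambda>g\<in>carrier G. c \<otimes>\<^bsub>k\<^esub> a g) U s = scal U c \<odot>\<^bsub>Msec F U\<^esub> \<rho>F a U s"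
    using action_scalar[of c a U s] by (simp add: \<rho>F_simps F_sub del: group_algebra_simps)
qed

abbreviation "incl \<equiv> stalk_map S E (\<lambda>U s. s)"

lemma incl_germ:
  assumes "opn U" "x \<in> U" "s \<in> carrier (Msec F U)"
  shows "incl x (Mgerm S F x U s) = Mgerm S E x U s"
  using stalk_map_germ[OF F_presheaf M_presheaf, of "\<lambda>U s. s" U x s] assms F_sub by (simp add: F_Mres)

lemma incl_hom: "incl x \<in> module_hom (stalk_ring S x) (stalk_module S F x) (stalk_module S E x)"
proof (rule module_homI)
  fix A assume "A \<in> carrier (stalk_module S F x)"
  then obtain U s where "opn U" "x \<in> U" "s \<in> carrier (Msec F U)" "A = Mgerm S F x U s"
    unfolding F.stalk_module_carrier by (rule germsE)
  then show "incl x A \<in> carrier (stalk_module S E x)" by (simp add: incl_germ Mgerm_closed F_sub)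
next
  fix A B assume "A \<in> carrier (stalk_module S F x)" "B \<in> carrier (stalk_module S F x)"
  then obtain U s t where "opn U" "x \<in> U" "s \<in> carrier (Msec F U)" "t \<in> carrier (Msec F U)"
    "A = Mgerm S F x U s" "B = Mgerm S F x U t"
    unfolding F.stalk_module_carrier by (rule germs_common2[OF F_presheaf F_presheaf])
  then show "incl x (A \<oplus>\<^bsub>stalk_module S F x\<^esub> B) = incl x A \<oplus>\<^bsub>stalk_module S E x\<^esub> incl x B"
    using F.Mgerm_ops(1)[of U x s t] Mgerm_ops(1)[of U x s t] F.M_closed(1)[of U s t] by (simp add: incl_germ F_sub)
next
  fix c A assume "c \<in> carrier (stalk_ring S x)" "A \<in> carrier (stalk_module S F x)"
  then obtain U a s where "opn U" "x \<in> U" "a \<in> carrier (Osec S U)" "s \<in> carrier (Msec F U)"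
    "c = Ogerm S x U a" "A = Mgerm S F x U s"
    unfolding F.stalk_module_carrier stalk_ring_carrier by (rule germs_common2[OF O_presheaf F_presheaf])
  then show "incl x (c \<odot>\<^bsub>stalk_module S F x\<^esub> A) = c \<odot>\<^bsub>stalk_module S E x\<^esub> incl x A"
    using F.Mgerm_ops(2)[of U x a s] Mgerm_ops(2)[of U x a s] F.M_closed(2)[of U a s] by (simp add: incl_germ F_sub)
qed

text \<open>The restriction maps of \<open>F\<close> are those of \<open>E\<close>, so a
  neighbourhood on which two sections of \<open>F\<close> agree in \<open>E\<close> also witnesses
  equality of their germs in \<open>F\<close>.\<close>

lemma incl_inj: "inj_on (incl x) (carrier (stalk_module S F x))"
proof
  fix A B assume AB: "A \<in> carrier (stalk_module S F x)" "B \<in> carrier (stalk_module S F x)" and eq: "incl x A = incl x B"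
  obtain U s t where U: "opn U" "x \<in> U" and s: "s \<in> carrier (Msec F U)" and t: "t \<in> carrier (Msec F U)"
    and A: "A = Mgerm S F x U s" and B: "B = Mgerm S F x U t"
    by (rule germs_common2[OF F_presheaf F_presheaf AB[unfolded F.stalk_module_carrier]])
  have "Mgerm S E x U s = Mgerm S E x U t" using eq unfolding A B incl_germ[OF U s] incl_germ[OF U t] .
  then obtain W where W: "opn W" "x \<in> W" "W \<subseteq> U" "Mres E U W s = Mres E U W t"
    by (rule germ_eqD[where F = M and t = t]) (use U F_sub[OF U(1) t] in blast)+
  show "A = B" unfolding A B
    by (rule germ_eqI[OF F_presheaf U(1) s U(1) t W(1,2)]) (use W in \<open>simp_all add: F_Mres\<close>)
qed

text \<open>If a germ is fixed, a representing section need not be, but it agrees with its image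
  under \<open>\<rho> e\<close> on some smaller \<open>W\<close>. Its restriction to
  \<open>W\<close> is a section of \<open>F\<close>.\<close>

lemma incl_image:
  assumes "A \<in> carrier (stalk_module S E x)" "stalk_map S E (\<rho> e) x A = A"
  shows "A \<in> incl x ` carrier (stalk_module S F x)"
proof -
  obtain U s where U: "opn U" "x \<in> U" and s: "s \<in> M U" and A: "A = Mgerm S E x U s"
    using assms(1) unfolding stalk_module_carrier by (rule germsE)
  have "Mgerm S E x U (\<rho> e U s) = Mgerm S E x U s"
    using assms(2) unfolding A stalk_\<rho>[OF e U s] .
  then obtain W where W: "opn W" "x \<in> W" "W \<subseteq> U" "Mres E U W (\<rho> e U s) = Mres E U W s"
    by (rule germ_eqD[where F = M and t = s]) (use U s in blast)+
  have t: "Mres E U W s \<in> carrier (Msec F W)"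
    using W \<rho>_res[OF e U(1) W(1,3) s] Mres_closed[OF U(1) W(1,3) s] by (simp add: F_carrier)
  have "incl x (Mgerm S F x W (Mres E U W s)) = A"
    unfolding A incl_germ[OF W(1,2) t] by (rule germ_res[OF M_presheaf U(1) s W(1-3)])
  then show ?thesis using F.Mgerm_closed[OF W(1,2) t] by blast
qed

lemma incl_fixed:
  assumes "A \<in> carrier (stalk_module S F x)"
  shows "stalk_map S E (\<rho> e) x (incl x A) = incl x A"
proof -
  obtain U s where U: "opn U" "x \<in> U" and s: "s \<in> carrier (Msec F U)" and A: "A = Mgerm S F x U s"
    using assms(1) unfolding F.stalk_module_carrier by (rule germsE)
  show ?thesis unfolding A incl_germ[OF U s] stalk_\<rho>[OF e U F_sub[OF U(1) s]]
    using s U by (simp add: F_carrier)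
qed

lemma incl_equivariant:
  assumes "A \<in> carrier (stalk_module S F x)"
  shows "stalk_action k G S F \<rho>F x g A \<in> carrier (stalk_module S F x)"
    and "incl x (stalk_action k G S F \<rho>F x g A) = stalk_action k G S E \<rho> x g (incl x A)"
proof -
  \<comment> \<open>The image sheaf with the restricted action satisfies the same assumptions as
    \<open>E\<close>, so the computation of the stalk action on germs applies to it as well.\<close>
  interpret F': group_sheaf k G S \<pi> \<phi> F \<rho>F
    by (intro group_sheaf.intro F_OG_module F.sheaf_of_modules_axioms group_sheaf_axioms.intro k G finG mor)
  obtain U s where U: "opn U" "x \<in> U" and s: "s \<in> carrier (Msec F U)" and A: "A = Mgerm S F x U s"
    using assms(1) unfolding F.stalk_module_carrier by (rule germsE)
  have st: "\<rho> (group_elt k G g) U s \<in> carrier (Msec F U)" by (rule F_stable[OF group_elt_closed U(1) s])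
  have 1: "stalk_action k G S F \<rho>F x g A = Mgerm S F x U (\<rho> (group_elt k G g) U s)"
    unfolding A stalk_action_def F'.stalk_\<rho>[OF group_elt_closed U s] \<rho>F_simps[OF U(1) s] ..
  show "stalk_action k G S F \<rho>F x g A \<in> carrier (stalk_module S F x)"
    unfolding 1 by (rule F.Mgerm_closed[OF U st])
  show "incl x (stalk_action k G S F \<rho>F x g A) = stalk_action k G S E \<rho> x g (incl x A)"
    unfolding 1 incl_germ[OF U st] unfolding A incl_germ[OF U s] stalk_action_def stalk_\<rho>[OF group_elt_closed U F_sub[OF U(1) s]] ..
qed

end

section \<open>The decomposition\<close>

lemma module_hom_inverse:
  assumes "module R M" and f: "f \<in> module_hom R M N" and bij: "bij_betw f (carrier M) (carrier N)"
  shows "inv_into (carrier M) f \<in> module_hom R N M"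
proof -
  interpret module R M by fact
  let ?g = "inv_into (carrier M) f"
  have g: "?g w \<in> carrier M" "f (?g w) = w" if "w \<in> carrier N" for w
    using that bij by (auto simp: bij_betw_def inv_into_into f_inv_into_f)
  have gf: "?g (f v) = v" if "v \<in> carrier M" for v
    using that bij by (simp add: bij_betw_def)
  show ?thesis
  proof (rule module_homI)
    fix v w assume vw: "v \<in> carrier N" "w \<in> carrier N"
    have "f (?g v \<oplus>\<^bsub>M\<^esub> ?g w) = v \<oplus>\<^bsub>N\<^esub> w" using vw g module_homD(2)[OF f] by simp
    then show "?g (v \<oplus>\<^bsub>N\<^esub> w) = ?g v \<oplus>\<^bsub>M\<^esub> ?g w" using gf[of "?g v \<oplus>\<^bsub>M\<^esub> ?g w"] g vw by simp
  next
    fix c v assume cv: "c \<in> carrier R" "v \<in> carrier N"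
    have "f (c \<odot>\<^bsub>M\<^esub> ?g v) = c \<odot>\<^bsub>N\<^esub> v" using cv g module_homD(3)[OF f] by simp
    then show "?g (c \<odot>\<^bsub>N\<^esub> v) = c \<odot>\<^bsub>M\<^esub> ?g v" using gf[of "c \<odot>\<^bsub>M\<^esub> ?g v"] g cv by simp
  qed (use g in simp)
qed

text \<open>Finite dimension is known for the target \<open>W\<close>, while the dimension facts for
  linear maps start from the source; hence the passage to the inverse map.\<close>

lemma vectorspace_iso_dim:
  assumes V: "vectorspace K V" and W: "vectorspace K W" and f: "f \<in> module_hom K V W"
    and bij: "bij_betw f (carrier V) (carrier W)" and fin: "vectorspace.fin_dim K W"
  shows "vectorspace.fin_dim K V" "vectorspace.dim K V = vectorspace.dim K W"
proof -
  interpret V: vectorspace K V by fact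
  interpret W: vectorspace K W by fact
  let ?g = "inv_into (carrier V) f"
  have g: "?g \<in> module_hom K W V" by (rule module_hom_inverse[OF V.module_axioms f bij])
  interpret g: linear_map K W V ?g
    by (intro linear_map.intro mod_hom.intro mod_hom_axioms.intro V W V.module_axioms W.module_axioms g)
  have "bij_betw ?g (carrier W) (carrier V)" by (rule bij_betw_inv_into[OF bij])
  then have "inj_on ?g (carrier W)" "?g ` carrier W = carrier V" by (auto simp: bij_betw_def)
  then show "vectorspace.fin_dim K V" "vectorspace.dim K V = vectorspace.dim K W"
    using g.surj_fin_dim[OF fin] g.dim_eq[OF fin] by simp_all
qed

text \<open>The action of \<open>e i\<close> and the projection to the \<open>i\<close>-th summand
  agree on the carrier only, so they cannot be exchanged by rewriting the function.\<close>

lemma (in scalars) ext_map_cong: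
  assumes M: "module k M" "module k M'" and f: "f \<in> module_hom k M M'" and g: "g \<in> module_hom k M M'"
    and eq: "\<And>v. v \<in> carrier M \<Longrightarrow> f v = g v" and x: "x \<in> carrier (ext M)"
  shows "ext_map M M' f x = ext_map M M' g x"
  using M(1) x
proof (induct rule: ext_induct)
  case zero
  show ?case
    using module_hom_zero[OF ext_module ext_module ext_map_hom] M f g by metis
next
  case (add x y)
  then show ?case by (simp only: module_homD[OF ext_map_hom[OF M f]] module_homD[OF ext_map_hom[OF M g]])
qed (simp add: ext_map_ten M f g eq)

lemma (in group_sheaf) stalk_\<rho>_closed:
  assumes "a \<in> carrier GA" "A \<in> carrier (stalk_module S E x)"
  shows "stalk_map S E (\<rho> a) x A \<in> carrier (stalk_module S E x)"
proof -
  obtain U s where U: "opn U" "x \<in> U" and s: "s \<in> M U" and A: "A = Mgerm S E x U s"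
    using assms(2) unfolding stalk_module_carrier by (rule germsE)
  show ?thesis
    unfolding A stalk_\<rho>[OF assms(1) U s] by (rule Mgerm_closed[OF U \<rho>_lin(1)[OF assms(1) U(1) s]])
qed

text \<open>Existence: the idempotents add up to one, so \<open>s\<close> is the sum of the sections
  \<open>\<rho> (e i) U s\<close>. Uniqueness: \<open>e j\<close> applied to any decomposition keeps
  the \<open>j\<close>-th term, which it fixes, and kills the others, which are fixed by idempotents
  orthogonal to it.\<close>

lemma (in group_sheaf) direct_sum:
  assumes e: "\<And>i. i \<le> r \<Longrightarrow> central_idempotent k G S \<pi> \<phi> E \<rho> (e i)"
    and orth: "\<And>i j. i \<le> r \<Longrightarrow> j \<le> r \<Longrightarrow> i \<noteq> j \<Longrightarrow> e i \<otimes>\<^bsub>GA\<^esub> e j = \<zero>\<^bsub>GA\<^esub>"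
    and sum: "(\<Oplus>\<^bsub>GA\<^esub>i\<in>{..r}. e i) = \<one>\<^bsub>GA\<^esub>"
  shows "internal_direct_sum S E r (\<lambda>i. image_sheaf S E (\<rho> (e i)))"
  unfolding internal_direct_sum_def
proof (intro allI impI conjI ballI)
  fix U i assume "opn U" "i \<le> r"
  then show "submodule (Osec S U) (carrier (Msec (image_sheaf S E (\<rho> (e i))) U)) (Msec E U)"
    using central_idempotent.F_submodule[OF e] by blast
next
  fix U s assume U: "opn U" and s: "s \<in> M U"
  interpret U: module "Osec S U" "Msec E U" by (rule sections_module[OF U])
  let ?F = "\<lambda>i. carrier (Msec (image_sheaf S E (\<rho> (e i))) U)"
  have F: "?F i = {s \<in> M U. \<rho> (e i) U s = s}" if "i \<in> {..r}" for i
    using central_idempotent.F_carrier[OF e U] that by simp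
  have eGA: "e i \<in> carrier GA" if "i \<in> {..r}" for i
    using central_idempotent.e[OF e] that by simp
  let ?t = "\<lambda>i\<in>{..r}. \<rho> (e i) U s"
  have t: "?t \<in> (\<Pi>\<^sub>E i\<in>{..r}. ?F i)"
    using \<rho>_lin(1)[OF eGA U s] central_idempotent.e_idem[OF e U s]
    by (auto simp: F)
  have "s = \<rho> (\<Oplus>\<^bsub>GA\<^esub>i\<in>{..r}. e i) U s" using \<rho>_one[OF U s] sum by simp
  also have "\<dots> = (\<Oplus>\<^bsub>Msec E U\<^esub>i\<in>{..r}. \<rho> (e i) U s)"
    using eGA by (intro \<rho>_finsum[OF _ _ U s]) (auto simp del: group_algebra_simps)
  also have "\<dots> = (\<Oplus>\<^bsub>Msec E U\<^esub>i\<in>{..r}. ?t i)"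
    using \<rho>_lin(1)[OF eGA U s] by (intro U.M.finsum_cong') auto
  finally have st: "s = (\<Oplus>\<^bsub>Msec E U\<^esub>i\<in>{..r}. ?t i)" .
  have uniq: "t' = ?t" if t': "t' \<in> (\<Pi>\<^sub>E i\<in>{..r}. ?F i)" and st': "s = (\<Oplus>\<^bsub>Msec E U\<^esub>i\<in>{..r}. t' i)" for t'
  proof (rule PiE_ext[OF t' t])
    fix j assume j: "j \<in> {..r}"
    have tM: "t' i \<in> M U" "\<rho> (e i) U (t' i) = t' i" if "i \<in> {..r}" for i
      using PiE_mem[OF t' that] F[OF that] by auto
    have "\<rho> (e j) U s = (\<Oplus>\<^bsub>Msec E U\<^esub>i\<in>{..r}. \<rho> (e j) U (t' i))"
      unfolding st' using tM by (intro module_hom_finsum[OF U.module_axioms U.module_axioms \<rho>_hom[OF eGA[OF j] U]]) auto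
    also have "\<dots> = (\<Oplus>\<^bsub>Msec E U\<^esub>i\<in>{j}. \<rho> (e j) U (t' i))"
    proof (rule U.M.finsum_mono_neutral)
      fix i assume i: "i \<in> {..r} - {j}"
      have "\<rho> (e j) U (t' i) = \<rho> (e j \<otimes>\<^bsub>GA\<^esub> e i) U (t' i)"
        using \<rho>_mult[OF eGA[OF j] eGA U] tM i by simp
      also have "\<dots> = \<zero>\<^bsub>Msec E U\<^esub>" using \<rho>_zero[OF U] orth i j tM by simp
      finally show "\<rho> (e j) U (t' i) = \<zero>\<^bsub>Msec E U\<^esub>" .
    qed (use j \<rho>_lin(1)[OF eGA[OF j] U] tM in auto)
    also have "\<dots> = t' j" using tM[OF j] by simp
    finally show "t' j = ?t j" using j by simp
  qed
  show "\<exists>!t. t \<in> (\<Pi>\<^sub>E i\<in>{..r}. ?F i) \<and> s = (\<Oplus>\<^bsub>Msec E U\<^esub>i\<in>{..r}. t i)"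
    using t st uniq by (intro ex1I[of _ ?t]) blast+
qed

text \<open>The stalk of \<open>F\<close> is the fixed space of \<open>e i\<close> on the stalk of
  \<open>E\<close>. The map \<open>\<Phi>\<close> carries this operator to the extension of
  inclusion after projection on the direct sum, whose fixed space is the image of the extended
  inclusion. The square in the first conclusion expresses that \<open>\<Psi>\<close> is induced by
  the inclusion of \<open>F\<close> in \<open>E\<close>.\<close>

lemma group_sheaf_stalk_iso:
  fixes k :: "'k ring" and V :: "nat \<Rightarrow> ('k, 'v) module" and E :: "('x, 'a, 'e) module_sheaf_data" and n :: "nat \<Rightarrow> nat"
    and S :: "('x, 'a) ringed_space_data" and x \<pi> \<phi> \<rho> \<sigma> e i
  defines "K \<equiv> stalk_ring S x" and "\<iota> \<equiv> scalar_germ k S \<pi> \<phi> x"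
    and "W \<equiv> \<lambda>i. power_module (V i) (n i)" and "\<sigma>W \<equiv> \<lambda>i. power_action (n i) (\<sigma> i)"
  assumes ci: "central_idempotent k G S \<pi> \<phi> E \<rho> (e i)" and k: "field k" and K: "field K" and x: "x \<in> topspace (pts S)"
    and irr: "irreducible_reps G k r V \<sigma>" and cis: "central_idempotents G k r V \<sigma> e" and i: "i \<le> r"
    and iso: "rep_iso G K (stalk_module S E x) (stalk_action k G S E \<rho> x)
           (scalar_extension k K \<iota> (sum_module {..r} W))
           (scalar_extension_action k K \<iota> (sum_module {..r} W) (sum_action {..r} \<sigma>W)) \<Phi>"
  defines "F \<equiv> image_sheaf S E (\<rho> (e i))"
  shows "\<exists>\<Psi>. rep_iso G K (stalk_module S F x) (stalk_action k G S F (restrict_action S F \<rho>) x)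
               (scalar_extension k K \<iota> (W i)) (scalar_extension_action k K \<iota> (W i) (\<sigma>W i)) \<Psi> \<and>
             (\<forall>A\<in>carrier (stalk_module S F x).
                \<Phi> (stalk_map S E (\<lambda>U s. s) x A) =
                scalar_extension_map k K \<iota> (W i) (sum_module {..r} W) (sum_incl {..r} W i) (\<Psi> A))"
    and "vectorspace K (stalk_module S F x)"
    and "vectorspace.fin_dim K (stalk_module S F x)"
    and "vectorspace.dim K (stalk_module S F x) = n i * vectorspace.dim k (V i)"
proof -
  interpret ci: central_idempotent k G S \<pi> \<phi> E \<rho> "e i" by (rule ci)
  have F: "F = ci.F" by (simp add: F_def)
  interpret K: field K by (rule K)
  interpret sc: scalars k K \<iota>
    unfolding scalars_def scalars_axioms_def K_def \<iota>_def
    using scalar_germ_hom[OF ci.k ci.ringed_space_axioms ci.mor x] ci.k K.is_cring K_def by simp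
  have irrV: "irreducible_rep G k (V j) (\<sigma> j)" if "j \<in> {..r}" for j
    using irr that by (simp add: irreducible_reps_def)
  have rep: "representation G k (V j) (\<sigma> j)" if "j \<in> {..r}" for j
    using irrV[OF that] by (simp add: irreducible_rep_def)
  have repW: "representation G k (W j) (\<sigma>W j)" if "j \<in> {..r}" for j
    unfolding W_def \<sigma>W_def by (rule sum_action_representation[OF rep[OF that] ci.k ci.G])
  let ?W = "sum_module {..r} W" and ?\<sigma> = "sum_action {..r} \<sigma>W"
  have repT: "representation G k ?W ?\<sigma>" by (rule sum_action_representation[OF repW ci.k ci.G])
  have WT: "module k ?W" and Wi: "module k (W i)"
    using representation_module[OF repT] representation_module[OF repW] i by auto
  have inc: "sum_incl {..r} W i \<in> module_hom k (W i) ?W"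
    using i representation_module[OF repW] by (intro sum_incl_hom) auto
  have proj: "(\<lambda>v. v i) \<in> module_hom k ?W (W i)"
    using i by (intro sum_proj_hom) auto
  have incproj: "(\<lambda>w. sum_incl {..r} W i (w i)) \<in> module_hom k ?W ?W"
    by (rule module_hom_comp[OF proj inc])
  have projinc: "sum_incl {..r} W i v i = v" for v using i by (simp add: sum_incl_def)
  let ?X = "sc.ext ?W" and ?ME = "stalk_module S E x" and ?MF = "stalk_module S F x"
  let ?inc = "sc.ext_map (W i) ?W (sum_incl {..r} W i)" and ?proj = "sc.ext_map ?W (W i) (\<lambda>v. v i)"
  have ME: "module K ?ME" unfolding K_def by (rule ci.stalk_is_module[OF _ x]) (use K.is_cring K_def in simp)
  have MF: "module K ?MF" unfolding K_def F by (rule ci.F.stalk_is_module[OF _ x]) (use K.is_cring K_def in simp)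
  have X: "module K ?X" by (rule sc.ext_module[OF WT])
  have \<Phi>: "\<Phi> \<in> module_hom K ?ME ?X" and bij: "bij_betw \<Phi> (carrier ?ME) (carrier ?X)"
    and equi: "\<And>g v. g \<in> carrier G \<Longrightarrow> v \<in> carrier ?ME \<Longrightarrow>
       \<Phi> (stalk_action k G S E \<rho> x g v) = scalar_extension_action k K \<iota> ?W ?\<sigma> g (\<Phi> v)"
    using iso by (auto simp: rep_iso_def)
  have inc_hom: "ci.incl x \<in> module_hom K ?MF ?ME" unfolding K_def F by (rule ci.incl_hom)
  have ek: "\<And>g. g \<in> carrier G \<Longrightarrow> e i g \<in> carrier k" using ci.e by auto
  \<comment> \<open>The operator changes its form three times: sheaf endomorphism, combination of
    group elements over \<open>K\<close>, and extension of the action of \<open>e i\<close> over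
    \<open>k\<close>. Only the middle form can be moved past \<open>\<Phi>\<close>.\<close>
  have act: "\<Phi> (stalk_map S E (\<rho> (e i)) x A) = sc.ext_map ?W ?W (\<lambda>w. sum_incl {..r} W i (w i)) (\<Phi> A)"
    if A: "A \<in> carrier ?ME" for A
  proof -
    have \<Phi>A: "\<Phi> A \<in> carrier ?X" using module_homD(1)[OF \<Phi> A] .
    have "\<Phi> (stalk_map S E (\<rho> (e i)) x A) =
        \<Phi> (algebra_action G ?ME (stalk_action k G S E \<rho> x) (\<lambda>g. \<iota> (e i g)) A)"
      using ci.stalk_algebra_action[OF ci.e x A] K.is_cring by (simp add: K_def \<iota>_def)
    also have "\<dots> = algebra_action G ?X (scalar_extension_action k K \<iota> ?W ?\<sigma>) (\<lambda>g. \<iota> (e i g)) (\<Phi> A)"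
      by (rule algebra_action_equivariant[OF ME X \<Phi>])
        (use equi A ek ci.stalk_\<rho>_closed[OF ci.group_elt_closed] in \<open>auto simp: stalk_action_def\<close>)
    also have "\<dots> = sc.ext_map ?W ?W (algebra_action G ?W ?\<sigma> (e i)) (\<Phi> A)"
      by (rule sc.ext_algebra_action[OF repT ek \<Phi>A])
    also have "\<dots> = sc.ext_map ?W ?W (\<lambda>w. sum_incl {..r} W i (w i)) (\<Phi> A)"
      using idempotent_action_sum[OF k ci.G ci.finG irr cis i, of _ n, folded W_def \<sigma>W_def]
      by (intro sc.ext_map_cong[OF WT WT algebra_action_hom[OF repT ek] incproj _ \<Phi>A])
    finally show ?thesis .
  qed
  \<comment> \<open>Projecting gives a total linear map at once; inverting the extended inclusion
    would first require a description of its image. That nothing is lost by projecting is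
    \<open>key\<close>.\<close>
  define \<Psi> where "\<Psi> A = ?proj (\<Phi> (ci.incl x A))" for A
  have \<Psi>: "\<Psi> \<in> module_hom K ?MF (sc.ext (W i))"
    unfolding \<Psi>_def
    by (rule module_hom_comp[OF module_hom_comp[OF inc_hom \<Phi>] sc.ext_map_hom[OF WT Wi proj]])
  have \<Phi>inc: "\<Phi> (ci.incl x A) \<in> carrier ?X" if "A \<in> carrier ?MF" for A
    using module_homD(1)[OF \<Phi> module_homD(1)[OF inc_hom that]] .
  \<comment> \<open>Including after projecting is the action of \<open>e i\<close>, by
    \<open>act\<close> and functoriality, and \<open>e i\<close> fixes every germ that comes from
    \<open>F\<close>.\<close>
  have key: "?inc (\<Psi> A) = \<Phi> (ci.incl x A)" if A: "A \<in> carrier ?MF" for A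
  proof -
    have "?inc (\<Psi> A) = sc.ext_map ?W ?W (\<lambda>w. sum_incl {..r} W i (w i)) (\<Phi> (ci.incl x A))"
      unfolding \<Psi>_def by (rule sc.ext_map_comp[OF WT Wi WT proj inc \<Phi>inc[OF A]])
    also have "\<dots> = \<Phi> (stalk_map S E (\<rho> (e i)) x (ci.incl x A))"
      by (rule act[OF module_homD(1)[OF inc_hom A], symmetric])
    finally show ?thesis using ci.incl_fixed A by (simp add: F)
  qed
  have inj: "inj_on \<Psi> (carrier ?MF)"
  proof
    fix A B assume AB: "A \<in> carrier ?MF" "B \<in> carrier ?MF" "\<Psi> A = \<Psi> B"
    then have "\<Phi> (ci.incl x A) = \<Phi> (ci.incl x B)" using key by metis
    then have "ci.incl x A = ci.incl x B"
      using inj_onD[OF bij_betw_imp_inj_on[OF bij]] module_homD(1)[OF inc_hom] AB by blast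
    then show "A = B" using inj_onD[OF ci.incl_inj] AB by (simp add: F)
  qed
  \<comment> \<open>The extended inclusion of \<open>y\<close> is fixed by the projector, because
    projecting after including is the identity. Its preimage under \<open>\<Phi>\<close> is
    therefore fixed by \<open>e i\<close> and comes from \<open>F\<close>.\<close>
  have surj: "y \<in> \<Psi> ` carrier ?MF" if y: "y \<in> carrier (sc.ext (W i))" for y
  proof -
    have iy: "?inc y \<in> carrier ?X" using module_homD(1)[OF sc.ext_map_hom[OF Wi WT inc] y] .
    then have "?inc y \<in> \<Phi> ` carrier ?ME" by (simp only: bij_betw_imp_surj_on[OF bij])
    then obtain B where B: "B \<in> carrier ?ME" "\<Phi> B = ?inc y" by (elim imageE) simp
    have "\<Phi> (stalk_map S E (\<rho> (e i)) x B) = sc.ext_map ?W ?W (\<lambda>w. sum_incl {..r} W i (w i)) (?inc y)"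
      using act[OF B(1)] B(2) by simp
    also have "\<dots> = ?inc y"
      using sc.ext_map_comp[OF Wi WT WT inc incproj y] by (simp only: projinc)
    finally have "stalk_map S E (\<rho> (e i)) x B = B"
      using inj_onD[OF bij_betw_imp_inj_on[OF bij] _ ci.stalk_\<rho>_closed[OF ci.e B(1)] B(1)] B(2) by simp
    then obtain A where A: "A \<in> carrier ?MF" "B = ci.incl x A"
      using ci.incl_image[OF B(1)] by (auto simp: F)
    have "\<Psi> A = ?proj (?inc y)" using A B by (simp add: \<Psi>_def)
    also have "\<dots> = sc.ext_map (W i) (W i) (\<lambda>v. v) y"
      using sc.ext_map_comp[OF Wi WT Wi inc proj y] by (simp only: projinc)
    also have "\<dots> = y" by (rule sc.ext_map_ident[OF Wi module_hom_ident refl y])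
    finally show ?thesis using A(1) by blast
  qed
  have bij\<Psi>: "bij_betw \<Psi> (carrier ?MF) (carrier (sc.ext (W i)))"
    using inj surj module_homD(1)[OF \<Psi>] by (auto simp: bij_betw_def simp del: sc.ext_simps)
  have equi\<Psi>: "\<Psi> (stalk_action k G S F (restrict_action S F \<rho>) x g A) = scalar_extension_action k K \<iota> (W i) (\<sigma>W i) g (\<Psi> A)"
    if g: "g \<in> carrier G" and A: "A \<in> carrier ?MF" for g A
  proof -
    have lin: "?\<sigma> g \<in> module_hom k ?W ?W" "\<sigma>W i g \<in> module_hom k (W i) (W i)"
      using representation.linear[OF repT g] representation.linear[OF repW g] i by auto
    have "\<Psi> (stalk_action k G S F (restrict_action S F \<rho>) x g A) = ?proj (\<Phi> (stalk_action k G S E \<rho> x g (ci.incl x A)))"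
      using ci.incl_equivariant(2) A by (simp add: \<Psi>_def F)
    also have "\<dots> = ?proj (sc.ext_map ?W ?W (?\<sigma> g) (\<Phi> (ci.incl x A)))"
      using equi[OF g module_homD(1)[OF inc_hom A]] by simp
    also have "\<dots> = sc.ext_map ?W (W i) (\<lambda>w. ?\<sigma> g w i) (\<Phi> (ci.incl x A))"
      by (rule sc.ext_map_comp[OF WT WT Wi lin(1) proj \<Phi>inc[OF A]])
    also have "\<dots> = sc.ext_map ?W (W i) (\<lambda>w. \<sigma>W i g (w i)) (\<Phi> (ci.incl x A))"
      using i by (simp add: sum_action_def)
    also have "\<dots> = sc.ext_map (W i) (W i) (\<sigma>W i g) (\<Psi> A)"
      unfolding \<Psi>_def by (rule sc.ext_map_comp[OF WT Wi Wi proj lin(2) \<Phi>inc[OF A], symmetric])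
    finally show ?thesis .
  qed
  have "rep_iso G K ?MF (stalk_action k G S F (restrict_action S F \<rho>) x)
      (scalar_extension k K \<iota> (W i)) (scalar_extension_action k K \<iota> (W i) (\<sigma>W i)) \<Psi>"
    unfolding rep_iso_def using \<Psi> bij\<Psi> equi\<Psi> by blast
  then show "\<exists>\<Psi>. rep_iso G K ?MF (stalk_action k G S F (restrict_action S F \<rho>) x)
               (scalar_extension k K \<iota> (W i)) (scalar_extension_action k K \<iota> (W i) (\<sigma>W i)) \<Psi> \<and>
             (\<forall>A\<in>carrier ?MF. \<Phi> (ci.incl x A) = ?inc (\<Psi> A))"
    using key by (intro exI[of _ \<Psi>]) simp
  show vs: "vectorspace K ?MF" using MF K by (simp add: vectorspace_def)
  have "i \<in> {..r}" using i by simp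
  note Vi = irreducible_rep_fin_dim[OF k ci.finG irrV[OF this]]
  have "W i = power_module (V i) (n i)" by (simp add: W_def)
  note ext = sc.power_ext_dim[OF k K Vi, of "n i", folded this]
  show "vectorspace.fin_dim K ?MF" "vectorspace.dim K ?MF = n i * vectorspace.dim k (V i)"
    using vectorspace_iso_dim[OF vs ext(1) \<Psi> bij\<Psi> ext(2)] ext(3) by simp_all
qed

text \<open>The dimension of a vector space is the least size of a finite generating set and is
  unspecified if there is none. For this reason the conclusion records finite dimension along with
  the rank. The last clause ties \<open>\<Psi>\<close> to \<open>\<Phi>\<close>, so that the
  isomorphism in (ii) is the one induced by the inclusion and not merely an abstract one.\<close>

theorem theorem1:
  fixes k :: "'k ring" and G :: "'g monoid"
    and S :: "('x, 'a) ringed_space_data" and \<pi> :: "'x \<Rightarrow> 'k set"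
    and \<phi> :: "'k set set \<Rightarrow> ('k set \<Rightarrow> ('k \<times> 'k) set) \<Rightarrow> 'a" and \<epsilon> :: 'x
    and E :: "('x, 'a, 'e) module_sheaf_data" and \<rho> :: "('g \<Rightarrow> 'k) \<Rightarrow> 'x set \<Rightarrow> 'e \<Rightarrow> 'e"
    and r :: nat and V :: "nat \<Rightarrow> ('k, 'v) module" and \<sigma> :: "nat \<Rightarrow> 'g \<Rightarrow> 'v \<Rightarrow> 'v"
    and e :: "nat \<Rightarrow> 'g \<Rightarrow> 'k" and n :: "nat \<Rightarrow> nat"
    and \<Phi> :: "('x set \<times> 'e) set \<Rightarrow> ((nat \<Rightarrow> nat \<Rightarrow> 'v) \<times> ('x set \<times> 'a) set \<Rightarrow> 'k) set"
  defines "K \<equiv> function_field S \<epsilon>"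
    and "\<iota> \<equiv> scalar_germ k S \<pi> \<phi> \<epsilon>"
    and "W \<equiv> \<lambda>i. power_module (V i) (n i)"
    and "\<sigma>W \<equiv> \<lambda>i. power_action (n i) (\<sigma> i)"
    and "F \<equiv> \<lambda>i. image_sheaf S E (\<rho> (e i))"
    and "\<rho>F \<equiv> \<lambda>i. restrict_action S (image_sheaf S E (\<rho> (e i))) \<rho>"
  assumes "algebraically_closed k"
    and "group G" and "finite (carrier G)" and "\<not> ring_char k dvd order G"
    and "integral_scheme S" and "scheme_over k S \<pi> \<phi>" and "generic_point S \<epsilon>"
    and "OG_module k G S \<pi> \<phi> E \<rho>" and "coherent S E" and "torsion_free S E"
    and "irreducible_reps G k r V \<sigma>" and "central_idempotents G k r V \<sigma> e"
    and "rep_iso G K (stalk_module S E \<epsilon>) (stalk_action k G S E \<rho> \<epsilon>)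
           (scalar_extension k K \<iota> (sum_module {..r} W))
           (scalar_extension_action k K \<iota> (sum_module {..r} W) (sum_action {..r} \<sigma>W)) \<Phi>"
  shows "internal_direct_sum S E r F \<and>
    (\<forall>i\<le>r. OG_module k G S \<pi> \<phi> (F i) (\<rho>F i) \<and>
       vectorspace K (stalk_module S (F i) \<epsilon>) \<and>
       vectorspace.fin_dim K (stalk_module S (F i) \<epsilon>) \<and>
       sheaf_rank S \<epsilon> (F i) = n i * vectorspace.dim k (V i) \<and>
       (\<exists>\<Psi>. rep_iso G K (stalk_module S (F i) \<epsilon>) (stalk_action k G S (F i) (\<rho>F i) \<epsilon>)
               (scalar_extension k K \<iota> (W i)) (scalar_extension_action k K \<iota> (W i) (\<sigma>W i)) \<Psi> \<and>
             (\<forall>A\<in>carrier (stalk_module S (F i) \<epsilon>).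
                \<Phi> (stalk_map S E (\<lambda>U s. s) \<epsilon> A) =
                scalar_extension_map k K \<iota> (W i) (sum_module {..r} W) (sum_incl {..r} W i) (\<Psi> A))))"
proof -
  interpret alg: algebraically_closed k by fact
  have field_k: "field k" by (rule alg.field_axioms)
  have K: "field K" unfolding K_def by (rule function_field_is_field) fact+
  have mor: "lrs_morphism S (Spec k) \<pi> \<phi>" using \<open>scheme_over k S \<pi> \<phi>\<close> by (simp add: scheme_over_def)
  have \<epsilon>: "\<epsilon> \<in> topspace (pts S)" using \<open>generic_point S \<epsilon>\<close> by (simp add: generic_point_def)
  have OG: "OG_module k G S \<pi> \<phi> E \<rho>" by fact
  interpret group_sheaf k G S \<pi> \<phi> E \<rho>
    by (intro group_sheaf.intro sheaf_of_modules.intro group_sheaf_axioms.intro OG_module.axioms(1)[OF OG] OG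
        integral_scheme_ringed_space alg.is_cring mor) fact+
  have cis: "central_idempotents G k r V \<sigma> e" by fact
  note ci1 = cis[unfolded central_idempotents_def, THEN conjunct1, rule_format]
  note ci2 = cis[unfolded central_idempotents_def, THEN conjunct2, THEN conjunct1, rule_format]
  note ci3 = cis[unfolded central_idempotents_def, THEN conjunct2, THEN conjunct2, THEN conjunct1]
  have ci: "central_idempotent k G S \<pi> \<phi> E \<rho> (e i)" if i: "i \<le> r" for i
  proof (intro central_idempotent.intro central_idempotent_axioms.intro group_sheaf_axioms)
    show "e i \<in> carrier GA" using ci1[OF i] by (rule conjunct1)
    show "e i \<otimes>\<^bsub>GA\<^esub> e i = e i" using ci2[OF i i] by (simp only: refl if_True)
    show "e i \<otimes>\<^bsub>GA\<^esub> a = a \<otimes>\<^bsub>GA\<^esub> e i" if "a \<in> carrier GA" for a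
      using ci1[OF i, THEN conjunct2] that by (rule bspec)
  qed
  have sum: "internal_direct_sum S E r F"
    unfolding F_def
  proof (rule direct_sum[OF ci _ ci3])
    show "e i \<otimes>\<^bsub>GA\<^esub> e j = \<zero>\<^bsub>GA\<^esub>" if "i \<le> r" "j \<le> r" "i \<noteq> j" for i j
      using ci2[OF that(1,2)] that(3) by (simp only: if_False)
  qed
  note iso = group_sheaf_stalk_iso[OF ci field_k K[unfolded K_def] \<epsilon> \<open>irreducible_reps G k r V \<sigma>\<close> cis _
      \<open>rep_iso G K _ _ _ _ _\<close>[unfolded K_def \<iota>_def W_def \<sigma>W_def]]
  show ?thesis
  proof (intro conjI allI impI sum)
    fix i assume i: "i \<le> r"
    show "OG_module k G S \<pi> \<phi> (F i) (\<rho>F i)"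
      unfolding F_def \<rho>F_def by (rule central_idempotent.F_OG_module[OF ci[OF i]])
    show "vectorspace K (stalk_module S (F i) \<epsilon>)"
      unfolding K_def F_def by (rule iso(2)[OF i i])
    show "vectorspace.fin_dim K (stalk_module S (F i) \<epsilon>)"
      unfolding K_def F_def by (rule iso(3)[OF i i])
    show "sheaf_rank S \<epsilon> (F i) = n i * vectorspace.dim k (V i)"
      unfolding sheaf_rank_def F_def by (rule iso(4)[OF i i])
    show "\<exists>\<Psi>. rep_iso G K (stalk_module S (F i) \<epsilon>) (stalk_action k G S (F i) (\<rho>F i) \<epsilon>)
               (scalar_extension k K \<iota> (W i)) (scalar_extension_action k K \<iota> (W i) (\<sigma>W i)) \<Psi> \<and>
             (\<forall>A\<in>carrier (stalk_module S (F i) \<epsilon>).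
                \<Phi> (stalk_map S E (\<lambda>U s. s) \<epsilon> A) =
                scalar_extension_map k K \<iota> (W i) (sum_module {..r} W) (sum_incl {..r} W i) (\<Psi> A))"
      unfolding K_def \<iota>_def W_def \<sigma>W_def F_def \<rho>F_def by (rule iso(1)[OF i i])
  qed
qed

end
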